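(* Let $K$ be an algebraically closed field of characteristic zero, let $Q$ be a connected affine algebraic group over $K$, and let $\mathfrak q=\mathrm{Lie}\,Q$. If $\mathrm{ind}\,\mathfrak q=1$ and the radical of $\mathfrak q$ consists of $\mathrm{ad}$-nilpotent elements, then $\mathfrak q$ is contact.
   Context: A finite-dimensional Lie algebra $\mathfrak q$ is called contact if $\dim\mathfrak q=2n+1$ is odd and there is $\alpha\in\mathfrak q^*$ with $(d_{\mathfrak q}\alpha)^{\wedge n}\wedge\alpha\neq 0$, where $d_{\mathfrak q}\alpha\in\wedge^2\mathfrak q^*$ is the Chevalley--Eilenberg differential, $d_{\mathfrak q}\alpha(\xi,\eta)=-\alpha([\xi,\eta])$ (up to an irrelevant sign convention). The index is $\mathrm{ind}\,\mathfrak q=\min_{\gamma\in\mathfrak q^*}\dim\mathfrak q_\gamma$, where $\mathfrak q_\gamma=\{\xi\in\mathfrak q\mid\gamma([\xi,\mathfrak q])=0\}$. The radical is the largest solvable ideal; $x\in\mathfrak q$ is $\mathrm{ad}$-nilpotent if $\mathrm{ad}(x):\mathfrak q\to\mathfrak q$ is nilpotent. *)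

theory Defs
  imports
    "HOL-Analysis.Abstract_Topology"
    "HOL-Algebra.Group"
    "HOL-Combinatorics.Permutations"
    "HOL-Computational_Algebra.Polynomial"
    "HOL-Library.Function_Algebras"
    "HOL-Library.Indicator_Function"
begin

section \<open>Exterior products of alternating forms\<close>

text \<open>
  In characteristic 0 the exterior power \<open>\<Lambda>\<^sup>p V\<^sup>*\<close> is identified with the alternating \<open>p\<close>-linear
  forms on \<open>V\<close>.  A \<open>p\<close>-form is a function of a sequence of vectors, of which only the entries
  \<open>0, \<dots>, p - 1\<close> are used; its degree is passed separately.
\<close>

definition wedge ::
  "nat \<Rightarrow> nat \<Rightarrow> ((nat \<Rightarrow> 'v) \<Rightarrow> 'k::field_char_0) \<Rightarrow> ((nat \<Rightarrow> 'v) \<Rightarrow> 'k) \<Rightarrow> (nat \<Rightarrow> 'v) \<Rightarrow> 'k" where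
  "wedge p q \<omega> \<eta> = (\<lambda>v.
     (\<Sum>\<sigma> | \<sigma> permutes {..<p + q}.
        of_int (sign \<sigma>) * \<omega> (\<lambda>i. v (\<sigma> i)) * \<eta> (\<lambda>i. v (\<sigma> (p + i)))) / (fact p * fact q))"

primrec wedge_power ::
  "nat \<Rightarrow> ((nat \<Rightarrow> 'v) \<Rightarrow> 'k::field_char_0) \<Rightarrow> nat \<Rightarrow> (nat \<Rightarrow> 'v) \<Rightarrow> 'k" where
  "wedge_power p \<omega> 0 = (\<lambda>v. 1)"
| "wedge_power p \<omega> (Suc n) = wedge p (n * p) \<omega> (wedge_power p \<omega> n)"


section \<open>Finite-dimensional Lie algebras\<close>

text \<open>The Lie algebra is a subspace \<open>L\<close> of an ambient vector space.\<close>

locale fin_dim_lie_algebra = vector_space scale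
  for scale :: "'k::field_char_0 \<Rightarrow> 'v::ab_group_add \<Rightarrow> 'v" (infixr "*s" 75) +
  fixes L :: "'v set" and br :: "'v \<Rightarrow> 'v \<Rightarrow> 'v"
  assumes subspace_L: "subspace L"
    and fin_dim: "\<exists>B. finite B \<and> L \<subseteq> span B"
    and br_closed: "\<lbrakk>x \<in> L; y \<in> L\<rbrakk> \<Longrightarrow> br x y \<in> L"
    and br_add_left: "\<lbrakk>x \<in> L; y \<in> L; z \<in> L\<rbrakk> \<Longrightarrow> br (x + y) z = br x z + br y z"
    and br_add_right: "\<lbrakk>x \<in> L; y \<in> L; z \<in> L\<rbrakk> \<Longrightarrow> br x (y + z) = br x y + br x z"
    and br_scale_left: "\<lbrakk>x \<in> L; y \<in> L\<rbrakk> \<Longrightarrow> br (c *s x) y = c *s br x y"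
    and br_scale_right: "\<lbrakk>x \<in> L; y \<in> L\<rbrakk> \<Longrightarrow> br x (c *s y) = c *s br x y"
    and br_self: "x \<in> L \<Longrightarrow> br x x = 0"
    and jacobi: "\<lbrakk>x \<in> L; y \<in> L; z \<in> L\<rbrakk> \<Longrightarrow>
      br x (br y z) + br y (br z x) + br z (br x y) = 0"
begin

text \<open>Only the values on \<open>L\<close> of a linear form matter.\<close>

definition linear_form :: "('v \<Rightarrow> 'k) \<Rightarrow> bool" where
  "linear_form \<alpha> \<longleftrightarrow>
     (\<forall>x\<in>L. \<forall>y\<in>L. \<alpha> (x + y) = \<alpha> x + \<alpha> y) \<and> (\<forall>c. \<forall>x\<in>L. \<alpha> (c *s x) = c * \<alpha> x)"

definition differential :: "('v \<Rightarrow> 'k) \<Rightarrow> (nat \<Rightarrow> 'v) \<Rightarrow> 'k" where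
  "differential \<alpha> = (\<lambda>v. - \<alpha> (br (v 0) (v 1)))"

definition contact :: bool where
  "contact \<longleftrightarrow> (\<exists>n \<alpha>. dim L = 2 * n + 1 \<and> linear_form \<alpha> \<and>
     (\<exists>v. (\<forall>i < 2 * n + 1. v i \<in> L) \<and>
        wedge (2 * n) 1 (wedge_power 2 (differential \<alpha>) n) (\<lambda>u. \<alpha> (u 0)) v \<noteq> 0))"

definition stabilizer :: "('v \<Rightarrow> 'k) \<Rightarrow> 'v set" where
  "stabilizer \<gamma> = {\<xi>\<in>L. \<forall>\<eta>\<in>L. \<gamma> (br \<xi> \<eta>) = 0}"

definition index :: nat where
  "index = Inf {dim (stabilizer \<gamma>) | \<gamma>. linear_form \<gamma>}"

definition lie_ideal :: "'v set \<Rightarrow> bool" where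
  "lie_ideal I \<longleftrightarrow> subspace I \<and> I \<subseteq> L \<and> (\<forall>x\<in>L. \<forall>y\<in>I. br x y \<in> I)"

definition derived :: "'v set \<Rightarrow> 'v set" where
  "derived I = span {br x y | x y. x \<in> I \<and> y \<in> I}"

definition solvable :: "'v set \<Rightarrow> bool" where
  "solvable I \<longleftrightarrow> (\<exists>n. (derived ^^ n) I = {0})"

definition radical :: "'v set" where
  "radical = (GREATEST I. lie_ideal I \<and> solvable I)"

definition ad_nilpotent :: "'v \<Rightarrow> bool" where
  "ad_nilpotent x \<longleftrightarrow> (\<exists>n. \<forall>y\<in>L. (br x ^^ n) y = 0)"

end


section \<open>Affine varieties\<close>

text \<open>
  Functions on a set \<open>X\<close> of points are extended by 0 outside \<open>X\<close>, so that the unit of an algebra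
  of functions on \<open>X\<close> is \<open>indicator X\<close>.
\<close>

definition function_algebra :: "'p set \<Rightarrow> ('p \<Rightarrow> 'k::field) set \<Rightarrow> bool" where
  "function_algebra X A \<longleftrightarrow>
     (\<forall>f\<in>A. \<forall>x. x \<notin> X \<longrightarrow> f x = 0) \<and> indicator X \<in> A \<and>
     (\<forall>f\<in>A. \<forall>g\<in>A. f + g \<in> A \<and> f * g \<in> A) \<and> (\<forall>c. \<forall>f\<in>A. (\<lambda>x. c * f x) \<in> A)"

definition algebra_hom :: "'p set \<Rightarrow> ('p \<Rightarrow> 'k::field) set \<Rightarrow> (('p \<Rightarrow> 'k) \<Rightarrow> 'k) \<Rightarrow> bool" where
  "algebra_hom X A \<phi> \<longleftrightarrow>
     \<phi> (indicator X) = 1 \<and>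
     (\<forall>f\<in>A. \<forall>g\<in>A. \<phi> (f + g) = \<phi> f + \<phi> g \<and> \<phi> (f * g) = \<phi> f * \<phi> g) \<and>
     (\<forall>c. \<forall>f\<in>A. \<phi> (\<lambda>x. c * f x) = c * \<phi> f)"

text \<open>
  An affine variety over an algebraically closed field, possibly reducible, is given
  intrinsically (without choosing a closed embedding into affine space) by its set \<open>X\<close> of points
  and its algebra \<open>A\<close> of regular functions.  A choice of \<open>n\<close> generators of \<open>A\<close> identifies \<open>X\<close> with
  a Zariski closed subset of \<open>K\<^sup>n\<close>, and \<open>A\<close> with the restrictions of polynomials.
\<close>

locale affine_variety =
  fixes X :: "'p set" and A :: "('p \<Rightarrow> 'k::{alg_closed_field, field_char_0}) set"
  assumes function_algebra: "function_algebra X A"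
    and finitely_generated:
      "\<exists>S. finite S \<and> S \<subseteq> A \<and> (\<forall>B. function_algebra X B \<and> S \<subseteq> B \<longrightarrow> A \<subseteq> B)"
    and points: "algebra_hom X A \<phi> \<Longrightarrow> \<exists>!x. x \<in> X \<and> (\<forall>f\<in>A. \<phi> f = f x)"
begin

definition zariski_open :: "'p set \<Rightarrow> bool" where
  "zariski_open U \<longleftrightarrow> (\<exists>S\<subseteq>A. U = X - {x\<in>X. \<forall>f\<in>S. f x = 0})"

definition zariski :: "'p topology" where
  "zariski = topology zariski_open"

lemma zariski_open_iff:
  "zariski_open U \<longleftrightarrow> (\<exists>S\<subseteq>A. \<forall>x. x \<in> U \<longleftrightarrow> x \<in> X \<and> (\<exists>f\<in>S. f x \<noteq> 0))"
  unfolding zariski_open_def set_eq_iff by (simp cong: conj_cong)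

lemma istopology_zariski: "istopology zariski_open"
  unfolding istopology_def
proof (intro conjI allI impI)
  fix U V assume "zariski_open U" "zariski_open V"
  then obtain S T where S: "S \<subseteq> A" "\<And>x. x \<in> U \<longleftrightarrow> x \<in> X \<and> (\<exists>f\<in>S. f x \<noteq> 0)"
    and T: "T \<subseteq> A" "\<And>x. x \<in> V \<longleftrightarrow> x \<in> X \<and> (\<exists>f\<in>T. f x \<noteq> 0)"
    unfolding zariski_open_iff by metis
  let ?P = "(\<lambda>(f, g). f * g) ` (S \<times> T)"
  have "?P \<subseteq> A"
    using S(1) T(1) function_algebra unfolding function_algebra_def by (auto simp: subset_iff)
  moreover have "x \<in> U \<inter> V \<longleftrightarrow> x \<in> X \<and> (\<exists>f\<in>?P. f x \<noteq> 0)" for x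
    by (auto simp: S(2) T(2))
  ultimately show "zariski_open (U \<inter> V)"
    unfolding zariski_open_iff by (intro exI[of _ ?P] conjI allI)
next
  fix \<U> assume "\<forall>U\<in>\<U>. zariski_open U"
  then obtain S where S: "\<And>U. U \<in> \<U> \<Longrightarrow> S U \<subseteq> A"
    "\<And>U x. U \<in> \<U> \<Longrightarrow> x \<in> U \<longleftrightarrow> x \<in> X \<and> (\<exists>f\<in>S U. f x \<noteq> 0)"
    unfolding zariski_open_iff by metis
  have "x \<in> \<Union>\<U> \<longleftrightarrow> x \<in> X \<and> (\<exists>f\<in>\<Union>(S ` \<U>). f x \<noteq> 0)" for x
    by (auto simp: S(2))
  moreover have "\<Union>(S ` \<U>) \<subseteq> A"
    using S(1) by (rule UN_least)
  ultimately show "zariski_open (\<Union>\<U>)"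
    unfolding zariski_open_iff by (intro exI[of _ "\<Union>(S ` \<U>)"] conjI allI)
qed

lemma openin_zariski: "openin zariski U \<longleftrightarrow> zariski_open U"
  by (simp add: zariski_def istopology_zariski)

lemma topspace_zariski: "topspace zariski = X"
proof -
  have "\<exists>f\<in>{indicator X}. f x \<noteq> (0::'k)" if "x \<in> X" for x
    using that by simp
  moreover have "{indicator X} \<subseteq> A"
    using function_algebra unfolding function_algebra_def by simp
  ultimately have "zariski_open X"
    unfolding zariski_open_iff by blast
  moreover have "\<And>U. zariski_open U \<Longrightarrow> U \<subseteq> X"
    unfolding zariski_open_def by blast
  ultimately show ?thesis
    unfolding topspace_def openin_zariski by blast
qed

lemma regular_add: "f \<in> A \<Longrightarrow> g \<in> A \<Longrightarrow> f + g \<in> A"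
  and regular_mult: "f \<in> A \<Longrightarrow> g \<in> A \<Longrightarrow> f * g \<in> A"
  and regular_scale: "f \<in> A \<Longrightarrow> (\<lambda>x. c * f x) \<in> A"
  and regular_one: "indicator X \<in> A"
  and regular_outside: "f \<in> A \<Longrightarrow> x \<notin> X \<Longrightarrow> f x = 0"
  using function_algebra unfolding function_algebra_def by blast+

lemma regular_zero: "0 \<in> A"
proof -
  have "(\<lambda>x. 0 * indicator X x) \<in> A"
    using regular_scale[OF regular_one] .
  then show ?thesis by (simp add: zero_fun_def)
qed

lemma regular_diff: "f \<in> A \<Longrightarrow> g \<in> A \<Longrightarrow> f - g \<in> A"
proof -
  assume "f \<in> A" "g \<in> A"
  then have "f + (\<lambda>x. (-1) * g x) \<in> A"
    by (intro regular_add regular_scale)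
  moreover have "f + (\<lambda>x. (-1) * g x) = f - g"
    by (simp add: fun_eq_iff)
  ultimately show ?thesis by metis
qed

lemma regular_sum: "(\<And>i. i \<in> I \<Longrightarrow> f i \<in> A) \<Longrightarrow> sum f I \<in> A"
  by (induction I rule: infinite_finite_induct) (auto intro: regular_add regular_zero)

end


section \<open>Affine algebraic groups and their Lie algebras\<close>

text \<open>
  The regular functions on the product variety \<open>G \<times> G\<close> are the finite sums of the functions
  \<open>(x, y) \<mapsto> g x * h y\<close> with \<open>g\<close> and \<open>h\<close> regular on \<open>G\<close>.
\<close>

locale affine_algebraic_group = group G + affine_variety "carrier G" A
  for G (structure) and A :: "('g \<Rightarrow> 'k::{alg_closed_field, field_char_0}) set" +
  assumes mult_regular: "f \<in> A \<Longrightarrow> \<exists>(n::nat) g h. (\<forall>i<n. g i \<in> A \<and> h i \<in> A) \<and>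
      (\<forall>x\<in>carrier G. \<forall>y\<in>carrier G. f (x \<otimes> y) = (\<Sum>i<n. g i x * h i y))"
    and inv_regular: "f \<in> A \<Longrightarrow> (\<lambda>x. if x \<in> carrier G then f (inv x) else 0) \<in> A"
begin

definition left_translate :: "'g \<Rightarrow> ('g \<Rightarrow> 'k) \<Rightarrow> 'g \<Rightarrow> 'k" where
  "left_translate x f = (\<lambda>y. if y \<in> carrier G then f (inv x \<otimes> y) else 0)"

text \<open>
  The Lie algebra consists of the left-invariant derivations of \<open>A\<close>.  As operators on all
  functions, they are extended by 0 outside \<open>A\<close>.
\<close>

definition Lie :: "(('g \<Rightarrow> 'k) \<Rightarrow> ('g \<Rightarrow> 'k)) set" where
  "Lie = {D. (\<forall>f. f \<notin> A \<longrightarrow> D f = 0) \<and> (\<forall>f\<in>A. D f \<in> A) \<and>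
     (\<forall>f\<in>A. \<forall>g\<in>A. D (f + g) = D f + D g) \<and>
     (\<forall>c. \<forall>f\<in>A. D (\<lambda>x. c * f x) = (\<lambda>x. c * D f x)) \<and>
     (\<forall>f\<in>A. \<forall>g\<in>A. D (f * g) = D f * g + f * D g) \<and>
     (\<forall>x\<in>carrier G. \<forall>f\<in>A. D (left_translate x f) = left_translate x (D f))}"

end

definition op_scale :: "'k::field \<Rightarrow> (('g \<Rightarrow> 'k) \<Rightarrow> ('g \<Rightarrow> 'k)) \<Rightarrow> ('g \<Rightarrow> 'k) \<Rightarrow> 'g \<Rightarrow> 'k" where
  "op_scale c D = (\<lambda>f x. c * D f x)"

definition commutator ::
  "(('g \<Rightarrow> 'k::field) \<Rightarrow> ('g \<Rightarrow> 'k)) \<Rightarrow> (('g \<Rightarrow> 'k) \<Rightarrow> ('g \<Rightarrow> 'k)) \<Rightarrow> ('g \<Rightarrow> 'k) \<Rightarrow> 'g \<Rightarrow> 'k" where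
  "commutator D E = (\<lambda>f. D (E f) - E (D f))"

lemma vector_space_op_scale: "vector_space op_scale"
  by standard (simp_all add: op_scale_def fun_eq_iff algebra_simps)

context affine_algebraic_group
begin

lemma left_translate_regular:
  assumes "x \<in> carrier G" "f \<in> A"
  shows "left_translate x f \<in> A"
proof -
  obtain n :: nat and g h where gh: "\<forall>i<n. g i \<in> A \<and> h i \<in> A"
    and eq: "\<forall>x\<in>carrier G. \<forall>y\<in>carrier G. f (x \<otimes> y) = (\<Sum>i<n. g i x * h i y)"
    using mult_regular[OF assms(2)] by blast
  have "left_translate x f = (\<Sum>i<n. (\<lambda>y. g i (inv x) * h i y))"
  proof
    fix y
    have sum_app: "(\<Sum>i<m. (\<lambda>y. g i (inv x) * h i y)) y = (\<Sum>i<m. g i (inv x) * h i y)" for m :: nat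
      by (induction m) auto
    show "left_translate x f y = (\<Sum>i<n. (\<lambda>y. g i (inv x) * h i y)) y"
    proof (cases "y \<in> carrier G")
      case True
      then show ?thesis
        using eq assms(1) unfolding sum_app by (simp add: left_translate_def)
    next
      case False
      then have "h i y = 0" if "i < n" for i
        using gh regular_outside that by blast
      then show ?thesis
        using False unfolding sum_app by (simp add: left_translate_def)
    qed
  qed
  then show ?thesis
    using gh by (auto intro: regular_sum regular_scale)
qed

lemma LieI:
  assumes "\<And>f. f \<notin> A \<Longrightarrow> D f = 0" and "\<And>f. f \<in> A \<Longrightarrow> D f \<in> A"
    and "\<And>f g. f \<in> A \<Longrightarrow> g \<in> A \<Longrightarrow> D (f + g) = D f + D g"
    and "\<And>c f. f \<in> A \<Longrightarrow> D (\<lambda>x. c * f x) = (\<lambda>x. c * D f x)"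
    and "\<And>f g. f \<in> A \<Longrightarrow> g \<in> A \<Longrightarrow> D (f * g) = D f * g + f * D g"
    and "\<And>x f. x \<in> carrier G \<Longrightarrow> f \<in> A \<Longrightarrow> D (left_translate x f) = left_translate x (D f)"
  shows "D \<in> Lie"
  using assms unfolding Lie_def by blast

lemma
  assumes "D \<in> Lie"
  shows Lie_outside: "f \<notin> A \<Longrightarrow> D f = 0"
    and Lie_add: "f \<in> A \<Longrightarrow> g \<in> A \<Longrightarrow> D (f + g) = D f + D g"
    and Lie_scale: "f \<in> A \<Longrightarrow> D (\<lambda>x. c * f x) = (\<lambda>x. c * D f x)"
    and Lie_leibniz: "f \<in> A \<Longrightarrow> g \<in> A \<Longrightarrow> D (f * g) = D f * g + f * D g"
    and Lie_translate:
      "x \<in> carrier G \<Longrightarrow> f \<in> A \<Longrightarrow> D (left_translate x f) = left_translate x (D f)"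
  using assms unfolding Lie_def by blast+

lemma Lie_regular: "D \<in> Lie \<Longrightarrow> D f \<in> A"
  unfolding Lie_def using regular_zero by (cases "f \<in> A") auto

lemma Lie_zero: "D \<in> Lie \<Longrightarrow> D 0 = 0"
  using Lie_add[of D 0 0] regular_zero by simp

lemma Lie_diff: "D \<in> Lie \<Longrightarrow> f \<in> A \<Longrightarrow> g \<in> A \<Longrightarrow> D (f - g) = D f - D g"
  using Lie_add[of D "f - g" g] regular_diff[of f g] by simp

lemma left_translate_simps:
  "left_translate x (f + g) = left_translate x f + left_translate x g"
  "left_translate x (f - g) = left_translate x f - left_translate x g"
  "left_translate x 0 = 0"
  "left_translate x (\<lambda>y. c * f y) = (\<lambda>y. c * left_translate x f y)"
  unfolding left_translate_def by (rule ext; simp)+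

lemma Lie_zero_closed: "0 \<in> Lie"
proof (rule LieI, goal_cases)
  case (4 c f)
  show ?case unfolding zero_fun_apply mult_zero_right zero_fun_def ..
qed (simp_all only: zero_fun_apply regular_zero add_0_left mult_zero_left mult_zero_right
    left_translate_simps)

lemma Lie_add_closed:
  assumes D: "D \<in> Lie" and E: "E \<in> Lie" shows "D + E \<in> Lie"
proof -
  have app: "(D + E) f = D f + E f" for f by (rule plus_fun_apply)
  show ?thesis
  proof (rule LieI, goal_cases)
    case (1 f)
    show ?case unfolding app Lie_outside[OF D 1] Lie_outside[OF E 1] by (intro ext) simp
  next
    case (2 f)
    show ?case unfolding app by (intro regular_add Lie_regular D E)
  next
    case (3 f g)
    show ?case unfolding app Lie_add[OF D 3] Lie_add[OF E 3]
      by (simp only: add_ac)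
  next
    case (4 c f)
    show ?case unfolding app Lie_scale[OF D 4] Lie_scale[OF E 4]
      by (intro ext) (simp add: distrib_left)
  next
    case (5 f g)
    show ?case unfolding app Lie_leibniz[OF D 5] Lie_leibniz[OF E 5]
      by (intro ext) (simp add: algebra_simps)
  next
    case (6 x f)
    show ?case
      unfolding app Lie_translate[OF D 6] Lie_translate[OF E 6] left_translate_simps ..
  qed
qed

lemma Lie_scale_closed:
  assumes D: "D \<in> Lie" shows "op_scale c D \<in> Lie"
proof (rule LieI, goal_cases)
  case (1 f)
  show ?case unfolding op_scale_def Lie_outside[OF D 1] by (intro ext) simp
next
  case (2 f)
  show ?case unfolding op_scale_def by (intro regular_scale Lie_regular D)
next
  case (3 f g)
  show ?case unfolding op_scale_def Lie_add[OF D 3]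
    by (intro ext) (simp add: distrib_left)
next
  case (4 d f)
  show ?case unfolding op_scale_def Lie_scale[OF D 4]
    by (intro ext) (simp add: mult.left_commute)
next
  case (5 f g)
  show ?case unfolding op_scale_def Lie_leibniz[OF D 5]
    by (intro ext) (simp add: algebra_simps)
next
  case (6 x f)
  show ?case unfolding op_scale_def Lie_translate[OF D 6] left_translate_simps ..
qed

lemma Lie_commutator_closed:
  assumes D: "D \<in> Lie" and E: "E \<in> Lie" shows "commutator D E \<in> Lie"
proof (rule LieI, goal_cases)
  case (1 f)
  show ?case
    unfolding commutator_def Lie_outside[OF D 1] Lie_outside[OF E 1] Lie_zero[OF D] Lie_zero[OF E]
    by simp
next
  case (2 f)
  show ?case unfolding commutator_def by (intro regular_diff Lie_regular D E)
next
  case (3 f g)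
  show ?case
    unfolding commutator_def Lie_add[OF D 3] Lie_add[OF E 3]
      Lie_add[OF D Lie_regular[OF E] Lie_regular[OF E]]
      Lie_add[OF E Lie_regular[OF D] Lie_regular[OF D]]
    by (intro ext) simp
next
  case (4 c f)
  show ?case
    unfolding commutator_def Lie_scale[OF D 4] Lie_scale[OF E 4]
      Lie_scale[OF D Lie_regular[OF E]] Lie_scale[OF E Lie_regular[OF D]]
    by (intro ext) (simp add: algebra_simps)
next
  case (5 f g)
  note m = regular_mult[OF Lie_regular[OF D] 5(2)] regular_mult[OF Lie_regular[OF E] 5(2)]
    regular_mult[OF 5(1) Lie_regular[OF D]] regular_mult[OF 5(1) Lie_regular[OF E]]
  show ?case
    unfolding commutator_def Lie_leibniz[OF D 5] Lie_leibniz[OF E 5]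
      Lie_add[OF D m(2,4)] Lie_add[OF E m(1,3)]
      Lie_leibniz[OF D Lie_regular[OF E] 5(2)] Lie_leibniz[OF E Lie_regular[OF D] 5(2)]
      Lie_leibniz[OF D 5(1) Lie_regular[OF E]] Lie_leibniz[OF E 5(1) Lie_regular[OF D]]
    by (intro ext) (simp add: algebra_simps)
next
  case (6 x f)
  show ?case
    unfolding commutator_def Lie_translate[OF D 6] Lie_translate[OF E 6]
      Lie_translate[OF D 6(1) Lie_regular[OF E]] Lie_translate[OF E 6(1) Lie_regular[OF D]]
      left_translate_simps ..
qed

lemma Lie_eq_0:
  assumes D: "D \<in> Lie" and S: "\<forall>B. function_algebra (carrier G) B \<and> S \<subseteq> B \<longrightarrow> A \<subseteq> B" "S \<subseteq> A"
    and 0: "\<forall>f\<in>S. D f \<one> = 0"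
  shows "D = 0"
proof -
  let ?B = "{f\<in>A. D f \<one> = 0}"
  have "D (indicator (carrier G) * indicator (carrier G)) =
      D (indicator (carrier G)) * indicator (carrier G) + indicator (carrier G) * D (indicator (carrier G))"
    using D regular_one unfolding Lie_def by blast
  moreover have "indicator (carrier G) * indicator (carrier G) = (indicator (carrier G) :: 'g \<Rightarrow> 'k)"
    by (simp add: fun_eq_iff indicator_def)
  ultimately have "D (indicator (carrier G)) =
      D (indicator (carrier G)) * indicator (carrier G) + indicator (carrier G) * D (indicator (carrier G))"
    by simp
  from fun_cong[OF this, of \<one>] have one: "D (indicator (carrier G)) \<one> = 0"
    by simp
  have "function_algebra (carrier G) ?B"
    unfolding function_algebra_def
    using D regular_one one regular_outside
    by (auto simp: Lie_def intro: regular_add regular_mult regular_scale)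
  then have A: "D f \<one> = 0" if "f \<in> A" for f
    using S 0 that by blast
  show ?thesis
  proof (intro ext)
    fix f x
    show "D f x = (0 :: ('g \<Rightarrow> 'k) \<Rightarrow> ('g \<Rightarrow> 'k)) f x"
    proof (cases "f \<in> A \<and> x \<in> carrier G")
      case True
      then have "D (left_translate (inv x) f) = left_translate (inv x) (D f)"
        using D unfolding Lie_def by blast
      moreover have "D (left_translate (inv x) f) \<one> = 0"
        using True by (intro A left_translate_regular) auto
      ultimately show ?thesis
        using True by (simp add: left_translate_def)
    next
      case False
      then show ?thesis
        using D regular_outside unfolding Lie_def by (cases "f \<in> A") auto
    qed
  qed
qed

lemma Lie_fin_dim: "\<exists>B. finite B \<and> Lie \<subseteq> module.span op_scale B"
proof -
  interpret V: vector_space "op_scale :: 'k \<Rightarrow> (('g \<Rightarrow> 'k) \<Rightarrow> ('g \<Rightarrow> 'k)) \<Rightarrow> _"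
    by (rule vector_space_op_scale)
  define sc where "sc = (\<lambda>(c::'k) (u::('g \<Rightarrow> 'k) \<Rightarrow> 'k) f. c * u f)"
  interpret W: vector_space sc
    by standard (simp_all add: sc_def fun_eq_iff algebra_simps)
  obtain S where S: "finite S" "S \<subseteq> A" "\<forall>B. function_algebra (carrier G) B \<and> S \<subseteq> B \<longrightarrow> A \<subseteq> B"
    using finitely_generated by blast
  define \<Phi> where "\<Phi> D = (\<lambda>f. if f \<in> S then D f \<one> else 0)" for D :: "('g \<Rightarrow> 'k) \<Rightarrow> ('g \<Rightarrow> 'k)"
  interpret \<Phi>: Vector_Spaces.linear op_scale sc \<Phi>
    by unfold_locales (auto simp: \<Phi>_def op_scale_def sc_def fun_eq_iff)
  obtain B where B: "B \<subseteq> Lie" "\<not> V.dependent B" "Lie \<subseteq> V.span B"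
    using V.maximal_independent_subset[of Lie] by metis
  have sub: "V.subspace Lie"
    by (rule V.subspaceI) (rule Lie_zero_closed Lie_add_closed Lie_scale_closed; assumption)+
  have span: "V.span B \<subseteq> Lie"
    using V.span_minimal[OF B(1) sub] .
  have inj: "inj_on \<Phi> (V.span B)"
  proof (rule inj_onI)
    fix D E assume DE: "D \<in> V.span B" "E \<in> V.span B" "\<Phi> D = \<Phi> E"
    have "D f \<one> = E f \<one>" if "f \<in> S" for f
      using fun_cong[OF DE(3), of f] that by (simp add: \<Phi>_def)
    moreover have "D - E \<in> Lie"
      using V.span_diff[OF DE(1,2)] span by blast
    ultimately have "D - E = 0"
      by (intro Lie_eq_0[OF _ S(3,2)]) auto
    then show "D = E" by (metis eq_iff_diff_eq_0)
  qed
  then have ind: "\<not> W.dependent (\<Phi> ` B)"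
    using \<Phi>.independent_injective_image[OF B(2)] by blast
  let ?T = "(\<lambda>s f. if f = s then 1 else 0) ` S"
  have "\<Phi> D \<in> W.span ?T" for D
  proof -
    have "\<Phi> D = (\<Sum>s\<in>S. sc (D s \<one>) (\<lambda>f. if f = s then 1 else 0))"
    proof
      fix f
      have "(\<Sum>s\<in>S'. sc (D s \<one>) (\<lambda>f. if f = s then 1 else 0)) f =
          (\<Sum>s\<in>S'. if f = s then D s \<one> else 0)" if "finite S'" for S'
        using that by (induction S' rule: finite_induct) (auto simp: sc_def)
      then show "\<Phi> D f = (\<Sum>s\<in>S. sc (D s \<one>) (\<lambda>f. if f = s then 1 else 0)) f"
        using S(1) by (simp add: \<Phi>_def)
    qed
    then show ?thesis
      by (simp only:) (intro W.span_sum W.span_scale W.span_base imageI)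
  qed
  then have "\<Phi> ` B \<subseteq> W.span ?T" by blast
  then have "finite (\<Phi> ` B)"
    using W.independent_span_bound[OF _ ind] S(1) by blast
  then have "finite B"
    using inj_on_subset[OF inj V.span_superset] by (rule finite_imageD)
  then show ?thesis
    using B by blast
qed

sublocale Lie: fin_dim_lie_algebra op_scale Lie commutator
proof -
  interpret V: vector_space "op_scale :: 'k \<Rightarrow> (('g \<Rightarrow> 'k) \<Rightarrow> ('g \<Rightarrow> 'k)) \<Rightarrow> _"
    by (rule vector_space_op_scale)
  note ap = Lie_add[OF _ Lie_regular Lie_regular]
  note am = Lie_diff[OF _ Lie_regular Lie_regular]
  note as = Lie_scale[OF _ Lie_regular]
  show "fin_dim_lie_algebra op_scale Lie commutator"
  proof (standard, goal_cases)
    case 1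
    show ?case
      by (rule V.subspaceI) (rule Lie_zero_closed Lie_add_closed Lie_scale_closed; assumption)+
  next
    case 2
    show ?case by (rule Lie_fin_dim)
  next
    case (3 D E)
    then show ?case by (rule Lie_commutator_closed)
  next
    case (4 D E F)
    then show ?case
      by (intro ext) (simp add: commutator_def ap)
  next
    case (5 D E F)
    then show ?case
      by (intro ext) (simp add: commutator_def ap)
  next
    case (6 D E c)
    then show ?case
      by (intro ext) (simp add: commutator_def op_scale_def as right_diff_distrib)
  next
    case (7 D E c)
    then show ?case
      by (intro ext) (simp add: commutator_def op_scale_def as right_diff_distrib)
  next
    case (8 D)
    show ?case by (intro ext) (simp add: commutator_def)
  next
    case (9 D E F)
    then show ?case
      by (intro ext) (simp add: commutator_def am)
  qed
qed

end

end

theory Submission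
  imports Defs
begin

text \<open>
  Only two properties of the Lie algebra \<open>q\<close> matter: its index is 1 and it is unimodular.
  Unimodularity follows from a form of Cartan's criterion: the orthogonal \<open>J\<close> of \<open>[q, q]\<close> under the
  Killing form is a solvable ideal, hence consists of ad-nilpotent elements and so, by Engel's
  theorem, lies in the kernel of the Killing form.  As the character \<open>x \<mapsto> tr (ad x)\<close> vanishes on
  this kernel, it is represented by some \<open>w\<close>, and \<open>w \<in> J\<close> because characters vanish on \<open>[q, q]\<close>;
  so the character is 0.

  In a unimodular Lie algebra of index 1 take \<open>\<gamma>\<close> with a one-dimensional stabilizer \<open>K v\<close>.  If
  \<open>\<gamma> v \<noteq> 0\<close>, then \<open>\<gamma>\<close> is a contact form; otherwise, for any \<open>\<rho>\<close> that is 1 at \<open>v\<close> and 0 on a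
  suitable complement of \<open>K v\<close>, \<open>\<gamma> + t \<rho>\<close> is one for all but finitely many \<open>t\<close>.
\<close>

section \<open>Top degree forms on a hyperbolic basis\<close>

text \<open>Index 1 alone does not give a contact form: the algebra with \<open>[h, x] = x\<close>,
  \<open>[h, y] = y\<close>, \<open>[x, y] = 0\<close> has index 1 and is not contact. The
  obstruction is a single number. If \<open>\<gamma> v = 0\<close>, then \<open>\<gamma>\<close>
  equals \<open>\<gamma> [u, -]\<close> for some \<open>u\<close>, and the kernel equations of the
  perturbed form can be solved for their scalar unknowns only if \<open>1 - \<rho> [u, v]\<close> is
  nonzero; in the example it is 0. Unimodularity computes it: \<open>ad u\<close> has trace
  \<open>n\<close> modulo \<open>v\<close>, so \<open>\<rho> [u, v] = - n\<close>, and the number is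
  \<open>n + 1\<close>, nonzero in characteristic 0.

  Solvability of \<open>J\<close> needs a Cartan-type argument over a field without order or
  conjugation. The sum of squares that forces eigenvalues to vanish is therefore formed in the
  rationals, through a rational-linear functional on the field. The operator with the modified
  eigenvalues is built on a basis that is triangular inside each generalized eigenspace. The trace
  argument reaches only sums of brackets \<open>[u, v]\<close> with \<open>u\<close> in the kernel
  \<open>K\<close> of the Killing form, which is why the ideal \<open>[K, L]\<close> stands at the
  bottom of the chain.\<close>

lemma sum_permutations_average:
  fixes f :: "('a \<Rightarrow> 'a) \<Rightarrow> 'b::semiring_1"
  assumes "\<And>\<tau>. \<tau> \<in> T \<Longrightarrow> h \<tau> permutes S"
  shows "(\<Sum>\<sigma> | \<sigma> permutes S. \<Sum>\<tau>\<in>T. f (\<sigma> \<circ> h \<tau>)) =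
    of_nat (card T) * (\<Sum>\<sigma> | \<sigma> permutes S. f \<sigma>)"
proof -
  have "(\<Sum>\<sigma> | \<sigma> permutes S. f (\<sigma> \<circ> h \<tau>)) = (\<Sum>\<sigma> | \<sigma> permutes S. f \<sigma>)" if "\<tau> \<in> T" for \<tau>
    using sum_permutations_compose_right[OF assms[OF that]] by metis
  then show ?thesis
    by (subst sum.swap) simp
qed

text \<open>The recursion produces a double sum over permutations \<open>\<sigma>\<close> of all
  indices and \<open>\<tau>\<close> of those left after one factor is split off. Absorbing
  \<open>\<tau>\<close> into \<open>\<sigma>\<close> makes every term occur as often as there are
  \<open>\<tau>\<close>, which cancels the second factorial of \<open>wedge\<close>; the first one
  is 2 for each factor and leaves \<open>2 ^ n\<close>.\<close>

lemma wedge_power_2_eq_sum: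
  fixes g :: "'v \<Rightarrow> 'v \<Rightarrow> 'k::field_char_0"
  shows "wedge_power 2 (\<lambda>v. g (v 0) (v 1)) n v =
    (\<Sum>\<sigma> | \<sigma> permutes {..<2 * n}.
      of_int (sign \<sigma>) * (\<Prod>i<n. g (v (\<sigma> (2 * i))) (v (\<sigma> (2 * i + 1))))) / 2 ^ n"
proof (induction n arbitrary: v)
  case 0
  show ?case by (simp add: permutes_empty)
next
  case (Suc n)
  let ?S = "{\<sigma>. \<sigma> permutes {..<2 * Suc n}}" and ?T = "{\<tau>. \<tau> permutes {..<2 * n}}"
  define G where "G \<sigma> = of_int (sign \<sigma>) *
    (\<Prod>i<Suc n. g (v (\<sigma> (2 * i))) (v (\<sigma> (2 * i + 1))))" for \<sigma>
  \<comment> \<open>\<open>h \<tau>\<close> lets \<open>\<tau>\<close> act on the indices from 2 on,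
    because the factor split off by the recursion uses the entries 0 and 1.\<close>
  define h where "h = map_permutation {..<2 * n} (\<lambda>i. 2 + i)"
  have bij: "bij_betw (\<lambda>i. 2 + i) {..<2 * n} {2..<2 * Suc n}"
    by (rule bij_betw_byWitness[where f' = "\<lambda>i. i - 2"]) auto
  have h: "h \<tau> permutes {..<2 * Suc n}" "h \<tau> 0 = 0" "h \<tau> 1 = 1"
    "\<And>i. i < 2 * n \<Longrightarrow> h \<tau> (2 + i) = 2 + \<tau> i" "sign (h \<tau>) = sign \<tau>" if "\<tau> \<in> ?T" for \<tau>
  proof -
    have p: "h \<tau> permutes {2..<2 * Suc n}"
      unfolding h_def using that by (intro map_permutation_permutes[OF bij]) auto
    show "h \<tau> permutes {..<2 * Suc n}"
      by (rule permutes_subset[OF p]) auto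
    show "h \<tau> 0 = 0" "h \<tau> 1 = 1"
      using p by (auto simp: permutes_def)
    show "h \<tau> (2 + i) = 2 + \<tau> i" if "i < 2 * n" for i
      unfolding h_def using that by (intro map_permutation_apply) auto
    show "sign (h \<tau>) = sign \<tau>"
      unfolding h_def using that by (intro sign_map_permutation) auto
  qed
  have fact: "(fact (n * 2) :: 'k) = of_nat (card ?T)"
    by (simp add: card_permutations mult.commute)
  have "of_int (sign \<sigma>) * g (v (\<sigma> 0)) (v (\<sigma> 1)) *
      wedge_power 2 (\<lambda>v. g (v 0) (v 1)) n (\<lambda>i. v (\<sigma> (2 + i))) = (\<Sum>\<tau>\<in>?T. G (\<sigma> \<circ> h \<tau>)) / 2 ^ n"
    if \<sigma>: "\<sigma> \<in> ?S" for \<sigma>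
  proof -
    have "G (\<sigma> \<circ> h \<tau>) = of_int (sign \<sigma>) * g (v (\<sigma> 0)) (v (\<sigma> 1)) * (of_int (sign \<tau>) *
        (\<Prod>i<n. g (v (\<sigma> (2 + \<tau> (2 * i)))) (v (\<sigma> (2 + \<tau> (2 * i + 1))))))" if \<tau>: "\<tau> \<in> ?T" for \<tau>
    proof -
      have "sign (\<sigma> \<circ> h \<tau>) = sign \<sigma> * sign \<tau>"
        using \<sigma> h(1)[OF \<tau>] h(5)[OF \<tau>]
        by (subst sign_compose) (auto intro: permutes_imp_permutation)
      moreover have "g (v ((\<sigma> \<circ> h \<tau>) (2 * Suc i))) (v ((\<sigma> \<circ> h \<tau>) (2 * Suc i + 1))) =
          g (v (\<sigma> (2 + \<tau> (2 * i)))) (v (\<sigma> (2 + \<tau> (2 * i + 1))))" if "i < n" for i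
        using h(4)[OF \<tau>, of "2 * i"] h(4)[OF \<tau>, of "2 * i + 1"] that by simp
      ultimately show ?thesis
        unfolding G_def prod.lessThan_Suc_shift using h(2,3)[OF \<tau>] by simp
    qed
    then show ?thesis
      unfolding Suc.IH by (simp add: sum_distrib_left sum_divide_distrib)
  qed
  then have "wedge_power 2 (\<lambda>v. g (v 0) (v 1)) (Suc n) v =
      (\<Sum>\<sigma>\<in>?S. (\<Sum>\<tau>\<in>?T. G (\<sigma> \<circ> h \<tau>)) / 2 ^ n) / (fact 2 * fact (n * 2))"
    unfolding wedge_power.simps wedge_def by (simp add: mult.commute)
  also have "\<dots> = (\<Sum>\<sigma>\<in>?S. \<Sum>\<tau>\<in>?T. G (\<sigma> \<circ> h \<tau>)) / (2 ^ Suc n * of_nat (card ?T))"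
    unfolding fact by (simp add: sum_divide_distrib[symmetric])
  also have "\<dots> = (\<Sum>\<sigma>\<in>?S. G \<sigma>) / 2 ^ Suc n"
    using h(1) by (subst sum_permutations_average) (auto simp: card_permutations)
  finally show ?case unfolding G_def .
qed

text \<open>The Gram matrix of the standard symplectic form in the order e0, f0, e1, f1, ...: it is
  1 at (2i, 2i + 1) and -1 at (2i + 1, 2i). Integer values allow an argument by positivity before
  passing to the field.\<close>

definition hyperbolic :: "nat \<Rightarrow> nat \<Rightarrow> int" where
  "hyperbolic a b = (if a div 2 = b div 2 then int (b mod 2) - int (a mod 2) else 0)"

text \<open>If the product is nonzero, \<open>\<sigma>\<close> carries each pair 2i, 2i + 1 to such
  a pair. Permuting whole pairs is even and keeps the product; a swap inside a pair reverses both
  the sign and the product.\<close>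

lemma hyperbolic_sign_nonneg:
  assumes "\<sigma> permutes {..<2 * n}"
  shows "0 \<le> sign \<sigma> * (\<Prod>i<n. hyperbolic (\<sigma> (2 * i)) (\<sigma> (2 * i + 1)))"
  using assms
proof (induction n arbitrary: \<sigma>)
  case 0
  then show ?case by (simp add: permutes_empty)
next
  case (Suc n)
  let ?h = "\<lambda>\<sigma> i. hyperbolic (\<sigma> (2 * i)) (\<sigma> (2 * i + 1))"
  have even_case: "0 \<le> sign \<sigma> * (\<Prod>i<Suc n. ?h \<sigma> i)"
    if \<sigma>: "\<sigma> permutes {..<2 * Suc n}" and j: "\<sigma> (2 * n) = 2 * j" "\<sigma> (2 * n + 1) = 2 * j + 1" for \<sigma> j
  proof -
    \<comment> \<open>Exchanges the pairs \<open>j\<close> and \<open>n\<close> entry by entry; the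
      composite fixes the last pair, so the induction hypothesis applies to it.\<close>
    define \<tau> where "\<tau> = transpose (2 * j) (2 * n) \<circ> transpose (2 * j + 1) (2 * n + 1)"
    have "\<sigma> (2 * n) < 2 * Suc n"
      using permutes_in_image[OF \<sigma>, of "2 * n"] by simp
    then have "j \<le> n" using j by simp
    have \<tau>: "\<tau> permutes {..<2 * Suc n}"
      unfolding \<tau>_def using \<open>j \<le> n\<close> by (intro permutes_compose permutes_swap_id) auto
    have sign: "sign \<tau> = 1"
      unfolding \<tau>_def by (subst sign_compose) (auto simp: sign_swap_id permutation_swap_id)
    have hyp: "hyperbolic (\<tau> a) (\<tau> b) = hyperbolic a b" for a b
    proof -
      have "\<tau> c mod 2 = c mod 2" for c
        unfolding \<tau>_def transpose_def by auto
      moreover have "\<tau> c div 2 = transpose j n (c div 2)" for c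
        unfolding \<tau>_def transpose_def by auto
      ultimately show ?thesis
        by (simp add: hyperbolic_def) (metis transpose_involutory)
    qed
    have \<tau>\<sigma>: "\<tau> \<circ> \<sigma> permutes {..<2 * Suc n}"
      using \<sigma> \<tau> by (rule permutes_compose)
    have "(\<tau> \<circ> \<sigma>) (2 * n) = 2 * n" "(\<tau> \<circ> \<sigma>) (2 * n + 1) = 2 * n + 1"
      using j unfolding \<tau>_def by (auto simp: transpose_def) presburger
    then have "\<forall>x\<in>{..<2 * Suc n} - {..<2 * n}. (\<tau> \<circ> \<sigma>) x = x"
      by (metis Diff_iff Suc_eq_plus1 less_Suc_eq lessThan_iff mult_Suc_right add_2_eq_Suc)
    then have "\<tau> \<circ> \<sigma> permutes {..<2 * n}"
      using \<tau>\<sigma> by (metis permutes_superset)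
    from Suc.IH[OF this] have "0 \<le> sign \<sigma> * (\<Prod>i<n. ?h \<sigma> i)"
      using \<sigma> \<tau> sign hyp by (subst (asm) sign_compose) (auto intro: permutes_imp_permutation)
    moreover have "?h \<sigma> n = 1"
      using j by (simp add: hyperbolic_def)
    ultimately show ?thesis by simp
  qed
  show ?case
  proof (cases "?h \<sigma> n = 0")
    case True
    then show ?thesis by simp
  next
    case False
    define a b j where "a = \<sigma> (2 * n)" and "b = \<sigma> (2 * n + 1)" and "j = a div 2"
    have "j = b div 2" "b mod 2 \<noteq> a mod 2"
      using False unfolding a_def b_def j_def hyperbolic_def by (auto split: if_splits)
    moreover have "a = 2 * j \<or> a = 2 * j + 1" "b = 2 * (b div 2) \<or> b = 2 * (b div 2) + 1"
      unfolding j_def by presburger+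
    ultimately have "a = 2 * j \<and> b = 2 * j + 1 \<or> a = 2 * j + 1 \<and> b = 2 * j"
      by auto
    then consider j where "\<sigma> (2 * n) = 2 * j" "\<sigma> (2 * n + 1) = 2 * j + 1"
      | j where "\<sigma> (2 * n) = 2 * j + 1" "\<sigma> (2 * n + 1) = 2 * j"
      unfolding a_def b_def by blast
    then show ?thesis
    proof cases
      case 1
      then show ?thesis using even_case[OF Suc.prems] by blast
    next
      case (2 j)
      \<comment> \<open>Swapping the two values taken on the last pair reverses both signs and leads
        back to \<open>even_case\<close>.\<close>
      define \<tau> where "\<tau> = transpose (2 * j) (2 * j + 1)"
      have "\<sigma> (2 * n) < 2 * Suc n"
        using permutes_in_image[OF Suc.prems, of "2 * n"] by simp
      then have \<tau>: "\<tau> permutes {..<2 * Suc n}"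
        unfolding \<tau>_def using 2 by (intro permutes_swap_id) auto
      have "0 \<le> sign (\<tau> \<circ> \<sigma>) * (\<Prod>i<Suc n. ?h (\<tau> \<circ> \<sigma>) i)"
        using 2 by (intro even_case permutes_compose[OF Suc.prems \<tau>]) (auto simp: \<tau>_def)
      moreover have "sign (\<tau> \<circ> \<sigma>) = - sign \<sigma>"
        using Suc.prems \<tau> by (subst sign_compose)
          (auto intro: permutes_imp_permutation simp: \<tau>_def sign_swap_id)
      moreover have "?h (\<tau> \<circ> \<sigma>) i = ?h \<sigma> i" if "i < n" for i
      proof -
        have "\<tau> (\<sigma> k) = \<sigma> k" if "k < 2 * n" for k
        proof -
          have "\<sigma> k \<noteq> \<sigma> (2 * n)" "\<sigma> k \<noteq> \<sigma> (2 * n + 1)"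
            using that by (auto simp: inj_eq[OF permutes_inj[OF Suc.prems]])
          then show ?thesis using 2 by (simp add: \<tau>_def transpose_def)
        qed
        then show ?thesis using that by simp
      qed
      moreover have "?h (\<tau> \<circ> \<sigma>) n = 1" "?h \<sigma> n = -1"
        using 2 by (simp_all add: \<tau>_def hyperbolic_def)
      ultimately show ?thesis by simp
    qed
  qed
qed

lemma sum_hyperbolic_pos:
  "0 < (\<Sum>\<sigma> | \<sigma> permutes {..<2 * n}. sign \<sigma> * (\<Prod>i<n. hyperbolic (\<sigma> (2 * i)) (\<sigma> (2 * i + 1))))"
proof (rule sum_pos2[where i = id])
  show "finite {\<sigma>. \<sigma> permutes {..<2 * n}}" by (simp add: finite_permutations)
  show "id \<in> {\<sigma>. \<sigma> permutes {..<2 * n}}" by (simp add: permutes_id)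
  have "(\<Prod>i<n. hyperbolic (id (2 * i)) (id (2 * i + 1))) = 1"
    by (intro prod.neutral) (simp add: hyperbolic_def)
  then show "0 < sign id * (\<Prod>i<n. hyperbolic (id (2 * i)) (id (2 * i + 1)))"
    by simp
qed (use hyperbolic_sign_nonneg in auto)

text \<open>As \<open>\<alpha>\<close> sees only the last vector, permutations moving
  \<open>2 * n\<close> drop out, and with them every value of \<open>g\<close> at that vector. The
  remaining terms are all equal, because the two occurrences of \<open>sign \<sigma>\<close> cancel;
  their common value is a positive integer over a power of 2, times \<open>\<alpha>\<close> of the
  last vector.\<close>

lemma wedge_power_hyperbolic_ne_0:
  fixes g :: "'v \<Rightarrow> 'v \<Rightarrow> 'k::field_char_0"
  assumes g: "\<And>a b. a < 2 * n \<Longrightarrow> b < 2 * n \<Longrightarrow> g (v a) (v b) = of_int (hyperbolic a b)"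
    and \<alpha>: "\<And>a. a < 2 * n \<Longrightarrow> \<alpha> (v a) = 0" "\<alpha> (v (2 * n)) \<noteq> 0"
  shows "wedge (2 * n) 1 (wedge_power 2 (\<lambda>v. g (v 0) (v 1)) n) (\<lambda>u. \<alpha> (u 0)) v \<noteq> 0"
proof -
  let ?S = "{\<sigma>. \<sigma> permutes {..<2 * n + 1}}" and ?T = "{\<sigma>. \<sigma> permutes {..<2 * n}}"
  let ?P = "\<lambda>\<sigma>. \<Prod>i<n. g (v (\<sigma> (2 * i))) (v (\<sigma> (2 * i + 1)))"
  let ?W = "wedge_power 2 (\<lambda>v. g (v 0) (v 1)) n"
  define s where "s = (\<Sum>\<sigma>\<in>?T. sign \<sigma> * (\<Prod>i<n. hyperbolic (\<sigma> (2 * i)) (\<sigma> (2 * i + 1))))"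
  have s: "0 < s"
    unfolding s_def by (rule sum_hyperbolic_pos)
  have W: "?W (\<lambda>i. v (\<sigma> i)) = of_int (sign \<sigma>) * (of_int s / 2 ^ n)" if \<sigma>: "\<sigma> \<in> ?T" for \<sigma>
  proof -
    \<comment> \<open>The power is alternating: left composition with \<open>\<sigma>\<close>
      reindexes the sum and costs the factor \<open>sign \<sigma>\<close>.\<close>
    have bij: "bij_betw (\<lambda>\<tau>. \<sigma> \<circ> \<tau>) ?T ?T"
      unfolding bij_betw_def
    proof
      show "inj_on (\<lambda>\<tau>. \<sigma> \<circ> \<tau>) ?T"
        using \<sigma> fun.inj_map[OF permutes_inj] by (blast intro: inj_on_subset)
      show "(\<lambda>\<tau>. \<sigma> \<circ> \<tau>) ` ?T = ?T"
        using image_compose_permutations_left \<sigma> by blast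
    qed
    have "of_int (sign \<sigma>) * of_int (sign \<sigma>) = (1 :: 'k)"
      by (metis of_int_mult of_int_1 sign_idempotent)
    then have "?W (\<lambda>i. v (\<sigma> i)) = of_int (sign \<sigma>) *
        (\<Sum>\<tau>\<in>?T. of_int (sign \<sigma>) * (of_int (sign \<tau>) * ?P (\<sigma> \<circ> \<tau>))) / 2 ^ n"
      unfolding wedge_power_2_eq_sum by (simp add: sum_distrib_left mult.assoc[symmetric])
    also have "(\<Sum>\<tau>\<in>?T. of_int (sign \<sigma>) * (of_int (sign \<tau>) * ?P (\<sigma> \<circ> \<tau>))) =
        (\<Sum>\<tau>\<in>?T. of_int (sign (\<sigma> \<circ> \<tau>)) * ?P (\<sigma> \<circ> \<tau>))"
      using \<sigma> by (intro sum.cong) (auto simp: sign_compose permutes_imp_permutation[of "{..<2 * n}"])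
    also have "\<dots> = (\<Sum>\<tau>\<in>?T. of_int (sign \<tau>) * ?P \<tau>)"
      using bij by (rule sum.reindex_bij_betw)
    also have "\<dots> = of_int s"
    proof -
      have "?P \<tau> = of_int (\<Prod>i<n. hyperbolic (\<tau> (2 * i)) (\<tau> (2 * i + 1)))" if "\<tau> \<in> ?T" for \<tau>
      proof -
        have "\<tau> k < 2 * n" if "k < 2 * n" for k
          using permutes_in_image[of \<tau> "{..<2 * n}" k] \<open>\<tau> \<in> ?T\<close> that by simp
        then show ?thesis by (simp add: g)
      qed
      then show ?thesis by (simp add: s_def)
    qed
    finally show ?thesis by simp
  qed
  have "(\<Sum>\<sigma>\<in>?S. of_int (sign \<sigma>) * ?W (\<lambda>i. v (\<sigma> i)) * \<alpha> (v (\<sigma> (2 * n)))) =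
      (\<Sum>\<sigma>\<in>?T. of_int (sign \<sigma>) * ?W (\<lambda>i. v (\<sigma> i)) * \<alpha> (v (\<sigma> (2 * n))))"
  proof (rule sum.mono_neutral_right)
    show "finite ?S" by (simp add: finite_permutations)
    show "?T \<subseteq> ?S" by (auto intro: permutes_subset)
    show "\<forall>\<sigma>\<in>?S - ?T. of_int (sign \<sigma>) * ?W (\<lambda>i. v (\<sigma> i)) * \<alpha> (v (\<sigma> (2 * n))) = 0"
    proof
      fix \<sigma> assume \<sigma>: "\<sigma> \<in> ?S - ?T"
      then have "\<sigma> (2 * n) \<noteq> 2 * n"
        using permutes_superset[of \<sigma> "{..<2 * n + 1}" "{..<2 * n}"] by auto
      moreover have "\<sigma> (2 * n) < 2 * n + 1"
        using \<sigma> permutes_in_image[of \<sigma> "{..<2 * n + 1}" "2 * n"] by simp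
      ultimately show "of_int (sign \<sigma>) * ?W (\<lambda>i. v (\<sigma> i)) * \<alpha> (v (\<sigma> (2 * n))) = 0"
        using \<alpha>(1) by simp
    qed
  qed
  also have "\<dots> = (\<Sum>\<sigma>\<in>?T. of_int s / 2 ^ n * \<alpha> (v (2 * n)))"
  proof (rule sum.cong[OF refl])
    fix \<sigma> assume \<sigma>: "\<sigma> \<in> ?T"
    then have "\<sigma> (2 * n) = 2 * n"
      by (auto simp: permutes_def)
    moreover have "of_int (sign \<sigma>) * of_int (sign \<sigma>) = (1 :: 'k)"
      by (metis of_int_mult of_int_1 sign_idempotent)
    ultimately show "of_int (sign \<sigma>) * ?W (\<lambda>i. v (\<sigma> i)) * \<alpha> (v (\<sigma> (2 * n))) =
        of_int s / 2 ^ n * \<alpha> (v (2 * n))"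
      unfolding W[OF \<sigma>] by (simp add: mult.assoc[symmetric])
  qed
  also have "\<dots> \<noteq> 0"
    using \<alpha>(2) s by (simp add: card_permutations)
  finally show ?thesis
    unfolding wedge_def by simp
qed

section \<open>Endomorphisms of a finite-dimensional space\<close>

locale fin_dim_subspace = vector_space scale
  for scale :: "'k::field \<Rightarrow> 'v::ab_group_add \<Rightarrow> 'v" (infixr "*s" 75) +
  fixes L :: "'v set"
  assumes subspace_L: "subspace L"
    and fin_dim: "\<exists>B. finite B \<and> L \<subseteq> span B"
begin

definition functional :: "('v \<Rightarrow> 'k) \<Rightarrow> bool" where
  "functional f \<longleftrightarrow>
     (\<forall>x\<in>L. \<forall>y\<in>L. f (x + y) = f x + f y) \<and> (\<forall>a. \<forall>x\<in>L. f (a *s x) = a * f x)"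

definition endo :: "('v \<Rightarrow> 'v) \<Rightarrow> bool" where
  "endo T \<longleftrightarrow> (\<forall>x\<in>L. T x \<in> L) \<and>
     (\<forall>x\<in>L. \<forall>y\<in>L. T (x + y) = T x + T y) \<and> (\<forall>a. \<forall>x\<in>L. T (a *s x) = a *s T x)"

text \<open>A basis together with its dual basis, so that expansions and traces are plain finite
  sums. All conditions are relative to \<open>L\<close>, as the ambient space may be
  infinite-dimensional.\<close>

definition frame :: "nat \<Rightarrow> (nat \<Rightarrow> 'v) \<Rightarrow> (nat \<Rightarrow> 'v \<Rightarrow> 'k) \<Rightarrow> bool" where
  "frame d b c \<longleftrightarrow> (\<forall>i<d. b i \<in> L \<and> functional (c i)) \<and>
     (\<forall>i<d. \<forall>j<d. c i (b j) = (if i = j then 1 else 0)) \<and>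
     (\<forall>x\<in>L. x = (\<Sum>i<d. c i x *s b i))"

lemmas L_closed [simp, intro] =
  subspace_0[OF subspace_L] subspace_add[OF subspace_L] subspace_diff[OF subspace_L]
  subspace_scale[OF subspace_L] subspace_neg[OF subspace_L]

lemma L_sum [intro]: "(\<And>i. i \<in> I \<Longrightarrow> x i \<in> L) \<Longrightarrow> sum x I \<in> L"
  by (rule subspace_sum[OF subspace_L])

lemma span_subset_L: "S \<subseteq> L \<Longrightarrow> span S \<subseteq> L"
  by (rule span_minimal[OF _ subspace_L])

lemma functionalD:
  assumes "functional f"
  shows functional_add: "x \<in> L \<Longrightarrow> y \<in> L \<Longrightarrow> f (x + y) = f x + f y"
    and functional_scale: "x \<in> L \<Longrightarrow> f (a *s x) = a * f x"
  using assms unfolding functional_def by blast+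

lemma functional_0: "functional f \<Longrightarrow> f 0 = 0"
  using functional_scale[of f 0 0] by auto

lemma functional_diff: "functional f \<Longrightarrow> x \<in> L \<Longrightarrow> y \<in> L \<Longrightarrow> f (x - y) = f x - f y"
  using functional_add[of f "x - y" y] by auto

lemma functional_sum:
  assumes "functional f" "\<And>i. i \<in> I \<Longrightarrow> x i \<in> L"
  shows "f (\<Sum>i\<in>I. x i) = (\<Sum>i\<in>I. f (x i))"
  using assms(2)
  by (induction I rule: infinite_finite_induct)
    (auto simp: functional_0[OF assms(1)] functional_add[OF assms(1)] L_sum)

lemma endoD:
  assumes "endo T"
  shows endo_closed: "x \<in> L \<Longrightarrow> T x \<in> L"
    and endo_add: "x \<in> L \<Longrightarrow> y \<in> L \<Longrightarrow> T (x + y) = T x + T y"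
    and endo_scale: "x \<in> L \<Longrightarrow> T (a *s x) = a *s T x"
  using assms unfolding endo_def by blast+

lemma endo_0: "endo T \<Longrightarrow> T 0 = 0"
  using endo_scale[of T 0 0] by auto

lemma endo_diff: "endo T \<Longrightarrow> x \<in> L \<Longrightarrow> y \<in> L \<Longrightarrow> T (x - y) = T x - T y"
  using endo_add[of T "x - y" y] by (auto simp: algebra_simps)

lemma endo_sum:
  assumes "endo T" "\<And>i. i \<in> I \<Longrightarrow> x i \<in> L"
  shows "T (\<Sum>i\<in>I. x i) = (\<Sum>i\<in>I. T (x i))"
  using assms(2)
  by (induction I rule: infinite_finite_induct)
    (auto simp: endo_0[OF assms(1)] endo_add[OF assms(1)] L_sum)

lemma endo_compose: "endo S \<Longrightarrow> endo T \<Longrightarrow> endo (\<lambda>x. S (T x))"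
  unfolding endo_def by simp

lemma endo_minus: "endo S \<Longrightarrow> endo T \<Longrightarrow> endo (\<lambda>x. S x - T x)"
  unfolding endo_def by (simp add: algebra_simps)

lemma endo_power: "endo T \<Longrightarrow> endo (T ^^ n)"
  by (induction n) (auto simp: endo_def)

lemma functional_endo: "functional f \<Longrightarrow> endo T \<Longrightarrow> functional (\<lambda>x. f (T x))"
  unfolding endo_def functional_def by simp

section \<open>Bases, coordinates and dimension\<close>

lemma in_span_lessThan:
  assumes "x \<in> span (w ` {..<n})"
  shows "\<exists>a. x = (\<Sum>i<n::nat. a i *s w i)"
  using assms
proof (induction n arbitrary: x)
  case 0
  then show ?case by simp
next
  case (Suc n)
  then obtain k where "x - k *s w n \<in> span (w ` {..<n})"
    by (auto simp: lessThan_Suc span_breakdown_eq)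
  with Suc.IH obtain a where a: "x - k *s w n = (\<Sum>i<n. a i *s w i)" by blast
  have "x = (\<Sum>i<Suc n. (a(n := k)) i *s w i)"
    using a by (simp add: algebra_simps)
  then show ?case by blast
qed

lemma independent_sequence:
  assumes "\<And>i. i < m \<Longrightarrow> b i \<notin> span (b ` {..<i})"
  shows "independent (b ` {..<m::nat})" "inj_on b {..<m}"
  using assms
proof (induction m)
  case (Suc m)
  { case 1
    then show ?case using Suc by (simp add: lessThan_Suc independent_insertI) }
  { case 2
    then have "b m \<notin> b ` {..<m}" by (meson lessI span_base)
    then show ?case using Suc 2 by (simp add: lessThan_Suc) }
qed (auto simp: independent_empty)

text \<open>Every maximality argument below rests on this bound: bases, triangular bases, Engel's
  theorem, the radical, dual systems and symplectic systems all come from a longest sequence that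
  could otherwise be prolonged.\<close>

lemma independent_sequence_bound:
  obtains N :: nat where "\<And>m b. (\<And>i. i < m \<Longrightarrow> b i \<in> L \<and> b i \<notin> span (b ` {..<i})) \<Longrightarrow> m \<le> N"
proof -
  obtain B where B: "finite B" "L \<subseteq> span B" using fin_dim by blast
  have "m \<le> card B" if "\<And>i. i < m \<Longrightarrow> b i \<in> L \<and> b i \<notin> span (b ` {..<i})" for m and b :: "nat \<Rightarrow> 'v"
  proof -
    have "independent (b ` {..<m})" "inj_on b {..<m}"
      using independent_sequence[of m b] that by blast+
    moreover have "b ` {..<m} \<subseteq> span B" using that B by auto
    ultimately show ?thesis
      using independent_span_bound[OF B(1)] by (metis card_image card_lessThan)
  qed
  then show thesis using that by blast
qed

lemma frame_of_sequence:
  assumes b: "\<And>i. i < d \<Longrightarrow> b i \<in> L" "\<And>i. i < d \<Longrightarrow> b i \<notin> span (b ` {..<i})"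
    and span: "L \<subseteq> span (b ` {..<d})"
  shows "\<exists>c. frame d b c"
proof -
  let ?B = "b ` {..<d}"
  note ind = independent_sequence[OF b(2)]
  define c where "c i x = representation ?B x (b i)" for i x
  have "functional (c i)" for i
    unfolding functional_def c_def using span ind(1)
    by (auto simp: representation_add representation_scale subset_iff)
  moreover have "c i (b j) = (if i = j then 1 else 0)" if "i < d" "j < d" for i j
    unfolding c_def using that ind by (subst representation_basis) (auto simp: inj_on_def)
  moreover have "x = (\<Sum>i<d. c i x *s b i)" if "x \<in> L" for x
  proof -
    have "x = (\<Sum>v\<in>?B. representation ?B x v *s v)"
      using that span ind(1) by (intro sum_representation_eq[symmetric]) auto
    also have "\<dots> = (\<Sum>i<d. c i x *s b i)"
      unfolding c_def
      by (rule sum.reindex_bij_betw[symmetric]) (simp add: bij_betw_def ind(2))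
    finally show ?thesis .
  qed
  ultimately show ?thesis
    unfolding frame_def using b(1) by blast
qed

lemma frameD:
  assumes "frame d b c"
  shows frame_mem: "i < d \<Longrightarrow> b i \<in> L"
    and frame_functional: "i < d \<Longrightarrow> functional (c i)"
    and frame_dual: "i < d \<Longrightarrow> j < d \<Longrightarrow> c i (b j) = (if i = j then 1 else 0)"
    and frame_expand: "x \<in> L \<Longrightarrow> x = (\<Sum>i<d. c i x *s b i)"
  using assms unfolding frame_def by blast+

lemma frame_exists: "\<exists>d b c. frame d b c"
proof -
  define P where "P m \<longleftrightarrow> (\<exists>b. \<forall>i<m. b i \<in> L \<and> b i \<notin> span (b ` {..<i}))" for m :: nat
  obtain N :: nat where N: "\<And>m (b :: nat \<Rightarrow> 'v).
      (\<And>i. i < m \<Longrightarrow> b i \<in> L \<and> b i \<notin> span (b ` {..<i})) \<Longrightarrow> m \<le> N"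
    using independent_sequence_bound by blast
  then have "\<forall>m. P m \<longrightarrow> m \<le> N" unfolding P_def by blast
  moreover have "P 0" unfolding P_def by simp
  ultimately obtain d where d: "P d" "\<And>m. P m \<Longrightarrow> m \<le> d"
    using Greatest_le_nat[of P] GreatestI_nat[of P] by blast
  then obtain b where b: "\<And>i. i < d \<Longrightarrow> b i \<in> L \<and> b i \<notin> span (b ` {..<i})"
    unfolding P_def by blast
  have "L \<subseteq> span (b ` {..<d})"
  proof (rule ccontr)
    assume "\<not> ?thesis"
    then obtain y where y: "y \<in> L" "y \<notin> span (b ` {..<d})" by blast
    have "(b(d := y)) ` {..<i} = b ` {..<i}" if "i \<le> d" for i
      using that by auto
    then have "(b(d := y)) i \<in> L \<and> (b(d := y)) i \<notin> span ((b(d := y)) ` {..<i})" if "i < Suc d" for i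
      using b[of i] y that by (cases "i = d")
        (simp_all only: less_Suc_eq less_imp_le fun_upd_same fun_upd_other simp_thms order_refl)
    then have "P (Suc d)" unfolding P_def by blast
    then show False using d(2) by fastforce
  qed
  then show ?thesis using frame_of_sequence[of d b] b by blast
qed

lemma functional_expand:
  assumes "frame d b c" "functional f" "x \<in> L"
  shows "f x = (\<Sum>i<d. c i x * f (b i))"
proof -
  have "f x = f (\<Sum>i<d. c i x *s b i)"
    by (rule arg_cong[OF frame_expand[OF assms(1,3)]])
  also have "\<dots> = (\<Sum>i<d. c i x * f (b i))"
    using assms by (subst functional_sum) (auto simp: functional_scale frame_mem)
  finally show ?thesis .
qed

lemma endo_expand:
  assumes "frame d b c" "endo T" "x \<in> L"
  shows "T x = (\<Sum>i<d. c i x *s T (b i))"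
proof -
  have "T x = T (\<Sum>i<d. c i x *s b i)"
    by (rule arg_cong[OF frame_expand[OF assms(1,3)]])
  also have "\<dots> = (\<Sum>i<d. c i x *s T (b i))"
    using assms by (subst endo_sum) (auto simp: endo_scale frame_mem)
  finally show ?thesis .
qed

lemma endo_of_values:
  assumes "frame d b c" "\<And>i. i < d \<Longrightarrow> w i \<in> L"
  shows "endo (\<lambda>x. \<Sum>i<d. c i x *s w i)"
  unfolding endo_def using assms
  by (auto simp: functional_add[OF frame_functional[OF assms(1)]]
      functional_scale[OF frame_functional[OF assms(1)]] scale_left_distrib sum.distrib
      scale_sum_right intro!: L_sum)

lemma frame_span: "frame d b c \<Longrightarrow> L = span (b ` {..<d})"
proof
  assume fr: "frame d b c"
  show "L \<subseteq> span (b ` {..<d})"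
  proof
    fix x assume "x \<in> L"
    have "(\<Sum>i<d. c i x *s b i) \<in> span (b ` {..<d})"
      by (intro span_sum span_scale span_base) auto
    then show "x \<in> span (b ` {..<d})"
      by (subst frame_expand[OF fr \<open>x \<in> L\<close>])
  qed
  show "span (b ` {..<d}) \<subseteq> L"
    using fr by (intro span_subset_L) (auto simp: frame_mem)
qed

lemma coordinate_zero_on_span:
  assumes "frame d b c" "k < d" "J \<subseteq> {..<d}" "k \<notin> J" "y \<in> span (b ` J)"
  shows "c k y = 0"
proof -
  have "subspace {y \<in> L. c k y = 0}"
    using frame_functional[OF assms(1,2)]
    by (intro subspaceI) (auto simp: functional_0 functional_add functional_scale)
  moreover have "b ` J \<subseteq> {y \<in> L. c k y = 0}"
    using assms frame_dual[OF assms(1)] frame_mem[OF assms(1)] by (auto simp: subset_iff)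
  ultimately show ?thesis
    using span_minimal assms(5) by blast
qed

lemma frame_dim:
  assumes fr: "frame d b c" shows "dim L = d"
proof -
  have "b i \<notin> span (b ` {..<i})" if "i < d" for i
    using coordinate_zero_on_span[OF fr that, of "{..<i}" "b i"] frame_dual[OF fr that that] that
    by auto
  then have ind: "independent (b ` {..<d})" "inj_on b {..<d}"
    using independent_sequence[of d b] by blast+
  have "dim L = card (b ` {..<d})"
    using frame_span[OF fr] dim_span_eq_card_independent[OF ind(1)] by simp
  also have "\<dots> = d" using card_image[OF ind(2)] by simp
  finally show ?thesis .
qed

section \<open>The trace of an endomorphism\<close>

definition trace :: "('v \<Rightarrow> 'v) \<Rightarrow> 'k" where
  "trace T = (SOME t. \<exists>d b c. frame d b c \<and> t = (\<Sum>i<d. c i (T (b i))))"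

text \<open>Expanding one frame in the other and exchanging the two sums shows that all frames give
  the same value, so the choice in the definition is harmless.\<close>

lemma trace_eq:
  assumes fr: "frame d b c" and T: "endo T"
  shows "trace T = (\<Sum>i<d. c i (T (b i)))"
proof -
  have *: "(\<Sum>i<d. c i (T (b i))) = (\<Sum>i<d'. c' i (T (b' i)))" if fr': "frame d' b' c'" for d' b' c'
  proof -
    have "(\<Sum>i<d. c i (T (b i))) = (\<Sum>i<d. \<Sum>j<d'. c' j (b i) * c i (T (b' j)))"
      by (intro sum.cong refl
          functional_expand[OF fr' functional_endo[OF frame_functional[OF fr] T] frame_mem[OF fr]]) auto
    also have "\<dots> = (\<Sum>j<d'. \<Sum>i<d. c i (T (b' j)) * c' j (b i))"
      by (subst sum.swap) (simp add: mult.commute)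
    also have "\<dots> = (\<Sum>j<d'. c' j (T (b' j)))"
      by (intro sum.cong refl
          functional_expand[OF fr frame_functional[OF fr'] endo_closed[OF T frame_mem[OF fr']],
            symmetric]) auto
    finally show ?thesis .
  qed
  show ?thesis
    unfolding trace_def
  proof (rule some_equality)
    show "\<exists>d' b' c'. frame d' b' c' \<and> (\<Sum>i<d. c i (T (b i))) = (\<Sum>i<d'. c' i (T (b' i)))"
      using fr by blast
    show "t = (\<Sum>i<d. c i (T (b i)))"
      if "\<exists>d' b' c'. frame d' b' c' \<and> t = (\<Sum>i<d'. c' i (T (b' i)))" for t
    proof -
      from that obtain d' b' c' where "frame d' b' c'" "t = (\<Sum>i<d'. c' i (T (b' i)))" by blast
      then show ?thesis using * by simp
    qed
  qed
qed

lemma trace_add: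
  assumes "endo S" "endo T" shows "trace (\<lambda>x. S x + T x) = trace S + trace T"
proof -
  obtain d b c where fr: "frame d b c" using frame_exists by blast
  have "endo (\<lambda>x. S x + T x)"
    using assms unfolding endo_def by (auto simp: algebra_simps)
  then show ?thesis
    using assms frame_mem[OF fr] frame_functional[OF fr]
    by (simp add: trace_eq[OF fr] functional_add endo_closed sum.distrib)
qed

lemma trace_scale:
  assumes "endo T" shows "trace (\<lambda>x. a *s T x) = a * trace T"
proof -
  obtain d b c where fr: "frame d b c" using frame_exists by blast
  have "endo (\<lambda>x. a *s T x)"
    using assms unfolding endo_def by (auto simp: algebra_simps)
  then show ?thesis
    using assms frame_mem[OF fr] frame_functional[OF fr]
    by (simp add: trace_eq[OF fr] functional_scale endo_closed sum_distrib_left)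
qed

lemma trace_diff:
  assumes "endo S" "endo T" shows "trace (\<lambda>x. S x - T x) = trace S - trace T"
proof -
  have "endo (\<lambda>x. (-1) *s T x)"
    using assms unfolding endo_def by (auto simp: algebra_simps)
  from trace_add[OF assms(1) this] show ?thesis
    using trace_scale[OF assms(2), of "-1"] by simp
qed

lemma trace_cong:
  assumes "endo S" "\<And>x. x \<in> L \<Longrightarrow> S x = T x" shows "trace S = trace T"
proof -
  obtain d b c where fr: "frame d b c" using frame_exists by blast
  have "endo T" unfolding endo_def by (simp add: assms(2)[symmetric] endoD[OF assms(1)])
  then show ?thesis
    using assms frame_mem[OF fr] by (simp add: trace_eq[OF fr])
qed

lemma trace_commute:
  assumes S: "endo S" and T: "endo T" shows "trace (\<lambda>x. S (T x)) = trace (\<lambda>x. T (S x))"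
proof -
  obtain d b c where fr: "frame d b c" using frame_exists by blast
  have *: "(\<Sum>i<d. c i (S (T (b i)))) = (\<Sum>i<d. \<Sum>j<d. c j (T (b i)) * c i (S (b j)))"
    if "endo S" "endo T" for S T
    by (intro sum.cong refl functional_expand[OF fr functional_endo[OF frame_functional[OF fr] that(1)]
        endo_closed[OF that(2) frame_mem[OF fr]]]) auto
  have "(\<Sum>i<d. c i (S (T (b i)))) = (\<Sum>i<d. c i (T (S (b i))))"
    unfolding *[OF S T] *[OF T S] by (subst sum.swap) (simp add: mult.commute)
  then show ?thesis
    using S T by (simp add: trace_eq[OF fr] endo_compose)
qed

text \<open>Sharper than a triangular matrix: the remainder involves only earlier vectors with the
  same eigenvalue. In a full basis the vectors with \<open>\<theta> j = \<mu>\<close> therefore span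
  the generalized eigenspace of \<open>\<mu>\<close>, and one basis provides both the flag and the
  decomposition.\<close>

definition triangular :: "('v \<Rightarrow> 'v) \<Rightarrow> nat \<Rightarrow> (nat \<Rightarrow> 'v) \<Rightarrow> (nat \<Rightarrow> 'k) \<Rightarrow> bool" where
  "triangular T m b \<theta> \<longleftrightarrow> (\<forall>i<m. b i \<in> L \<and> b i \<notin> span (b ` {..<i}) \<and>
     T (b i) - \<theta> i *s b i \<in> span (b ` {j. j < i \<and> \<theta> j = \<theta> i}))"

lemma triangularD:
  assumes "triangular T m b \<theta>" "i < m"
  shows "b i \<in> L" "b i \<notin> span (b ` {..<i})"
    "T (b i) - \<theta> i *s b i \<in> span (b ` {j. j < i \<and> \<theta> j = \<theta> i})"
    "T (b i) - \<theta> i *s b i \<in> span (b ` {..<i})"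
proof -
  show 1: "b i \<in> L" "b i \<notin> span (b ` {..<i})"
    "T (b i) - \<theta> i *s b i \<in> span (b ` {j. j < i \<and> \<theta> j = \<theta> i})"
    using assms unfolding triangular_def by blast+
  show "T (b i) - \<theta> i *s b i \<in> span (b ` {..<i})"
    using 1(3) by (rule set_mp[OF span_mono, rotated]) auto
qed

lemma subspace_endo_vimage:
  assumes "endo T" "subspace V" shows "subspace {x \<in> L. T x \<in> V}"
  using assms by (intro subspaceI)
    (auto simp: endo_0 endo_add endo_scale subspace_0 subspace_add subspace_scale)

lemma triangular_stable:
  assumes T: "endo T" and tri: "triangular T m b \<theta>" and i: "i \<le> m" and x: "x \<in> span (b ` {..<i})"
  shows "T x \<in> span (b ` {..<i})"
proof -
  have "T (b j) \<in> span (b ` {..<i})" if j: "j < i" for j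
  proof -
    have "T (b j) - \<theta> j *s b j \<in> span (b ` {..<i})"
      by (rule set_mp[OF span_mono triangularD(4)[OF tri]]) (use i j in auto)
    moreover have "\<theta> j *s b j \<in> span (b ` {..<i})"
      using j by (intro span_scale span_base) auto
    ultimately show ?thesis
      using span_add by fastforce
  qed
  then have "b ` {..<i} \<subseteq> {x \<in> L. T x \<in> span (b ` {..<i})}"
    using triangularD(1)[OF tri] i by auto
  from span_minimal[OF this subspace_endo_vimage[OF T subspace_span]] show ?thesis
    using x by blast
qed

end

section \<open>Existence of triangular bases over a field with roots\<close>

context fin_dim_subspace begin

definition poly_apply :: "('v \<Rightarrow> 'v) \<Rightarrow> 'k poly \<Rightarrow> 'v \<Rightarrow> 'v" where
  "poly_apply T p x = (\<Sum>i\<le>degree p. coeff p i *s (T ^^ i) x)"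

lemma poly_apply_eq_sum:
  assumes "degree p \<le> n" shows "poly_apply T p x = (\<Sum>i\<le>n. coeff p i *s (T ^^ i) x)"
  unfolding poly_apply_def using assms by (intro sum.mono_neutral_left) (auto simp: coeff_eq_0)

lemma poly_apply_linear_factor:
  assumes T: "endo T" and x: "x \<in> L"
  shows "poly_apply T ([:- \<mu>, 1:] * q) x = T (poly_apply T q x) - \<mu> *s poly_apply T q x"
proof -
  let ?n = "degree q"
  have mem: "(T ^^ i) x \<in> L" for i
    using endo_closed[OF endo_power[OF T] x] .
  have "degree ([:- \<mu>, 1:] * q) \<le> Suc ?n"
    using degree_mult_le[of "[:- \<mu>, 1:]" q] by simp
  then have "poly_apply T ([:- \<mu>, 1:] * q) x =
      (\<Sum>i\<le>Suc ?n. coeff (pCons 0 q) i *s (T ^^ i) x - \<mu> *s (coeff q i *s (T ^^ i) x))"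
    by (subst poly_apply_eq_sum)
      (auto simp: scale_left_diff_distrib scale_left_distrib algebra_simps intro!: sum.cong)
  also have "\<dots> = (\<Sum>i\<le>?n. coeff q i *s T ((T ^^ i) x)) - \<mu> *s (\<Sum>i\<le>Suc ?n. coeff q i *s (T ^^ i) x)"
    unfolding sum_subtractf scale_sum_right[symmetric] by (subst sum.atMost_Suc_shift) simp
  also have "(\<Sum>i\<le>?n. coeff q i *s T ((T ^^ i) x)) = T (poly_apply T q x)"
    unfolding poly_apply_def using T mem
    by (subst endo_sum) (auto simp: endo_scale)
  also have "(\<Sum>i\<le>Suc ?n. coeff q i *s (T ^^ i) x) = poly_apply T q x"
    by (rule poly_apply_eq_sum[symmetric]) simp
  finally show ?thesis .
qed

lemma exists_poly_apply_eq_0: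
  assumes T: "endo T" and x: "x \<in> L"
  shows "\<exists>p. p \<noteq> 0 \<and> poly_apply T p x = 0"
proof -
  obtain N :: nat where N: "\<And>m (b :: nat \<Rightarrow> 'v).
      (\<And>i. i < m \<Longrightarrow> b i \<in> L \<and> b i \<notin> span (b ` {..<i})) \<Longrightarrow> m \<le> N"
    using independent_sequence_bound by blast
  define w where "w i = (T ^^ i) x" for i
  have "\<exists>i<Suc N. w i \<in> span (w ` {..<i})"
    using N[of "Suc N" w] endo_closed[OF endo_power[OF T] x] unfolding w_def by force
  then obtain n where "w n \<in> span (w ` {..<n})" by blast
  then obtain a where a: "w n = (\<Sum>i<n. a i *s w i)"
    using in_span_lessThan by blast
  define p where "p = monom 1 n - (\<Sum>i<n. monom (a i) i)"
  have p: "coeff p i = (if i = n then 1 else if i < n then - a i else 0)" for i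
    unfolding p_def by (simp add: coeff_sum)
  have "degree p \<le> n"
    by (rule degree_le) (simp add: p)
  then have "poly_apply T p x = (\<Sum>i\<le>n. coeff p i *s w i)"
    unfolding w_def by (rule poly_apply_eq_sum)
  also have "\<dots> = 0"
    using a by (simp add: lessThan_Suc_atMost[symmetric] p sum_negf)
  finally show ?thesis
    using p[of n] by (intro exI[of _ p]) auto
qed

end

locale split_fin_dim_subspace = fin_dim_subspace scale L
  for scale :: "'k::field \<Rightarrow> 'v::ab_group_add \<Rightarrow> 'v" (infixr "*s" 75) and L +
  assumes poly_root: "degree (p :: 'k poly) > 0 \<Longrightarrow> \<exists>x. poly p x = 0"
begin

text \<open>Some nonzero polynomial in \<open>T\<close> carries \<open>y\<close> into
  \<open>U\<close>. Split off a linear factor \<open>X - \<mu>\<close> with quotient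
  \<open>q\<close>: either \<open>q\<close> also carries \<open>y\<close> into \<open>U\<close> and
  has smaller degree, or its value at \<open>y\<close> is an eigenvector modulo \<open>U\<close>. A
  nonzero constant would put \<open>y\<close> itself into \<open>U\<close>.\<close>

lemma exists_eigenvector_mod:
  assumes T: "endo T" and U: "subspace U" and y: "y \<in> L" "y \<notin> U"
  shows "\<exists>z \<mu>. z \<in> L \<and> z \<notin> U \<and> T z - \<mu> *s z \<in> U"
proof -
  have mem: "(T ^^ i) x \<in> L" if "x \<in> L" for i x
    using endo_closed[OF endo_power[OF T] that] .
  have "\<exists>z \<mu>. z \<in> L \<and> z \<notin> U \<and> T z - \<mu> *s z \<in> U" if "p \<noteq> 0" "poly_apply T p y \<in> U" for p
    using that
  proof (induction "degree p" arbitrary: p)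
    case 0
    then obtain a where "p = [:a:]" "a \<noteq> 0"
      by (metis degree_eq_zeroE pCons_eq_0_iff)
    then have "(1 / a) *s (a *s y) \<in> U"
      using 0 by (intro subspace_scale[OF U, of "a *s y"]) (simp add: poly_apply_def)
    then show ?case using y \<open>a \<noteq> 0\<close> by simp
  next
    case (Suc n)
    then obtain \<mu> where "poly p \<mu> = 0" using poly_root[of p] by auto
    then obtain q where q: "p = [:- \<mu>, 1:] * q"
      by (metis dvdE poly_eq_0_iff_dvd)
    have "q \<noteq> 0" using Suc.prems(1) q by auto
    then have "degree p = degree [:- \<mu>, 1:] + degree q"
      unfolding q by (intro degree_mult_eq) auto
    then have deg: "degree q = n" using Suc.hyps(2) by simp
    have "T (poly_apply T q y) - \<mu> *s poly_apply T q y \<in> U"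
      using Suc.prems(2) unfolding q poly_apply_linear_factor[OF T y(1)] .
    moreover have "poly_apply T q y \<in> L"
      unfolding poly_apply_def using mem[OF y(1)] by auto
    ultimately show ?case
      using Suc.hyps(1)[of q] deg \<open>q \<noteq> 0\<close> by blast
  qed
  then show ?thesis
    using exists_poly_apply_eq_0[OF T y(1)] subspace_0[OF U] by metis
qed

text \<open>
  The reason is that \<open>T - \<mu>\<close> is invertible on the part of the span that belongs to the
  eigenvalues different from \<open>\<mu>\<close>.
\<close>

lemma triangular_range_mod:
  assumes T: "endo T" and tri: "triangular T m b \<theta>" and u: "u \<in> span (b ` {..<m})"
  shows "\<exists>z\<in>span (b ` {..<m}). u - (T z - \<mu> *s z) \<in> span (b ` {j. j < m \<and> \<theta> j = \<mu>})"
proof -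
  let ?U = "span (b ` {..<m})" and ?V = "span (b ` {j. j < m \<and> \<theta> j = \<mu>})"
  have UL: "?U \<subseteq> L"
    using triangularD(1)[OF tri] by (intro span_subset_L) auto
  define P where "P = {u. \<exists>z\<in>?U. u - (T z - \<mu> *s z) \<in> ?V}"
  have P: "subspace P"
  proof (rule subspaceI)
    show "0 \<in> P"
      unfolding P_def using endo_0[OF T] span_zero by force
  next
    fix u v assume "u \<in> P" "v \<in> P"
    then obtain z w where zw: "z \<in> ?U" "u - (T z - \<mu> *s z) \<in> ?V" "w \<in> ?U" "v - (T w - \<mu> *s w) \<in> ?V"
      unfolding P_def by blast
    have "(u + v) - (T (z + w) - \<mu> *s (z + w)) = (u - (T z - \<mu> *s z)) + (v - (T w - \<mu> *s w))"
      using zw UL by (subst endo_add[OF T]) (auto simp: algebra_simps)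
    then have "(u + v) - (T (z + w) - \<mu> *s (z + w)) \<in> ?V"
      using zw span_add by metis
    then show "u + v \<in> P"
      unfolding P_def using zw span_add by blast
  next
    fix a u assume "u \<in> P"
    then obtain z where z: "z \<in> ?U" "u - (T z - \<mu> *s z) \<in> ?V"
      unfolding P_def by blast
    have "a *s u - (T (a *s z) - \<mu> *s (a *s z)) = a *s (u - (T z - \<mu> *s z))"
      using z UL by (subst endo_scale[OF T]) (auto simp: algebra_simps)
    then have "a *s u - (T (a *s z) - \<mu> *s (a *s z)) \<in> ?V"
      using z span_scale by metis
    then show "a *s u \<in> P"
      unfolding P_def using z span_scale by blast
  qed
  have "b j \<in> P" if "j < m" for j
    using that
  proof (induction j rule: less_induct)
    case (less j)
    show ?case
    proof (cases "\<theta> j = \<mu>")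
      case True
      then have "b j - (T 0 - \<mu> *s 0) \<in> ?V"
        using less.prems endo_0[OF T] by (auto intro: span_base)
      then show ?thesis unfolding P_def using span_zero by blast
    next
      case False
      let ?w = "T (b j) - \<theta> j *s b j"
      have "?w \<in> span (b ` {..<j})"
        using triangularD(4)[OF tri less.prems] .
      moreover have "b ` {..<j} \<subseteq> P"
        using less by auto
      ultimately have w: "?w \<in> P"
        using span_minimal P by blast
      have "T (b j) - \<mu> *s b j \<in> P"
        unfolding P_def using less.prems by (auto intro!: bexI[of _ "b j"] simp: span_base span_zero)
      from subspace_scale[OF P subspace_diff[OF P this w], of "1 / (\<theta> j - \<mu>)"]
      have "(1 / (\<theta> j - \<mu>)) *s ((\<theta> j - \<mu>) *s b j) \<in> P"
        by (simp add: scale_left_diff_distrib)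
      then show ?thesis using False by simp
    qed
  qed
  then have "b ` {..<m} \<subseteq> P" by auto
  then have "u \<in> P" using span_minimal[OF _ P] u by blast
  then show ?thesis unfolding P_def by blast
qed

text \<open>A longest triangular system spans. Otherwise there is an eigenvector \<open>y\<close>
  modulo its span, for some \<open>\<mu>\<close>, and subtracting a suitable \<open>z\<close> from
  the span removes from the error \<open>T y - \<mu> *s y\<close> all components belonging to other
  eigenvalues, so that \<open>y - z\<close> prolongs the system.\<close>

theorem exists_triangular_frame:
  assumes T: "endo T"
  shows "\<exists>d b c \<theta>. frame d b c \<and> triangular T d b \<theta>"
proof -
  define P where "P m \<longleftrightarrow> (\<exists>b \<theta>. triangular T m b \<theta>)" for m
  obtain N :: nat where N: "\<And>m (b :: nat \<Rightarrow> 'v).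
      (\<And>i. i < m \<Longrightarrow> b i \<in> L \<and> b i \<notin> span (b ` {..<i})) \<Longrightarrow> m \<le> N"
    using independent_sequence_bound by blast
  have "\<forall>m. P m \<longrightarrow> m \<le> N"
    unfolding P_def using N triangularD(1,2) by metis
  moreover have "P 0" unfolding P_def triangular_def by simp
  ultimately obtain d where d: "P d" "\<And>m. P m \<Longrightarrow> m \<le> d"
    using Greatest_le_nat[of P] GreatestI_nat[of P] by blast
  then obtain b \<theta> where tri: "triangular T d b \<theta>"
    unfolding P_def by blast
  let ?U = "span (b ` {..<d})"
  have "L \<subseteq> ?U"
  proof (rule ccontr)
    assume "\<not> ?thesis"
    then obtain y where "y \<in> L" "y \<notin> ?U" by blast
    then obtain y \<mu> where y: "y \<in> L" "y \<notin> ?U" "T y - \<mu> *s y \<in> ?U"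
      using exists_eigenvector_mod[OF T subspace_span] by blast
    from triangular_range_mod[OF T tri y(3)] obtain z where z: "z \<in> ?U"
      "T y - \<mu> *s y - (T z - \<mu> *s z) \<in> span (b ` {j. j < d \<and> \<theta> j = \<mu>})" by blast
    have UL: "?U \<subseteq> L"
      using triangularD(1)[OF tri] by (intro span_subset_L) auto
    define b' \<theta>' where "b' = b(d := y - z)" and "\<theta>' = \<theta>(d := \<mu>)"
    have b': "b' ` J = b ` J" if "J \<subseteq> {..<d}" for J
      using that unfolding b'_def by auto
    have \<theta>': "{j. j < i \<and> \<theta>' j = \<theta>' i} = {j. j < i \<and> \<theta> j = \<theta>' i}" if "i \<le> d" for i
      using that unfolding \<theta>'_def by auto
    have "triangular T (Suc d) b' \<theta>'"
      unfolding triangular_def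
    proof (intro allI impI)
      fix i assume i: "i < Suc d"
      have sub: "{..<i} \<subseteq> {..<d}" "{j. j < i \<and> \<theta> j = \<theta>' i} \<subseteq> {..<d}"
        using i by auto
      have "b' i \<in> L \<and> b' i \<notin> span (b ` {..<i}) \<and>
        T (b' i) - \<theta>' i *s b' i \<in> span (b ` {j. j < i \<and> \<theta> j = \<theta>' i})"
      proof (cases "i = d")
        case True
        have "T (y - z) - \<mu> *s (y - z) = T y - \<mu> *s y - (T z - \<mu> *s z)"
          using y z UL by (subst endo_diff[OF T]) (auto simp: algebra_simps)
        moreover have "y - z \<notin> ?U"
          using y z span_add by fastforce
        ultimately show ?thesis
          using True y z UL by (auto simp: b'_def \<theta>'_def)
      next
        case False
        then show ?thesis
          using i triangularD[OF tri, of i] by (simp add: b'_def \<theta>'_def)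
      qed
      then show "b' i \<in> L \<and> b' i \<notin> span (b' ` {..<i}) \<and>
        T (b' i) - \<theta>' i *s b' i \<in> span (b' ` {j. j < i \<and> \<theta>' j = \<theta>' i})"
        using i by (simp add: b'[OF sub(1)] \<theta>' b'[OF sub(2)] less_Suc_eq_le)
    qed
    then have "P (Suc d)" unfolding P_def by blast
    then show False using d(2) by fastforce
  qed
  then show ?thesis
    using frame_of_sequence[of d b] triangularD[OF tri] tri by metis
qed

end

section \<open>Reading eigenvalues off a triangular basis\<close>

context fin_dim_subspace begin

lemma triangular_coordinate:
  assumes "frame d b c" "triangular T d b \<theta>" "i < d" "k < d"
  shows "c k (T (b i)) = (if k = i then \<theta> i else c k (T (b i) - \<theta> i *s b i))"
    and "\<not> (k < i \<and> \<theta> k = \<theta> i) \<Longrightarrow> c k (T (b i) - \<theta> i *s b i) = 0"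
proof -
  show 0: "c k (T (b i) - \<theta> i *s b i) = 0" if "\<not> (k < i \<and> \<theta> k = \<theta> i)"
    using assms that triangularD(3)[OF assms(2,3)]
    by (intro coordinate_zero_on_span[OF assms(1,4), of "{j. j < i \<and> \<theta> j = \<theta> i}"]) auto
  note f = frame_functional[OF assms(1,4)]
  have b: "b i \<in> L" using frame_mem[OF assms(1,3)] .
  have "b ` {j. j < i \<and> \<theta> j = \<theta> i} \<subseteq> L"
    using frame_mem[OF assms(1)] assms(3) by auto
  then have "T (b i) - \<theta> i *s b i \<in> L"
    using triangularD(3)[OF assms(2,3)] span_subset_L by blast
  then have "c k (T (b i)) = c k (T (b i) - \<theta> i *s b i) + \<theta> i * c k (b i)"
    using functional_add[OF f, of "T (b i) - \<theta> i *s b i" "\<theta> i *s b i"] functional_scale[OF f b] b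
    by simp
  then show "c k (T (b i)) = (if k = i then \<theta> i else c k (T (b i) - \<theta> i *s b i))"
    using 0 frame_dual[OF assms(1,4,3)] by auto
qed

text \<open>Let \<open>m\<close> be the largest index with \<open>\<theta> m \<noteq> \<mu>\<close>
  and nonzero coordinate of \<open>x\<close>. Only later vectors of eigenvalue
  \<open>\<theta> m\<close> could disturb coordinate \<open>m\<close> of \<open>T x\<close>, and
  their coefficients are 0 by the choice of \<open>m\<close>; so coordinate \<open>m\<close> of
  \<open>T x - \<mu> *s x\<close> is \<open>(\<theta> m - \<mu>) * c m x\<close>, which is
  nonzero.\<close>

lemma triangular_eigenspace:
  assumes fr: "frame d b c" and tri: "triangular T d b \<theta>" and T: "endo T"
    and x: "x \<in> L" "T x - \<mu> *s x \<in> span (b ` {j. j < d \<and> \<theta> j = \<mu>})"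
  shows "x \<in> span (b ` {j. j < d \<and> \<theta> j = \<mu>})"
proof -
  have "c k x = 0" if "k < d" "\<theta> k \<noteq> \<mu>" for k
  proof (rule ccontr)
    assume "c k x \<noteq> 0"
    define S where "S = {k. k < d \<and> \<theta> k \<noteq> \<mu> \<and> c k x \<noteq> 0}"
    have S: "finite S" "S \<noteq> {}"
      using that \<open>c k x \<noteq> 0\<close> unfolding S_def by auto
    define m where "m = Max S"
    have "m \<in> S" and max: "\<And>l. l \<in> S \<Longrightarrow> l \<le> m"
      using S unfolding m_def by auto
    then have m: "m < d" "\<theta> m \<noteq> \<mu>" "c m x \<noteq> 0"
      unfolding S_def by auto
    note f = frame_functional[OF fr m(1)]
    have "c l x * c m (T (b l)) = (if l = m then \<theta> m * c m x else 0)" if l: "l < d" for l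
    proof (cases "m < l \<and> \<theta> m = \<theta> l")
      case True
      then have "l \<notin> S" using max by fastforce
      then show ?thesis using l True m(2) unfolding S_def by auto
    next
      case False
      then show ?thesis
        using triangular_coordinate[OF fr tri l m(1)] by auto
    qed
    then have "c m (T x) = \<theta> m * c m x"
      using functional_expand[OF fr functional_endo[OF f T] x(1)] m(1) by simp
    moreover have "c m (T x - \<mu> *s x) = 0"
      using m by (intro coordinate_zero_on_span[OF fr m(1) _ _ x(2)]) auto
    moreover have "c m (T x - \<mu> *s x) = c m (T x) - \<mu> * c m x"
      using x endo_closed[OF T] functional_diff[OF f] functional_scale[OF f] by auto
    ultimately show False using m by simp
  qed
  then have "(\<Sum>k<d. c k x *s b k) = (\<Sum>k | k < d \<and> \<theta> k = \<mu>. c k x *s b k)"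
    by (intro sum.mono_neutral_right) auto
  also have "\<dots> \<in> span (b ` {j. j < d \<and> \<theta> j = \<mu>})"
    by (intro span_sum span_scale span_base) auto
  finally show ?thesis by (subst frame_expand[OF fr x(1)])
qed

lemma eigenvalue_in_triangular:
  assumes fr: "frame d b c" and tri: "triangular T d b \<theta>" and T: "endo T"
    and x: "x \<in> L" "T x = \<mu> *s x" "x \<noteq> 0"
  shows "\<mu> \<in> \<theta> ` {..<d}"
proof (rule ccontr)
  assume "\<not> ?thesis"
  then have "{j. j < d \<and> \<theta> j = \<mu>} = {}" by auto
  then have "x \<in> span {}"
    using triangular_eigenspace[OF fr tri T x(1), of \<mu>] x(2) span_zero
    by (simp only: image_empty diff_self)
  then show False using x(3) by simp
qed

text \<open>Modulo the earlier vectors \<open>T ^^ k\<close> multiplies \<open>b i\<close> by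
  \<open>\<theta> i ^ k\<close>; conversely, if all \<open>\<theta> i\<close> vanish,
  \<open>T\<close> moves each step of the flag into the previous one.\<close>

lemma triangular_nilpotent_iff:
  assumes fr: "frame d b c" and tri: "triangular T d b \<theta>" and T: "endo T"
  shows "(\<exists>n. \<forall>x\<in>L. (T ^^ n) x = 0) \<longleftrightarrow> (\<forall>i<d. \<theta> i = 0)"
proof (intro iffI allI impI)
  fix i assume i: "i < d"
  assume "\<exists>n. \<forall>x\<in>L. (T ^^ n) x = 0"
  then obtain n where n: "\<forall>x\<in>L. (T ^^ n) x = 0" by blast
  let ?V = "span (b ` {..<i})"
  note b = triangularD[OF tri i]
  have VL: "?V \<subseteq> L"
    using frame_mem[OF fr] i by (intro span_subset_L) auto
  have "(T ^^ k) (b i) - \<theta> i ^ k *s b i \<in> ?V" for k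
  proof (induction k)
    case 0
    show ?case by (simp add: span_zero)
  next
    case (Suc k)
    let ?r = "(T ^^ k) (b i) - \<theta> i ^ k *s b i"
    have "T ((T ^^ k) (b i)) = T (?r + \<theta> i ^ k *s b i)" by simp
    also have "\<dots> = T ?r + \<theta> i ^ k *s T (b i)"
      using Suc VL b(1) by (subst endo_add[OF T]) (auto simp: endo_scale[OF T])
    finally have "(T ^^ Suc k) (b i) - \<theta> i ^ Suc k *s b i =
        T ?r + \<theta> i ^ k *s (T (b i) - \<theta> i *s b i)"
      by (simp add: scale_right_diff_distrib mult.commute)
    also have "\<dots> \<in> ?V"
      using triangular_stable[OF T tri _ Suc] i b(4) by (intro span_add span_scale) auto
    finally show ?case .
  qed
  from this[of n] have "- (\<theta> i ^ n *s b i) \<in> ?V"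
    using n b(1) by simp
  then have "\<theta> i ^ n *s b i \<in> ?V" using span_neg by fastforce
  then have "(1 / \<theta> i ^ n) *s (\<theta> i ^ n *s b i) \<in> ?V" by (rule span_scale)
  then show "\<theta> i = 0" using b(2) by (cases "\<theta> i = 0") auto
next
  assume 0: "\<forall>i<d. \<theta> i = 0"
  have "(T ^^ k) x = 0" if "x \<in> span (b ` {..<k})" "k \<le> d" for k x
    using that
  proof (induction k arbitrary: x)
    case 0
    then show ?case by simp
  next
    case (Suc k)
    have "T (b j) \<in> span (b ` {..<k})" if "j < Suc k" for j
    proof -
      have "T (b j) \<in> span (b ` {..<j})"
        using triangularD(4)[OF tri, of j] 0 that Suc.prems(2) by simp
      moreover have "span (b ` {..<j}) \<subseteq> span (b ` {..<k})"
        using that by (intro span_mono) auto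
      ultimately show ?thesis by blast
    qed
    then have "b ` {..<Suc k} \<subseteq> {x \<in> L. T x \<in> span (b ` {..<k})}"
      using frame_mem[OF fr] Suc.prems(2) by auto
    from span_minimal[OF this subspace_endo_vimage[OF T subspace_span]]
    have "T x \<in> span (b ` {..<k})" using Suc.prems(1) by blast
    then show ?case using Suc.IH Suc.prems(2) by (simp add: funpow_swap1)
  qed
  then have "\<forall>x\<in>L. (T ^^ d) x = 0" using frame_span[OF fr] by blast
  then show "\<exists>n. \<forall>x\<in>L. (T ^^ n) x = 0" by blast
qed

end

context split_fin_dim_subspace begin

lemma trace_nilpotent:
  assumes T: "endo T" and n: "\<forall>x\<in>L. (T ^^ n) x = 0"
  shows "trace T = 0"
proof -
  obtain d b c \<theta> where fr: "frame d b c" and tri: "triangular T d b \<theta>"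
    using exists_triangular_frame[OF T] by blast
  then have "\<theta> i = 0" if "i < d" for i
    using triangular_nilpotent_iff[OF fr tri T] n that by blast
  then have "c i (T (b i)) = 0" if "i < d" for i
    using triangular_coordinate(1)[OF fr tri that that] that by simp
  then show ?thesis
    unfolding trace_eq[OF fr T] by simp
qed

end

section \<open>Nilpotent ideals and the radical\<close>

sublocale fin_dim_lie_algebra \<subseteq> fin_dim_subspace scale L
  by unfold_locales (rule subspace_L fin_dim)+

lemma (in fin_dim_subspace) subspace_endo_image:
  assumes T: "endo T" and V: "subspace V" "V \<subseteq> L" shows "subspace (T ` V)"
proof (rule subspaceI)
  show "0 \<in> T ` V"
    using subspace_0[OF V(1)] endo_0[OF T] by (metis imageI)
  show "u + v \<in> T ` V" if uv: "u \<in> T ` V" "v \<in> T ` V" for u v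
  proof -
    obtain y z where yz: "y \<in> V" "z \<in> V" "u = T y" "v = T z" using uv by blast
    then have "u + v = T (y + z)" using V(2) by (simp add: endo_add[OF T] subset_iff)
    then show ?thesis using yz subspace_add[OF V(1)] by blast
  qed
  show "a *s u \<in> T ` V" if u: "u \<in> T ` V" for a u
  proof -
    obtain y where y: "y \<in> V" "u = T y" using u by blast
    then have "a *s u = T (a *s y)" using V(2) by (simp add: endo_scale[OF T] subset_iff)
    then show ?thesis using y subspace_scale[OF V(1)] by blast
  qed
qed

section \<open>Nilpotent actions and Engel's theorem\<close>

context fin_dim_lie_algebra begin

lemma linear_form_eq_functional: "linear_form = functional"
  unfolding linear_form_def functional_def by (simp add: fun_eq_iff)

lemma endo_br: "x \<in> L \<Longrightarrow> endo (br x)"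
  unfolding endo_def by (simp add: br_closed br_add_right br_scale_right)

lemma endo_br_left: "y \<in> L \<Longrightarrow> endo (\<lambda>x. br x y)"
  unfolding endo_def by (simp add: br_closed br_add_left br_scale_left)

lemmas br_0_left = endo_0[OF endo_br_left]
  and br_diff_right = endo_diff[OF endo_br] and br_diff_left = endo_diff[OF endo_br_left]

lemma br_anticommute:
  assumes "x \<in> L" "y \<in> L" shows "br y x = - br x y"
proof -
  have "br (x + y) (x + y) = br x x + br y x + (br x y + br y y)"
    using assms by (simp only: L_closed br_add_left br_add_right)
  then have "br y x + br x y = 0"
    using assms by (simp add: br_self)
  then show ?thesis by (simp add: eq_neg_iff_add_eq_0)
qed

lemma br_derivation:
  assumes "x \<in> L" "y \<in> L" "z \<in> L"
  shows "br x (br y z) = br (br x y) z + br y (br x z)"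
proof -
  have "br y (br z x) = - br y (br x z)"
    using assms br_anticommute[of x z] br_scale_right[of y "br x z" "-1"] by (simp add: br_closed)
  moreover have "br z (br x y) = - br (br x y) z"
    using assms br_anticommute[of "br x y" z] by (simp add: br_closed)
  ultimately show ?thesis
    using jacobi[OF assms] by (simp add: algebra_simps)
qed

text \<open>Iterated with fixed \<open>S\<close> it gives the chain L, [S, L], [S, [S, L]], ...; the
  condition \<open>(act S ^^ p) L \<subseteq> {0}\<close> says that every product of
  \<open>p\<close> operators \<open>ad s\<close> with \<open>s\<close> in \<open>S\<close> is 0 on
  \<open>L\<close>.\<close>

definition act :: "'v set \<Rightarrow> 'v set \<Rightarrow> 'v set" where
  "act S W = span {br x y | x y. x \<in> S \<and> y \<in> W}"

lemma derived_eq_act: "derived I = act I I"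
  unfolding derived_def act_def ..

lemma act_mem: "x \<in> S \<Longrightarrow> y \<in> W \<Longrightarrow> br x y \<in> act S W"
  unfolding act_def by (rule span_base) blast

lemma act_least:
  "subspace V \<Longrightarrow> (\<And>x y. x \<in> S \<Longrightarrow> y \<in> W \<Longrightarrow> br x y \<in> V) \<Longrightarrow> act S W \<subseteq> V"
  unfolding act_def by (rule span_minimal) auto

lemma subspace_act: "subspace (act S W)"
  unfolding act_def by (rule subspace_span)

lemma act_mono: "S \<subseteq> S' \<Longrightarrow> W \<subseteq> W' \<Longrightarrow> act S W \<subseteq> act S' W'"
  unfolding act_def by (rule span_mono) blast

lemma act_power_mono: "W \<subseteq> W' \<Longrightarrow> (act S ^^ n) W \<subseteq> (act S ^^ n) W'"
  by (induction n) (auto dest: act_mono[OF subset_refl])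

lemma subspace_act_power: "subspace W \<Longrightarrow> subspace ((act S ^^ n) W)"
  by (cases n) (auto simp: subspace_act)

lemma act_power_subset: "subspace V \<Longrightarrow> (\<And>x y. x \<in> S \<Longrightarrow> y \<in> V \<Longrightarrow> br x y \<in> V) \<Longrightarrow> (act S ^^ n) V \<subseteq> V"
proof (induction n)
  case (Suc n)
  have "act S ((act S ^^ n) V) \<subseteq> act S V"
    using Suc by (intro act_mono) auto
  also have "act S V \<subseteq> V"
    using Suc.prems by (intro act_least)
  finally show ?case by simp
qed simp

lemma act_power_subset_L: "S \<subseteq> L \<Longrightarrow> (act S ^^ n) L \<subseteq> L"
  using act_power_subset[OF subspace_L, of S n] br_closed by blast

lemma act_power_decreasing: "S \<subseteq> L \<Longrightarrow> (act S ^^ Suc n) L \<subseteq> (act S ^^ n) L"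
  unfolding funpow_Suc_right o_apply
  by (rule act_power_mono) (use act_power_subset_L[of S 1] in simp)

lemma act_power_stable:
  assumes S: "S \<subseteq> L" and x: "x \<in> L" "\<And>y. y \<in> S \<Longrightarrow> br x y \<in> S" and w: "w \<in> (act S ^^ n) L"
  shows "br x w \<in> (act S ^^ n) L"
  using w
proof (induction n arbitrary: w)
  case 0
  then show ?case using x br_closed by simp
next
  case (Suc n)
  have "act S ((act S ^^ n) L) \<subseteq> {w \<in> L. br x w \<in> (act S ^^ Suc n) L}"
  proof (rule act_least)
    show "subspace {w \<in> L. br x w \<in> (act S ^^ Suc n) L}"
      by (rule subspace_endo_vimage[OF endo_br[OF x(1)] subspace_act_power[OF subspace_L]])
    fix y z assume yz: "y \<in> S" "z \<in> (act S ^^ n) L"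
    then have L: "y \<in> L" "z \<in> L"
      using S act_power_subset_L[OF S] by blast+
    have "br x (br y z) = br (br x y) z + br y (br x z)"
      by (rule br_derivation[OF x(1) L])
    also have "\<dots> \<in> act S ((act S ^^ n) L)"
      using yz x(2) Suc.IH by (intro subspace_add[OF subspace_act] act_mem) auto
    finally show "br y z \<in> {w \<in> L. br x w \<in> (act S ^^ Suc n) L}"
      using L br_closed by simp
  qed
  then show ?case using Suc.prems by auto
qed

text \<open>The chain of \<open>M\<close> is stable under \<open>ad x\<close>. On the quotient of
  two consecutive terms \<open>M\<close> acts by 0, so every element of the enlarged space acts as a
  multiple of \<open>ad x\<close>, and \<open>r\<close> steps descend one level; there are
  \<open>p\<close> levels.\<close>

lemma acts_nilpotently_insert:
  assumes M: "subspace M" "M \<subseteq> L" and p: "(act M ^^ p) L \<subseteq> {0}"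
    and x: "x \<in> L" "\<And>m. m \<in> M \<Longrightarrow> br x m \<in> M" and r: "\<And>y. y \<in> L \<Longrightarrow> (br x ^^ r) y = 0"
  shows "(act (span (insert x M)) ^^ (r * p)) L \<subseteq> {0}"
proof -
  let ?N = "span (insert x M)"
  define V where "V j = (act M ^^ j) L" for j
  have V: "subspace (V j)" "V j \<subseteq> L" "V (Suc j) \<subseteq> V j" for j
    unfolding V_def using subspace_act_power[OF subspace_L] act_power_subset_L[OF M(2)]
      act_power_decreasing[OF M(2)] by blast+
  have xV: "br x w \<in> V j" if "w \<in> V j" for w j
    using act_power_stable[OF M(2) x] that unfolding V_def by blast
  have xVs: "(br x ^^ s) w \<in> V j" if "w \<in> V j" for w j s
    using that by (induction s) (auto simp: xV)
  have MV: "br m w \<in> V (Suc j)" if "m \<in> M" "w \<in> V j" for m w j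
    using act_mem[OF that] unfolding V_def by simp
  note xe = endo_power[OF endo_br[OF x(1)]]
  have step: "(act ?N ^^ r) (V j) \<subseteq> V (Suc j)" for j
  proof -
    \<comment> \<open>What \<open>s\<close> applications of elements of \<open>?N\<close> to
      \<open>V j\<close> can reach: the next level, plus the image of \<open>V j\<close> under the
      \<open>s\<close>-th power of \<open>ad x\<close>.\<close>
    define W where "W s = {w + u | w u. w \<in> V (Suc j) \<and> u \<in> (br x ^^ s) ` V j}" for s
    have W: "subspace (W s)" for s
    proof -
      have "subspace ((br x ^^ s) ` V j)"
        by (rule subspace_endo_image[OF xe V(1,2)])
      from subspace_sums[OF V(1)[of "Suc j"] this] show ?thesis
        unfolding W_def .
    qed
    have NW: "act ?N (W s) \<subseteq> W (Suc s)" for s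
    proof (rule act_least[OF W])
      fix n u assume "n \<in> ?N" "u \<in> W s"
      then obtain a w y where a: "n - a *s x \<in> span M" and
        u: "u = w + (br x ^^ s) y" "w \<in> V (Suc j)" "y \<in> V j"
        unfolding W_def span_breakdown_eq by blast
      define m where "m = n - a *s x"
      have m: "m \<in> M" "n = m + a *s x"
        using a span_eq_iff[THEN iffD2, OF M(1)] unfolding m_def by auto
      have L: "m \<in> L" "w \<in> L" "y \<in> L" "(br x ^^ s) y \<in> L" "x \<in> L"
        using m(1) M(2) u V(2) xVs x(1) by blast+
      have "br n u = br m w + br m ((br x ^^ s) y) + a *s br x w + a *s br x ((br x ^^ s) y)"
        unfolding m u(1) using L
        by (simp add: br_add_left br_add_right br_scale_left br_closed scale_right_distrib)
      also have "\<dots> = (br m w + br m ((br x ^^ s) y) + a *s br x w) + (br x ^^ Suc s) (a *s y)"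
        using endo_scale[OF endo_power[OF endo_br[OF x(1)], of "Suc s"] L(3)] by simp
      also have "\<dots> \<in> W (Suc s)"
      proof -
        have "br m w + br m ((br x ^^ s) y) + a *s br x w \<in> V (Suc j)"
        proof (intro subspace_add[OF V(1)] subspace_scale[OF V(1)])
          show "br m w \<in> V (Suc j)" using MV[OF m(1) u(2)] V(3) by blast
          show "br m ((br x ^^ s) y) \<in> V (Suc j)" by (rule MV[OF m(1) xVs[OF u(3)]])
          show "br x w \<in> V (Suc j)" by (rule xV[OF u(2)])
        qed
        then show ?thesis
          unfolding W_def using subspace_scale[OF V(1) u(3)] by blast
      qed
      finally show "br n u \<in> W (Suc s)" .
    qed
    have "(act ?N ^^ s) (V j) \<subseteq> W s" for s
    proof (induction s)
      case 0
      show ?case unfolding W_def using subspace_0[OF V(1), of "Suc j"] by force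
    next
      case (Suc s)
      have "(act ?N ^^ Suc s) (V j) \<subseteq> act ?N (W s)"
        using act_mono[OF subset_refl Suc] by simp
      then show ?case using NW by blast
    qed
    moreover have "W r \<subseteq> V (Suc j)"
      unfolding W_def using r subsetD[OF V(2)] by auto
    ultimately show ?thesis by blast
  qed
  have "(act ?N ^^ (r * j)) L \<subseteq> V j" for j
  proof (induction j)
    case 0
    show ?case unfolding V_def by simp
  next
    case (Suc j)
    have "(act ?N ^^ (r * Suc j)) L = (act ?N ^^ r) ((act ?N ^^ (r * j)) L)"
      by (simp add: funpow_add)
    also have "\<dots> \<subseteq> (act ?N ^^ r) (V j)"
      by (rule act_power_mono[OF Suc])
    also have "\<dots> \<subseteq> V (Suc j)" by (rule step)
    finally show ?case .
  qed
  then show ?thesis using p unfolding V_def by blast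
qed

text \<open>Take a subalgebra \<open>M\<close> of \<open>I\<close> that acts nilpotently on
  \<open>L\<close> and has the longest possible basis. If it were proper, some \<open>x\<close> in
  \<open>I\<close> outside \<open>M\<close> would normalize it, and \<open>M\<close> with
  \<open>x\<close> adjoined would again act nilpotently.\<close>

theorem engel:
  assumes I: "subspace I" "I \<subseteq> L" "\<And>x y. x \<in> I \<Longrightarrow> y \<in> I \<Longrightarrow> br x y \<in> I"
    and nil: "\<And>x. x \<in> I \<Longrightarrow> ad_nilpotent x"
  shows "\<exists>p. (act I ^^ p) L \<subseteq> {0}"
proof -
  define P where "P m \<longleftrightarrow> (\<exists>b. (\<forall>i<m. b i \<in> I \<and> b i \<notin> span (b ` {..<i})) \<and>
    (\<forall>x\<in>span (b ` {..<m}). \<forall>y\<in>span (b ` {..<m}). br x y \<in> span (b ` {..<m})) \<and>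
    (\<exists>p. (act (span (b ` {..<m})) ^^ p) L \<subseteq> {0}))" for m :: nat
  obtain N :: nat where N: "\<And>m (b :: nat \<Rightarrow> 'v).
      (\<And>i. i < m \<Longrightarrow> b i \<in> L \<and> b i \<notin> span (b ` {..<i})) \<Longrightarrow> m \<le> N"
    using independent_sequence_bound by blast
  have "\<forall>m. P m \<longrightarrow> m \<le> N"
    unfolding P_def using N I(2) by (metis subsetD)
  moreover have "P 0"
  proof -
    have "act {0} L \<subseteq> {0}"
      by (rule act_least) (auto simp: br_0_left)
    then have "(act {0} ^^ 1) L \<subseteq> {0}" by simp
    then show ?thesis
      unfolding P_def using br_0_left by (auto simp del: funpow.simps)
  qed
  ultimately obtain d where d: "P d" "\<And>m. P m \<Longrightarrow> m \<le> d"
    using Greatest_le_nat[of P] GreatestI_nat[of P] by blast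
  then obtain b p where b: "\<And>i. i < d \<Longrightarrow> b i \<in> I \<and> b i \<notin> span (b ` {..<i})"
    and alg: "\<And>x y. x \<in> span (b ` {..<d}) \<Longrightarrow> y \<in> span (b ` {..<d}) \<Longrightarrow> br x y \<in> span (b ` {..<d})"
    and p: "(act (span (b ` {..<d})) ^^ p) L \<subseteq> {0}"
    unfolding P_def by blast
  define M where "M = span (b ` {..<d})"
  have "b ` {..<d} \<subseteq> I" using b by auto
  then have M: "subspace M" "M \<subseteq> I" "M \<subseteq> L"
    unfolding M_def using span_minimal[OF _ I(1), of "b ` {..<d}"] I(2) by auto
  have "I \<subseteq> M"
  proof (rule ccontr)
    assume "\<not> I \<subseteq> M"
    \<comment> \<open>The chain I, [M, I], ... ends in \<open>M\<close>. An element of the last term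
      not contained in \<open>M\<close> is bracketed by \<open>M\<close> into the next term, hence
      into \<open>M\<close>; this is the normalizing \<open>x\<close>.\<close>
    define k where "k = (LEAST k. (act M ^^ k) I \<subseteq> M)"
    have "(act M ^^ p) I \<subseteq> M"
      using act_power_mono[OF I(2), of p M] p subspace_0[OF M(1)] unfolding M_def by blast
    then have k: "(act M ^^ k) I \<subseteq> M"
      unfolding k_def by (rule LeastI)
    with \<open>\<not> I \<subseteq> M\<close> obtain l where l: "k = Suc l" by (cases k) auto
    then have "\<not> (act M ^^ l) I \<subseteq> M"
      unfolding k_def using not_less_Least lessI by metis
    then obtain x where x: "x \<in> (act M ^^ l) I" "x \<notin> M" by blast
    have "x \<in> I"
      using act_power_subset[OF I(1), of M l] I(3) M(2) x(1) by blast
    then have xL: "x \<in> L" using I(2) by blast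
    have mx: "br m x \<in> M" if "m \<in> M" for m
      using act_mem[OF that x(1)] k l by auto
    have xm: "br x m \<in> M" if "m \<in> M" for m
      using mx[OF that] br_anticommute[of m x] that M(3) xL subspace_neg[OF M(1)] by auto
    obtain r where r: "\<And>y. y \<in> L \<Longrightarrow> (br x ^^ r) y = 0"
      using nil[OF \<open>x \<in> I\<close>] unfolding ad_nilpotent_def by blast
    define b' where "b' = b(d := x)"
    have b': "b' ` {..<i} = b ` {..<i}" if "i \<le> d" for i
      using that unfolding b'_def by auto
    have "b' ` {..<Suc d} = insert x (b ` {..<d})"
      using b'[of d] by (simp add: lessThan_Suc) (simp add: b'_def)
    then have span: "span (b' ` {..<Suc d}) = span (insert x M)"
      unfolding M_def by (simp add: span_insert span_span)
    have "br u v \<in> span (insert x M)" if "u \<in> span (insert x M)" "v \<in> span (insert x M)" for u v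
    proof -
      from that obtain a a' where "u - a *s x \<in> span M" "v - a' *s x \<in> span M"
        unfolding span_breakdown_eq by blast
      moreover define m m' where "m = u - a *s x" "m' = v - a' *s x"
      ultimately have m: "m \<in> M" "m' \<in> M" "u = m + a *s x" "v = m' + a' *s x"
        using span_eq_iff[THEN iffD2, OF M(1)] by auto
      have L: "m \<in> L" "m' \<in> L" using m M(3) by auto
      have "br u v = br m m' + a' *s br m x + a *s br x m'"
        unfolding m(3,4) using L xL
        by (simp add: br_add_left br_add_right br_scale_left br_scale_right br_closed br_self
            scale_right_distrib)
      also have "\<dots> \<in> M"
        using m alg[of m m'] xm mx unfolding M_def[symmetric]
        by (intro subspace_add[OF M(1)] subspace_scale[OF M(1)]) auto
      finally show ?thesis by (simp add: span_base)
    qed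
    moreover have "(act (span (insert x M)) ^^ (r * p)) L \<subseteq> {0}"
      using acts_nilpotently_insert[OF M(1,3) _ xL xm r] p unfolding M_def by blast
    moreover have "b' i \<in> I \<and> b' i \<notin> span (b' ` {..<i})" if "i < Suc d" for i
    proof (cases "i = d")
      case True
      then show ?thesis using x(2) \<open>x \<in> I\<close> b'[of d] unfolding M_def by (simp add: b'_def)
    next
      case False
      then show ?thesis using that b[of i] b'[of i] by (simp add: b'_def)
    qed
    ultimately have "P (Suc d)"
      unfolding P_def using span by (intro exI[of _ b']) auto
    then show False using d(2) by fastforce
  qed
  then have "I = M" using M(2) by blast
  then show ?thesis using p unfolding M_def by blast
qed

section \<open>Solvable ideals and the radical\<close>

lemma lie_idealD:
  assumes "lie_ideal I"
  shows "subspace I" "I \<subseteq> L" "x \<in> L \<Longrightarrow> y \<in> I \<Longrightarrow> br x y \<in> I" "x \<in> L \<Longrightarrow> y \<in> I \<Longrightarrow> br y x \<in> I"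
proof -
  show 1: "subspace I" "I \<subseteq> L" "x \<in> L \<Longrightarrow> y \<in> I \<Longrightarrow> br x y \<in> I" for x y
    using assms unfolding lie_ideal_def by blast+
  show "br y x \<in> I" if "x \<in> L" "y \<in> I"
    using 1(3)[OF that] br_anticommute[of x y] that 1(2) subspace_neg[OF 1(1)] by auto
qed

lemma ideal_acts_nilpotently:
  assumes I: "lie_ideal I" and "\<And>x. x \<in> I \<Longrightarrow> ad_nilpotent x"
  obtains p where "(act I ^^ p) L \<subseteq> {0}"
  using engel[of I] lie_idealD[OF I] assms(2) by blast

lemma derived_mono: "I \<subseteq> J \<Longrightarrow> derived I \<subseteq> derived J"
  unfolding derived_eq_act by (rule act_mono)

lemma derived_power_mono: "I \<subseteq> J \<Longrightarrow> (derived ^^ n) I \<subseteq> (derived ^^ n) J"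
  by (induction n) (auto dest: derived_mono)

lemma subspace_derived_power: "subspace I \<Longrightarrow> subspace ((derived ^^ n) I)"
  by (cases n) (auto simp: derived_eq_act subspace_act)

lemma solvableI:
  assumes "subspace I" "(derived ^^ k) I \<subseteq> J" "solvable J"
  shows "solvable I"
proof -
  obtain n where "(derived ^^ n) J = {0}" using assms(3) unfolding solvable_def by blast
  then have "(derived ^^ (n + k)) I \<subseteq> {0}"
    using derived_power_mono[OF assms(2), of n] by (simp add: funpow_add)
  then show ?thesis
    unfolding solvable_def using subspace_0[OF subspace_derived_power[OF assms(1)]] by blast
qed

lemma solvable_0: "solvable {0}"
  unfolding solvable_def by (rule exI[of _ 0]) simp

text \<open>The derived series of \<open>I\<close> descends at least as fast as the chain of
  \<open>I\<close> acting on \<open>L\<close>.\<close>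

lemma ideal_acts_nilpotently_solvable:
  assumes I: "lie_ideal I" and p: "(act I ^^ p) L \<subseteq> {0}"
  shows "solvable I"
proof -
  have "(derived ^^ k) I \<subseteq> I \<inter> (act I ^^ k) L" for k
  proof (induction k)
    case 0
    then show ?case using lie_idealD(2)[OF I] by simp
  next
    case (Suc k)
    have "derived I \<subseteq> I"
      unfolding derived_eq_act using lie_idealD[OF I] by (intro act_least) auto
    moreover have "act ((derived ^^ k) I) ((derived ^^ k) I) \<subseteq> act I ((act I ^^ k) L)"
      using Suc by (intro act_mono) auto
    ultimately show ?case
      using derived_mono[of "(derived ^^ k) I" I] Suc by (auto simp: derived_eq_act[of "_ I"])
  qed
  from this[of p] p show ?thesis
    using solvableI[OF lie_idealD(1)[OF I] _ solvable_0] by blast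
qed

text \<open>Modulo \<open>J\<close> the derived series of the sum is that of \<open>I\<close>, so it
  falls into \<open>J\<close> after finitely many steps.\<close>

lemma solvable_ideal_sum:
  assumes I: "lie_ideal I" "solvable I" and J: "lie_ideal J" "solvable J"
  defines "S \<equiv> {x + y | x y. x \<in> I \<and> y \<in> J}"
  shows "lie_ideal S" "solvable S"
proof -
  note i = lie_idealD[OF I(1)] and j = lie_idealD[OF J(1)]
  have S: "subspace S" unfolding S_def by (rule subspace_sums[OF i(1) j(1)])
  show "lie_ideal S"
    unfolding lie_ideal_def
  proof (intro conjI ballI)
    show "S \<subseteq> L" unfolding S_def using i(2) j(2) by auto
    fix x s assume "x \<in> L" "s \<in> S"
    then obtain y z where yz: "s = y + z" "y \<in> I" "z \<in> J" unfolding S_def by blast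
    then have "br x s = br x y + br x z"
      using \<open>x \<in> L\<close> i(2) j(2) br_add_right by blast
    then show "br x s \<in> S"
      unfolding S_def using i(3)[OF \<open>x \<in> L\<close>] j(3)[OF \<open>x \<in> L\<close>] yz by blast
  qed (rule S)
  have *: "derived I \<subseteq> I"
    unfolding derived_eq_act using i by (intro act_least) auto
  have IL: "(derived ^^ k) I \<subseteq> L" for k
  proof -
    have "(derived ^^ k) I \<subseteq> I"
      using * by (induction k) (auto dest: derived_mono)
    then show ?thesis using i(2) by blast
  qed
  have "(derived ^^ k) S \<subseteq> {x + y | x y. x \<in> (derived ^^ k) I \<and> y \<in> J}" for k
  proof (induction k)
    case 0
    show ?case unfolding S_def by simp
  next
    case (Suc k)
    let ?T = "\<lambda>k. {x + y | x y. x \<in> (derived ^^ k) I \<and> y \<in> J}"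
    have "derived (?T k) \<subseteq> ?T (Suc k)"
      unfolding derived_eq_act[of "?T k"]
    proof (rule act_least)
      show "subspace (?T (Suc k))"
        by (rule subspace_sums[OF subspace_derived_power[OF i(1)] j(1)])
      fix u v assume "u \<in> ?T k" "v \<in> ?T k"
      then obtain x y x' y' where u: "u = x + y" "x \<in> (derived ^^ k) I" "y \<in> J"
        and v: "v = x' + y'" "x' \<in> (derived ^^ k) I" "y' \<in> J" by blast
      have L: "x \<in> L" "x' \<in> L" "y \<in> L" "y' \<in> L"
        using u v IL j(2) by blast+
      have "br u v = br x x' + (br x y' + br y x' + br y y')"
        unfolding u v using L by (simp add: br_add_left br_add_right br_closed)
      moreover have "br x x' \<in> (derived ^^ Suc k) I"
        using act_mem[OF u(2) v(2)] by (simp add: derived_eq_act)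
      moreover have "br x y' + br y x' + br y y' \<in> J"
        using L u v j(3,4) by (intro subspace_add[OF j(1)]) auto
      ultimately show "br u v \<in> ?T (Suc k)" by blast
    qed
    then show ?case using derived_mono[OF Suc] by auto
  qed
  moreover obtain n where "(derived ^^ n) I = {0}" using I(2) unfolding solvable_def by blast
  ultimately have "(derived ^^ n) S \<subseteq> J" by force
  then show "solvable S" by (rule solvableI[OF S _ J(2)])
qed

text \<open>\<open>radical\<close> is a \<open>GREATEST\<close>, so a greatest solvable ideal has to
  be exhibited. A solvable ideal \<open>R\<close> of largest dimension is one: for another solvable
  ideal not inside \<open>R\<close>, the sum with \<open>R\<close> would contain a longer
  independent sequence.\<close>

lemma solvable_ideal_subset_radical:
  assumes I: "lie_ideal I" "solvable I"
  shows "I \<subseteq> radical"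
proof -
  define P where "P m \<longleftrightarrow> (\<exists>R b. lie_ideal R \<and> solvable R \<and>
    (\<forall>i<m. b i \<in> R \<and> b i \<notin> span (b ` {..<i})))" for m :: nat
  obtain N :: nat where N: "\<And>m (b :: nat \<Rightarrow> 'v).
      (\<And>i. i < m \<Longrightarrow> b i \<in> L \<and> b i \<notin> span (b ` {..<i})) \<Longrightarrow> m \<le> N"
    using independent_sequence_bound by blast
  have "\<forall>m. P m \<longrightarrow> m \<le> N"
    unfolding P_def using N lie_idealD(2) by (metis subsetD)
  moreover have "P 0" unfolding P_def using I by auto
  ultimately obtain d where d: "P d" "\<And>m. P m \<Longrightarrow> m \<le> d"
    using Greatest_le_nat[of P] GreatestI_nat[of P] by blast
  then obtain R b where R: "lie_ideal R" "solvable R"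
    and b: "\<And>i. i < d \<Longrightarrow> b i \<in> R \<and> b i \<notin> span (b ` {..<i})"
    unfolding P_def by blast
  have max: "J \<subseteq> R" if J: "lie_ideal J" "solvable J" for J
  proof
    fix x assume x: "x \<in> J"
    let ?S = "{x + y | x y. x \<in> J \<and> y \<in> R}"
    have "x \<in> span (b ` {..<d})"
    proof (rule ccontr)
      assume nx: "x \<notin> span (b ` {..<d})"
      define b' where "b' = b(d := x)"
      have b': "b' ` {..<i} = b ` {..<i}" if "i \<le> d" for i
        using that unfolding b'_def by auto
      have "x \<in> ?S" using x subspace_0[OF lie_idealD(1)[OF R(1)]] by force
      moreover have "R \<subseteq> ?S" using subspace_0[OF lie_idealD(1)[OF J(1)]] by force
      ultimately have "b' i \<in> ?S \<and> b' i \<notin> span (b' ` {..<i})" if "i < Suc d" for i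
        using that b[of i] b'[of i] nx by (cases "i = d") (auto simp: b'_def)
      then have "P (Suc d)"
        unfolding P_def using solvable_ideal_sum[OF J R] by blast
      then show False using d(2) by fastforce
    qed
    then show "x \<in> R"
      using span_minimal[OF _ lie_idealD(1)[OF R(1)], of "b ` {..<d}"] b by auto
  qed
  have "radical = R"
    unfolding radical_def using R max by (intro Greatest_equality) auto
  then show ?thesis using max[OF I] by simp
qed

text \<open>\<open>ad y\<close> preserves each term of the chain of the ideal and
  \<open>ad x\<close> descends one term. This makes the Killing form of such an ideal with all of
  \<open>L\<close> vanish.\<close>

lemma ideal_br_br_nilpotent:
  assumes I: "lie_ideal I" and p: "(act I ^^ p) L \<subseteq> {0}" and x: "x \<in> I" and y: "y \<in> L" and z: "z \<in> L"
  shows "((\<lambda>w. br x (br y w)) ^^ p) z = 0"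
proof -
  note i = lie_idealD[OF I]
  have "((\<lambda>w. br x (br y w)) ^^ k) z \<in> (act I ^^ k) L" for k
  proof (induction k)
    case 0
    then show ?case using z by simp
  next
    case (Suc k)
    then have "br y (((\<lambda>w. br x (br y w)) ^^ k) z) \<in> (act I ^^ k) L"
      using act_power_stable[OF i(2) y i(3)[OF y]] by blast
    then show ?case using act_mem[OF x] by simp
  qed
  then show ?thesis using p by blast
qed

end

section \<open>Unimodularity\<close>

lemma (in fin_dim_subspace) subspace_kernel:
  assumes "functional f" shows "subspace {x \<in> L. f x = 0}"
  using assms by (intro subspaceI) (auto simp: functional_0 functional_add functional_scale)

lemma (in fin_dim_subspace) functional_lincomb:
  assumes "functional f" "\<And>i. i \<in> I \<Longrightarrow> u i \<in> L"
  shows "f (\<Sum>i\<in>I. a i *s u i) = (\<Sum>i\<in>I. a i * f (u i))"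
  using assms by (subst functional_sum) (auto simp: functional_scale)

text \<open>A rank factorization of a possibly degenerate bilinear form: \<open>u\<close> and
  \<open>v\<close> are dual bases of complements of its left and right radicals. A longest
  biorthogonal system has this property, since a nonzero residue of the form would supply one more
  pair.\<close>

lemma (in fin_dim_subspace) dual_system:
  assumes B: "\<And>y. y \<in> L \<Longrightarrow> functional (\<lambda>x. B x y)" "\<And>x. x \<in> L \<Longrightarrow> functional (B x)"
  obtains m :: nat and u v where "\<And>i. i < m \<Longrightarrow> u i \<in> L \<and> v i \<in> L"
    "\<And>x y. x \<in> L \<Longrightarrow> y \<in> L \<Longrightarrow> B x y = (\<Sum>i<m. B x (v i) * B (u i) y)"
proof -
  define P where "P m \<longleftrightarrow> (\<exists>u v. (\<forall>i<m. u i \<in> L \<and> v i \<in> L) \<and>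
    (\<forall>i<m. \<forall>j<m. B (u i) (v j) = (if i = j then 1 else 0)))" for m :: nat
  obtain N :: nat where N: "\<And>m (b :: nat \<Rightarrow> 'v).
      (\<And>i. i < m \<Longrightarrow> b i \<in> L \<and> b i \<notin> span (b ` {..<i})) \<Longrightarrow> m \<le> N"
    using independent_sequence_bound by blast
  have "m \<le> N" if "P m" for m
  proof -
    from that obtain u v where uv: "\<forall>i<m. u i \<in> L \<and> v i \<in> L"
      "\<forall>i<m. \<forall>j<m. B (u i) (v j) = (if i = j then 1 else 0)"
      unfolding P_def by blast
    have "u i \<notin> span (u ` {..<i})" if i: "i < m" for i
    proof
      assume ui: "u i \<in> span (u ` {..<i})"
      have "u ` {..<i} \<subseteq> {x \<in> L. B x (v i) = 0}"
        using uv i by auto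
      from span_minimal[OF this subspace_kernel[OF B(1)]] have "B (u i) (v i) = 0"
        using ui uv(1) i by blast
      then show False using uv(2) i by simp
    qed
    then show ?thesis using N[of m u] uv(1) by blast
  qed
  moreover have "P 0" unfolding P_def by simp
  ultimately obtain m where m: "P m" "\<And>m'. P m' \<Longrightarrow> m' \<le> m"
    using Greatest_le_nat[of P _ N] GreatestI_nat[of P _ N] by blast
  then obtain u v where uv: "\<And>i. i < m \<Longrightarrow> u i \<in> L \<and> v i \<in> L"
    and \<delta>: "\<And>i j. i < m \<Longrightarrow> j < m \<Longrightarrow> B (u i) (v j) = (if i = j then 1 else 0)"
    unfolding P_def by blast
  have "B x y = (\<Sum>i<m. B x (v i) * B (u i) y)" if xy: "x \<in> L" "y \<in> L" for x y
  proof (rule ccontr)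
    assume ne: "B x y \<noteq> (\<Sum>i<m. B x (v i) * B (u i) y)"
    define r where "r = B x y - (\<Sum>i<m. B x (v i) * B (u i) y)"
    have r: "r \<noteq> 0" using ne unfolding r_def by simp
    define x' y' where "x' = x - (\<Sum>i<m. B x (v i) *s u i)" and "y' = y - (\<Sum>i<m. B (u i) y *s v i)"
    have sL: "(\<Sum>i<m. B x (v i) *s u i) \<in> L" "(\<Sum>i<m. B (u i) y *s v i) \<in> L"
      using uv by (auto intro!: L_sum)
    have L: "x' \<in> L" "y' \<in> L"
      unfolding x'_def y'_def using sL xy by auto
    have Bx: "B x' z = B x z - (\<Sum>i<m. B x (v i) * B (u i) z)" if "z \<in> L" for z
      unfolding x'_def using uv xy that sL functional_lincomb[OF B(1)[OF that], of "{..<m}" u]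
      by (simp add: functional_diff[OF B(1)])
    have By: "B z y' = B z y - (\<Sum>i<m. B (u i) y * B z (v i))" if "z \<in> L" for z
      unfolding y'_def using uv xy that sL functional_lincomb[OF B(2)[OF that], of "{..<m}" v]
      by (simp add: functional_diff[OF B(2)])
    have x'v: "B x' (v j) = 0" if "j < m" for j
    proof -
      have "(\<Sum>i<m. B x (v i) * B (u i) (v j)) = (\<Sum>i<m. if i = j then B x (v j) else 0)"
        using that by (intro sum.cong) (auto simp: \<delta>)
      then show ?thesis using Bx[of "v j"] uv[OF that] that by simp
    qed
    have uy': "B (u j) y' = 0" if "j < m" for j
    proof -
      have "(\<Sum>i<m. B (u i) y * B (u j) (v i)) = (\<Sum>i<m. if i = j then B (u j) y else 0)"
        using that by (intro sum.cong) (auto simp: \<delta>)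
      then show ?thesis using By[of "u j"] uv[OF that] that by simp
    qed
    have x'y': "B x' y' = r"
      using By[OF L(1)] Bx[OF xy(2)] x'v by (simp add: r_def)
    \<comment> \<open>\<open>x'\<close> and \<open>y'\<close> are orthogonal to the old system and
      pair to \<open>r\<close>; dividing by \<open>r\<close> normalizes the new pair.\<close>
    define u' v' where "u' = u(m := (1 / r) *s x')" and "v' = v(m := y')"
    have "P (Suc m)"
      unfolding P_def
    proof (rule exI[of _ u'], rule exI[of _ v'], intro conjI allI impI)
      fix i assume i: "i < Suc m"
      show "u' i \<in> L" "v' i \<in> L"
        using i uv L by (auto simp: u'_def v'_def less_Suc_eq)
      fix j assume j: "j < Suc m"
      show "B (u' i) (v' j) = (if i = j then 1 else 0)"
        using i j \<delta> x'v uy' x'y' r uv L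
        by (auto simp: u'_def v'_def less_Suc_eq functional_scale[OF B(1)])
    qed
    then show False using m(2) by fastforce
  qed
  with uv show thesis by (rule that)
qed

text \<open>The coordinate at \<open>a\<close> in a basis over the rationals that contains
  \<open>a\<close>. It transports eigenvalues into an ordered field, where a sum of squares vanishes
  only termwise.\<close>

lemma exists_rat_functional:
  fixes a :: "'k::field_char_0"
  assumes "a \<noteq> 0"
  obtains \<phi> :: "'k \<Rightarrow> rat" where "\<And>x y. \<phi> (x + y) = \<phi> x + \<phi> y"
    "\<And>q x. \<phi> (of_rat q * x) = q * \<phi> x" "\<phi> a \<noteq> 0"
proof -
  interpret Q: vector_space "\<lambda>(q :: rat) (x :: 'k). of_rat q * x"
    by unfold_locales (simp_all add: algebra_simps of_rat_add of_rat_mult)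
  have ind: "Q.independent {a}"
    using assms Q.dependent_single by simp
  define B where "B = Q.extend_basis {a}"
  have B: "Q.independent B" "Q.span B = UNIV" "a \<in> B"
    using Q.independent_extend_basis[OF ind] Q.span_extend_basis[OF ind]
      Q.extend_basis_superset[OF ind] unfolding B_def by auto
  show thesis
  proof (rule that[of "\<lambda>x. Q.representation B x a"])
    show "Q.representation B a a \<noteq> 0"
      using Q.representation_basis[OF B(1,3)] by simp
  qed (use B in \<open>simp_all add: Q.representation_add Q.representation_scale\<close>)
qed

context fin_dim_lie_algebra begin

text \<open>With remainders r i = [x, b i] - \<theta> i b i, the Leibniz rule gives (ad x - \<theta>
  i - \<theta> j) [b i, b j] = [r i, b j] + [b i, r j]. The remainders involve only earlier vectors
  of the same eigenvalues, so induction on \<open>i + j\<close> places the right-hand side in the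
  span, and \<open>triangular_eigenspace\<close> transfers this to the bracket.\<close>

lemma br_weight:
  assumes fr: "frame d b c" and x: "x \<in> L" and tri: "triangular (br x) d b \<theta>" and ij: "i < d" "j < d"
  shows "br (b i) (b j) \<in> span (b ` {k. k < d \<and> \<theta> k = \<theta> i + \<theta> j})"
  using ij
proof (induction "i + j" arbitrary: i j rule: less_induct)
  case less
  let ?U = "span (b ` {k. k < d \<and> \<theta> k = \<theta> i + \<theta> j})"
  let ?r = "\<lambda>i. br x (b i) - \<theta> i *s b i"
  have bL: "b k \<in> L" if "k < d" for k using frame_mem[OF fr that] .
  have rL: "?r k \<in> L" if "k < d" for k using bL[OF that] x br_closed by auto
  have "br (b k) (b j) \<in> ?U" if "k < i" "\<theta> k = \<theta> i" for k
    using less.hyps[of k j] less.prems that by simp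
  then have "b ` {k. k < i \<and> \<theta> k = \<theta> i} \<subseteq> {y \<in> L. br y (b j) \<in> ?U}"
    using less.prems bL by auto
  from span_minimal[OF this subspace_endo_vimage[OF endo_br_left subspace_span]]
  have 1: "br (?r i) (b j) \<in> ?U"
    using triangularD(3)[OF tri less.prems(1)] bL[OF less.prems(2)] by blast
  have "br (b i) (b k) \<in> ?U" if "k < j" "\<theta> k = \<theta> j" for k
    using less.hyps[of i k] less.prems that by simp
  then have "b ` {k. k < j \<and> \<theta> k = \<theta> j} \<subseteq> {y \<in> L. br (b i) y \<in> ?U}"
    using less.prems bL by auto
  from span_minimal[OF this subspace_endo_vimage[OF endo_br subspace_span]]
  have 2: "br (b i) (?r j) \<in> ?U"
    using triangularD(3)[OF tri less.prems(2)] bL[OF less.prems(1)] by blast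
  note L = bL[OF less.prems(1)] bL[OF less.prems(2)]
  have "br (?r i) (b j) = br (br x (b i)) (b j) - \<theta> i *s br (b i) (b j)"
    using L x by (simp add: br_closed br_diff_left br_scale_left)
  moreover have "br (b i) (?r j) = br (b i) (br x (b j)) - \<theta> j *s br (b i) (b j)"
    using L x by (simp add: br_closed br_diff_right br_scale_right)
  ultimately have "br x (br (b i) (b j)) - (\<theta> i + \<theta> j) *s br (b i) (b j) =
      br (?r i) (b j) + br (b i) (?r j)"
    unfolding br_derivation[OF x L] by (simp add: scale_left_distrib)
  also have "\<dots> \<in> ?U" using 1 2 by (rule span_add)
  finally show ?case
    by (rule triangular_eigenspace[OF fr tri endo_br[OF x] br_closed[OF L]])
qed

text \<open>\<open>D\<close> is a derivation because the generalized eigenspaces of \<open>ad x\<close> form a grading.\<close>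

lemma weight_derivation:
  assumes fr: "frame d b c" and x: "x \<in> L" and tri: "triangular (br x) d b \<theta>"
    and f: "\<And>s t. f (s + t) = f s + f t"
  obtains D where "endo D" "\<And>i. i < d \<Longrightarrow> D (b i) = f (\<theta> i) *s b i"
    "\<And>y z. y \<in> L \<Longrightarrow> z \<in> L \<Longrightarrow> D (br y z) = br (D y) z + br y (D z)"
proof -
  define D where "D y = (\<Sum>i<d. c i y *s (f (\<theta> i) *s b i))" for y
  have bL: "b k \<in> L" if "k < d" for k using frame_mem[OF fr that] .
  have D: "endo D"
    unfolding D_def using bL by (intro endo_of_values[OF fr]) auto
  have Db: "D (b i) = f (\<theta> i) *s b i" if "i < d" for i
  proof -
    have "D (b i) = (\<Sum>j<d. if j = i then f (\<theta> i) *s b i else 0)"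
      unfolding D_def using that by (intro sum.cong) (auto simp: frame_dual[OF fr])
    then show ?thesis using that by simp
  qed
  have DU: "D y = f \<mu> *s y" if "y \<in> span (b ` {k. k < d \<and> \<theta> k = \<mu>})" for y \<mu>
  proof -
    have "endo (\<lambda>y. D y - f \<mu> *s y)"
      using D by (intro endo_minus) (auto simp: endo_def scale_right_distrib mult.commute)
    moreover have "b ` {k. k < d \<and> \<theta> k = \<mu>} \<subseteq> {y \<in> L. D y - f \<mu> *s y \<in> {0}}"
      using bL Db by auto
    ultimately have "span (b ` {k. k < d \<and> \<theta> k = \<mu>}) \<subseteq> {y \<in> L. D y - f \<mu> *s y \<in> {0}}"
      by (intro span_minimal subspace_endo_vimage subspace_single_0)
    then show ?thesis using that by auto
  qed
  \<comment> \<open>The defect of the Leibniz rule. It is bilinear, so vanishing on the basis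
    suffices; there the weight of the bracket is \<open>\<theta> i + \<theta> j\<close> and
    additivity of \<open>f\<close> applies.\<close>
  define E where "E y z = D (br y z) - (br (D y) z + br y (D z))" for y z
  have E1: "endo (\<lambda>y. E y z)" if "z \<in> L" for z
    unfolding endo_def E_def using D that
    by (simp add: endo_closed[OF D] endo_add[OF D] endo_scale[OF D] br_closed br_add_left
        br_scale_left scale_right_distrib scale_right_diff_distrib)
  have E2: "endo (E y)" if "y \<in> L" for y
    unfolding endo_def E_def using D that
    by (simp add: endo_closed[OF D] endo_add[OF D] endo_scale[OF D] br_closed br_add_right
        br_scale_right scale_right_distrib scale_right_diff_distrib)
  have "E (b i) (b j) = 0" if ij: "i < d" "j < d" for i j
    using DU[OF br_weight[OF fr x tri ij]] ij bL
    by (simp add: E_def Db f br_scale_left br_scale_right scale_left_distrib)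
  then have "E y (b j) = 0" if "y \<in> L" "j < d" for y j
    using endo_expand[OF fr E1[OF bL[OF that(2)]] that(1)] that(2) by simp
  then have "E y z = 0" if "y \<in> L" "z \<in> L" for y z
    using endo_expand[OF fr E2[OF that(1)] that(2)] that(1) by simp
  then have "D (br y z) = br (D y) z + br y (D z)" if "y \<in> L" "z \<in> L" for y z
    using that unfolding E_def by simp
  with D Db show thesis by (rule that)
qed

section \<open>The Killing form and its invariance\<close>

definition killing :: "'v \<Rightarrow> 'v \<Rightarrow> 'k" where
  "killing x y = trace (\<lambda>z. br x (br y z))"

lemma endo_br_br: "x \<in> L \<Longrightarrow> y \<in> L \<Longrightarrow> endo (\<lambda>z. br x (br y z))"
  by (rule endo_compose[OF endo_br endo_br])

lemma endo_br_compose: "x \<in> L \<Longrightarrow> endo T \<Longrightarrow> endo (\<lambda>z. br x (T z))"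
  by (rule endo_compose[OF endo_br])

lemma killing_commute: "x \<in> L \<Longrightarrow> y \<in> L \<Longrightarrow> killing x y = killing y x"
  unfolding killing_def by (rule trace_commute) (simp_all add: endo_br)

text \<open>\<open>T\<close> is arbitrary because three cases occur: \<open>ad y\<close> for the
  Killing form, the identity for the trace character, and the weight derivation
  \<open>D\<close>.\<close>

lemma functional_trace_br:
  assumes T: "endo T" shows "functional (\<lambda>x. trace (\<lambda>z. br x (T z)))"
  unfolding functional_def
proof (intro conjI ballI allI)
  fix x y assume x: "x \<in> L" and y: "y \<in> L"
  note e = endo_compose[OF endo_br[OF x] T] endo_compose[OF endo_br[OF y] T]
  have "trace (\<lambda>z. br (x + y) (T z)) = trace (\<lambda>z. br x (T z) + br y (T z))"
    using x y endo_closed[OF T]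
    by (intro trace_cong[OF endo_br_compose[OF _ T]]) (auto simp: br_add_left)
  then show "trace (\<lambda>z. br (x + y) (T z)) = trace (\<lambda>z. br x (T z)) + trace (\<lambda>z. br y (T z))"
    using trace_add[OF e] by simp
next
  fix a x assume x: "x \<in> L"
  note e = endo_compose[OF endo_br[OF x] T]
  have "trace (\<lambda>z. br (a *s x) (T z)) = trace (\<lambda>z. a *s br x (T z))"
    using x endo_closed[OF T]
    by (intro trace_cong[OF endo_br_compose[OF _ T]]) (auto simp: br_scale_left)
  then show "trace (\<lambda>z. br (a *s x) (T z)) = a * trace (\<lambda>z. br x (T z))"
    using trace_scale[OF e] by simp
qed

lemma functional_killing_left: "y \<in> L \<Longrightarrow> functional (\<lambda>x. killing x y)"
  unfolding killing_def by (rule functional_trace_br) (rule endo_br)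

lemma functional_killing_right: "x \<in> L \<Longrightarrow> functional (killing x)"
  using functional_killing_left[of x] unfolding functional_def
  by (auto simp: killing_commute[of x])

lemma functional_trace_ad: "functional (\<lambda>x. trace (br x))"
  using functional_trace_br[of "\<lambda>z. z"] by (simp add: endo_def)

text \<open>Write \<open>ad [x, y]\<close> as a commutator and move \<open>ad y\<close> cyclically
  to the end. The identity as \<open>T\<close> shows that the trace character kills brackets,
  \<open>ad z\<close> gives invariance of the Killing form, and the weight derivation is used in the
  nilpotency argument.\<close>

lemma trace_br_br:
  assumes x: "x \<in> L" and y: "y \<in> L" and T: "endo T"
  shows "trace (\<lambda>z. br (br x y) (T z)) =
    trace (\<lambda>z. br x (br y (T z))) - trace (\<lambda>z. br x (T (br y z)))"
proof -
  have "trace (\<lambda>z. br (br x y) (T z)) = trace (\<lambda>z. br x (br y (T z)) - br y (br x (T z)))"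
    using x y endo_closed[OF T] br_derivation[OF x y]
    by (intro trace_cong[OF endo_br_compose[OF _ T]]) (auto simp: br_closed)
  also have "\<dots> = trace (\<lambda>z. br x (br y (T z))) - trace (\<lambda>z. br y (br x (T z)))"
    by (rule trace_diff[OF endo_br_compose[OF x endo_br_compose[OF y T]]
          endo_br_compose[OF y endo_br_compose[OF x T]]])
  also have "trace (\<lambda>z. br y (br x (T z))) = trace (\<lambda>z. br x (T (br y z)))"
    by (rule trace_commute[OF endo_br[OF y] endo_br_compose[OF x T]])
  finally show ?thesis .
qed

lemma trace_ad_br:
  assumes "x \<in> L" "y \<in> L" shows "trace (br (br x y)) = 0"
  using trace_br_br[OF assms, of "\<lambda>z. z"] by (simp add: endo_def)

lemma killing_invariant:
  assumes x: "x \<in> L" and y: "y \<in> L" and z: "z \<in> L"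
  shows "killing (br x y) z = killing x (br y z)"
proof -
  have "killing x (br y z) = trace (\<lambda>w. br x (br y (br z w)) - br x (br z (br y w)))"
    unfolding killing_def
    using x y z br_derivation[OF y z] br_add_right[OF x]
    by (intro trace_cong endo_br_br) (auto simp: br_closed)
  also have "\<dots> = killing (br x y) z"
    unfolding killing_def trace_br_br[OF x y endo_br[OF z]]
    by (rule trace_diff[OF endo_br_compose[OF x endo_br_br[OF y z]]
          endo_br_compose[OF x endo_br_br[OF z y]]])
  finally show ?thesis ..
qed

definition killing_radical :: "'v set" where
  "killing_radical = {x \<in> L. \<forall>y\<in>L. killing x y = 0}"

text \<open>The ideal called \<open>J\<close> in the overview.\<close>

definition derived_orthogonal :: "'v set" where
  "derived_orthogonal = {x \<in> L. \<forall>y\<in>L. \<forall>z\<in>L. killing x (br y z) = 0}"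

lemma lie_ideal_killing_radical: "lie_ideal killing_radical"
  unfolding lie_ideal_def
proof (intro conjI ballI)
  show "subspace killing_radical"
    unfolding killing_radical_def
    by (intro subspaceI) (auto simp: functional_0[OF functional_killing_left]
        functional_add[OF functional_killing_left] functional_scale[OF functional_killing_left])
  show "killing_radical \<subseteq> L" unfolding killing_radical_def by blast
  fix x y assume x: "x \<in> L" and y: "y \<in> killing_radical"
  have yL: "y \<in> L" using y unfolding killing_radical_def by blast
  have "killing (br x y) z = 0" if z: "z \<in> L" for z
  proof -
    have "killing (br x y) z = killing (br z x) y"
      using killing_commute[OF br_closed[OF x yL] z] killing_invariant[OF z x yL] by simp
    also have "\<dots> = killing y (br z x)"
      using x yL z by (intro killing_commute br_closed)
    finally show ?thesis using y x z br_closed unfolding killing_radical_def by simp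
  qed
  then show "br x y \<in> killing_radical"
    unfolding killing_radical_def using x yL br_closed by simp
qed

text \<open>By invariance, pairing \<open>[x, y]\<close> with \<open>z\<close> is pairing
  \<open>x\<close> with \<open>[y, z]\<close>.\<close>

lemma act_derived_orthogonal: "act derived_orthogonal L \<subseteq> killing_radical"
proof (rule act_least)
  show "subspace killing_radical" by (rule lie_idealD(1)[OF lie_ideal_killing_radical])
  show "br x y \<in> killing_radical" if "x \<in> derived_orthogonal" "y \<in> L" for x y
    using that unfolding derived_orthogonal_def killing_radical_def
    by (auto simp: br_closed killing_invariant)
qed

lemma killing_radical_subset: "killing_radical \<subseteq> derived_orthogonal"
  unfolding derived_orthogonal_def killing_radical_def using br_closed by auto

lemma lie_ideal_derived_orthogonal: "lie_ideal derived_orthogonal"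
  unfolding lie_ideal_def
proof (intro conjI ballI)
  show "subspace derived_orthogonal"
    unfolding derived_orthogonal_def
    by (intro subspaceI) (auto simp: functional_0[OF functional_killing_left] br_closed
        functional_add[OF functional_killing_left] functional_scale[OF functional_killing_left])
  show L: "derived_orthogonal \<subseteq> L" unfolding derived_orthogonal_def by blast
  fix x y assume x: "x \<in> L" and y: "y \<in> derived_orthogonal"
  have "br y x \<in> killing_radical"
    using act_derived_orthogonal act_mem[OF y x] by blast
  then have "- br y x \<in> killing_radical"
    by (rule subspace_neg[OF lie_idealD(1)[OF lie_ideal_killing_radical]])
  then show "br x y \<in> derived_orthogonal"
    using killing_radical_subset br_anticommute[OF subsetD[OF L y] x] by auto
qed

lemma lie_ideal_act:
  assumes I: "lie_ideal I" shows "lie_ideal (act I L)"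
  unfolding lie_ideal_def
proof (intro conjI ballI)
  note i = lie_idealD[OF I]
  show "subspace (act I L)" by (rule subspace_act)
  show AL: "act I L \<subseteq> L" using i br_closed by (intro act_least[OF subspace_L]) auto
  have "act I L \<subseteq> I" using i by (intro act_least) auto
  fix x y assume x: "x \<in> L" and y: "y \<in> act I L"
  have "br y x \<in> act I L"
    using act_mem[of y I x L] \<open>act I L \<subseteq> I\<close> x y by blast
  then have "- br y x \<in> act I L" by (rule subspace_neg[OF subspace_act])
  then show "br x y \<in> act I L"
    using br_anticommute[OF subsetD[OF AL y] x] by simp
qed

end

section \<open>A Cartan-type criterion and the trace character\<close>

locale split_lie_algebra = fin_dim_lie_algebra scale L br
  for scale :: "'k::field_char_0 \<Rightarrow> 'v::ab_group_add \<Rightarrow> 'v" (infixr "*s" 75) and L br +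
  assumes poly_root: "degree (p :: 'k poly) > 0 \<Longrightarrow> \<exists>x. poly p x = 0"

sublocale split_lie_algebra \<subseteq> split_fin_dim_subspace scale L
  by unfold_locales (rule poly_root)

context split_lie_algebra begin

text \<open>
  For a \<open>\<rat>\<close>-linear \<open>\<phi>\<close> from the field to \<open>\<rat>\<close>, let the derivation \<open>D\<close> act by \<open>\<phi> (\<theta> i)\<close> on the
  eigenvalue \<open>\<theta> i\<close> of \<open>ad x\<close>.  The trace of \<open>ad x \<circ> D\<close> is 0 as \<open>D\<close> is a derivation, and applying
  \<open>\<phi>\<close> to it gives the sum of the squares of the \<open>\<phi> (\<theta> i)\<close>.
\<close>

lemma ad_nilpotent_act_killing_radical:
  assumes x: "x \<in> act killing_radical L"
  shows "ad_nilpotent x"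
proof -
  note K = lie_ideal_killing_radical
  have xL: "x \<in> L" using lie_idealD(2)[OF lie_ideal_act[OF K]] x by blast
  obtain d b c \<theta> where fr: "frame d b c" and tri: "triangular (br x) d b \<theta>"
    using exists_triangular_frame[OF endo_br[OF xL]] by blast
  have "\<theta> i = 0" if i: "i < d" for i
  proof (rule ccontr)
    assume "\<theta> i \<noteq> 0"
    then obtain \<phi> :: "'k \<Rightarrow> rat" where \<phi>: "\<And>s t. \<phi> (s + t) = \<phi> s + \<phi> t"
      "\<And>q s. \<phi> (of_rat q * s) = q * \<phi> s" "\<phi> (\<theta> i) \<noteq> 0"
      using exists_rat_functional by blast
    obtain D where D: "endo D" and Db: "\<And>i. i < d \<Longrightarrow> D (b i) = of_rat (\<phi> (\<theta> i)) *s b i"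
      and der: "\<And>y z. y \<in> L \<Longrightarrow> z \<in> L \<Longrightarrow> D (br y z) = br (D y) z + br y (D z)"
      using weight_derivation[OF fr xL tri, of "\<lambda>s. of_rat (\<phi> s)"] \<phi>(1) by (metis of_rat_add)
    \<comment> \<open>The Leibniz rule, in the form
      \<open>D \<circ> ad v = ad (D v) + ad v \<circ> D\<close>, reduces this trace to
      \<open>- killing u (D v)\<close>, and \<open>u\<close> lies in the kernel of the Killing
      form.\<close>
    have "trace (\<lambda>z. br (br u v) (D z)) = 0" if u: "u \<in> killing_radical" and v: "v \<in> L" for u v
    proof -
      have uL: "u \<in> L" using u unfolding killing_radical_def by blast
      have "trace (\<lambda>z. br u (D (br v z))) = trace (\<lambda>z. br u (br (D v) z) + br u (br v (D z)))"
        using uL v endo_closed[OF D] der[OF v] br_add_right[OF uL]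
        by (intro trace_cong[OF endo_br_compose[OF uL endo_compose[OF D endo_br[OF v]]]])
            (auto simp: br_closed)
      also have "\<dots> = killing u (D v) + trace (\<lambda>z. br u (br v (D z)))"
        unfolding killing_def
        by (rule trace_add[OF endo_br_br[OF uL endo_closed[OF D v]]
              endo_br_compose[OF uL endo_br_compose[OF v D]]])
      also have "killing u (D v) = 0"
        using u endo_closed[OF D v] unfolding killing_radical_def by blast
      finally show ?thesis
        unfolding trace_br_br[OF uL v D] by simp
    qed
    then have "act killing_radical L \<subseteq> {y \<in> L. trace (\<lambda>z. br y (D z)) = 0}"
      using lie_idealD[OF K]
      by (intro act_least subspace_kernel functional_trace_br D) auto
    then have "trace (\<lambda>z. br x (D z)) = 0" using x by blast
    moreover have "trace (\<lambda>z. br x (D z)) = (\<Sum>i<d. of_rat (\<phi> (\<theta> i)) * \<theta> i)"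
      unfolding trace_eq[OF fr endo_compose[OF endo_br[OF xL] D]]
    proof (intro sum.cong refl)
      fix i assume "i \<in> {..<d}"
      then have i: "i < d" by simp
      have "c i (br x (D (b i))) = of_rat (\<phi> (\<theta> i)) * c i (br x (b i))"
        using frame_mem[OF fr i] xL
        by (simp add: Db[OF i] br_scale_right functional_scale[OF frame_functional[OF fr i]] br_closed)
      then show "c i (br x (D (b i))) = of_rat (\<phi> (\<theta> i)) * \<theta> i"
        using triangular_coordinate(1)[OF fr tri i i] by simp
    qed
    \<comment> \<open>Zero is written as \<open>of_rat 0 * 0\<close> so that homogeneity of
      \<open>\<phi>\<close> evaluates it to 0.\<close>
    ultimately have "\<phi> (\<Sum>i<d. of_rat (\<phi> (\<theta> i)) * \<theta> i) = \<phi> (of_rat 0 * 0)" by simp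
    moreover have "\<phi> (\<Sum>i<m. of_rat (\<phi> (\<theta> i)) * \<theta> i) = (\<Sum>i<m. \<phi> (\<theta> i) * \<phi> (\<theta> i))" for m :: nat
      using \<phi>(2)[of 0 0] by (induction m) (simp_all add: \<phi>(1,2))
    ultimately have "(\<Sum>i<d. \<phi> (\<theta> i) * \<phi> (\<theta> i)) = 0"
      unfolding \<phi>(2) by simp
    then have "\<phi> (\<theta> i) * \<phi> (\<theta> i) = 0"
      using i by (subst (asm) sum_nonneg_eq_0_iff) auto
    then show False using \<phi>(3) by simp
  qed
  then show ?thesis
    unfolding ad_nilpotent_def using triangular_nilpotent_iff[OF fr tri endo_br[OF xL]] by blast
qed

text \<open>One derivation step leads from \<open>derived_orthogonal\<close> into
  \<open>killing_radical\<close>, a second one into the ideal \<open>act killing_radical L\<close>,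
  which consists of ad-nilpotent elements and is solvable by Engel's theorem.\<close>

lemma solvable_derived_orthogonal: "solvable derived_orthogonal"
proof (rule solvableI)
  let ?I = "act killing_radical L"
  have I: "lie_ideal ?I" by (rule lie_ideal_act[OF lie_ideal_killing_radical])
  obtain p where "(act ?I ^^ p) L \<subseteq> {0}"
    using ideal_acts_nilpotently[OF I] ad_nilpotent_act_killing_radical by blast
  then show "solvable ?I" by (rule ideal_acts_nilpotently_solvable[OF I])
  have "derived derived_orthogonal \<subseteq> act derived_orthogonal L"
    unfolding derived_eq_act using lie_idealD(2)[OF lie_ideal_derived_orthogonal]
    by (intro act_mono) auto
  then have "derived derived_orthogonal \<subseteq> killing_radical"
    using act_derived_orthogonal by blast
  then have "derived (derived derived_orthogonal) \<subseteq> ?I"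
    unfolding derived_eq_act[of "derived derived_orthogonal"]
    using lie_idealD(2)[OF lie_ideal_killing_radical] by (intro act_mono) auto
  then show "(derived ^^ 2) derived_orthogonal \<subseteq> ?I" by (simp add: numeral_2_eq_2)
  show "subspace derived_orthogonal" by (rule lie_idealD(1)[OF lie_ideal_derived_orthogonal])
qed

theorem unimodular:
  assumes nil: "\<And>x. x \<in> radical \<Longrightarrow> ad_nilpotent x" and y: "y \<in> L"
  shows "trace (br y) = 0"
proof -
  note J = lie_ideal_derived_orthogonal
  have "derived_orthogonal \<subseteq> radical"
    using solvable_ideal_subset_radical[OF J solvable_derived_orthogonal] .
  then have Jnil: "ad_nilpotent x" if "x \<in> derived_orthogonal" for x
    using nil that by blast
  obtain p where p: "(act derived_orthogonal ^^ p) L \<subseteq> {0}"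
    using ideal_acts_nilpotently[OF J Jnil] by blast
  have J0: "killing x y = 0" if x: "x \<in> derived_orthogonal" and y: "y \<in> L" for x y
    unfolding killing_def
    using x y lie_idealD(2)[OF J] ideal_br_br_nilpotent[OF J p x y]
    by (intro trace_nilpotent endo_br_br ballI) auto
  have K0: "trace (br x) = 0" if x: "x \<in> killing_radical" for x
  proof -
    have "ad_nilpotent x" "x \<in> L"
      using x Jnil killing_radical_subset lie_idealD(2)[OF J] by blast+
    then show ?thesis
      unfolding ad_nilpotent_def using trace_nilpotent[OF endo_br] by blast
  qed
  obtain m :: nat and u v where uv: "\<And>i. i < m \<Longrightarrow> u i \<in> L \<and> v i \<in> L"
    and dual: "\<And>x y. x \<in> L \<Longrightarrow> y \<in> L \<Longrightarrow> killing x y = (\<Sum>i<m. killing x (v i) * killing (u i) y)"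
    by (rule dual_system[of killing],
        erule functional_killing_left, erule functional_killing_right, rule that, assumption)
  \<comment> \<open>The dual system turns the trace character, which vanishes on the kernel of the
    Killing form, into pairing with this vector.\<close>
  define w where "w = (\<Sum>i<m. trace (br (v i)) *s u i)"
  have wL: "w \<in> L" unfolding w_def using uv by (intro L_sum) simp
  have w: "trace (br y) = killing w y" if y: "y \<in> L" for y
  proof -
    \<comment> \<open>The component of \<open>y\<close> in the span of the \<open>v i\<close>; the
      difference \<open>y - s\<close> is orthogonal to everything, so its trace is 0.\<close>
    define s where "s = (\<Sum>i<m. killing (u i) y *s v i)"
    have sL: "s \<in> L" unfolding s_def using uv by (intro L_sum) simp
    have "killing (y - s) x = 0" if x: "x \<in> L" for x
    proof -
      have "killing x (y - s) = killing x y - (\<Sum>i<m. killing (u i) y * killing x (v i))"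
        unfolding functional_diff[OF functional_killing_right[OF x] y sL] unfolding s_def
        using uv by (subst functional_lincomb[OF functional_killing_right[OF x]]) auto
      also have "\<dots> = 0"
        using dual[OF x y] by (simp add: mult.commute)
      finally show ?thesis using killing_commute[of x "y - s"] x y sL by simp
    qed
    then have "trace (br (y - s)) = 0"
      using y sL by (intro K0) (simp add: killing_radical_def)
    then have "trace (br y) = trace (br s)"
      using functional_diff[OF functional_trace_ad y sL] by simp
    also have "\<dots> = (\<Sum>i<m. killing (u i) y * trace (br (v i)))"
      unfolding s_def using uv by (intro functional_lincomb[OF functional_trace_ad]) auto
    also have "\<dots> = killing w y"
      unfolding w_def using uv functional_lincomb[OF functional_killing_left[OF y], of "{..<m}" u]
      by (simp add: mult.commute)
    finally show ?thesis .
  qed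
  have "killing w (br a z) = 0" if "a \<in> L" "z \<in> L" for a z
    using w[of "br a z"] trace_ad_br[OF that] br_closed[OF that] by simp
  then have "w \<in> derived_orthogonal"
    unfolding derived_orthogonal_def using wL by blast
  then show ?thesis using w[OF y] J0[OF _ y] by simp
qed

end

section \<open>Symplectic bases\<close>

lemma sum_lessThan_double:
  "(\<Sum>a<2 * n. g a) = (\<Sum>i<n. g (2 * i) + g (2 * i + 1))" for g :: "nat \<Rightarrow> 'a::comm_monoid_add"
  by (induction n) (simp_all add: add.assoc)

context fin_dim_subspace begin

definition symplectic :: "('v \<Rightarrow> 'v \<Rightarrow> 'k) \<Rightarrow> nat \<Rightarrow> (nat \<Rightarrow> 'v) \<Rightarrow> (nat \<Rightarrow> 'v) \<Rightarrow> bool" where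
  "symplectic \<omega> n e f \<longleftrightarrow> (\<forall>i<n. e i \<in> L \<and> f i \<in> L) \<and>
     (\<forall>i<n. \<forall>j<n. \<omega> (e i) (f j) = (if i = j then 1 else 0) \<and>
       \<omega> (f j) (e i) = (if i = j then -1 else 0) \<and> \<omega> (e i) (e j) = 0 \<and> \<omega> (f i) (f j) = 0)"

text \<open>The projection onto the span of the \<open>e i\<close> and \<open>f i\<close> along its
  orthogonal. The minus sign comes from \<open>\<omega> (f i) (e i) = -1\<close>.\<close>

definition symplectic_proj ::
  "('v \<Rightarrow> 'v \<Rightarrow> 'k) \<Rightarrow> nat \<Rightarrow> (nat \<Rightarrow> 'v) \<Rightarrow> (nat \<Rightarrow> 'v) \<Rightarrow> 'v \<Rightarrow> 'v" where
  "symplectic_proj \<omega> n e f x = (\<Sum>i<n. \<omega> x (f i) *s e i) - (\<Sum>i<n. \<omega> x (e i) *s f i)"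

lemma symplecticD:
  assumes "symplectic \<omega> n e f"
  shows "i < n \<Longrightarrow> e i \<in> L" "i < n \<Longrightarrow> f i \<in> L"
    "i < n \<Longrightarrow> j < n \<Longrightarrow> \<omega> (e i) (f j) = (if i = j then 1 else 0)"
    "i < n \<Longrightarrow> j < n \<Longrightarrow> \<omega> (f j) (e i) = (if i = j then -1 else 0)"
    "i < n \<Longrightarrow> j < n \<Longrightarrow> \<omega> (e i) (e j) = 0"
    "i < n \<Longrightarrow> j < n \<Longrightarrow> \<omega> (f i) (f j) = 0"
  using assms unfolding symplectic_def by blast+

lemma symplectic_combination:
  assumes "symplectic \<omega> n e f"
  shows "(\<Sum>i<n. p i *s e i) - (\<Sum>i<n. q i *s f i) \<in> L"
    and "functional g \<Longrightarrow> g ((\<Sum>i<n. p i *s e i) - (\<Sum>i<n. q i *s f i)) =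
      (\<Sum>i<n. p i * g (e i)) - (\<Sum>i<n. q i * g (f i))"
proof -
  have L: "(\<Sum>i<n. p i *s e i) \<in> L" "(\<Sum>i<n. q i *s f i) \<in> L"
    using symplecticD(1,2)[OF assms] by (auto intro!: L_sum)
  then show "(\<Sum>i<n. p i *s e i) - (\<Sum>i<n. q i *s f i) \<in> L" by simp
  assume g: "functional g"
  show "g ((\<Sum>i<n. p i *s e i) - (\<Sum>i<n. q i *s f i)) =
      (\<Sum>i<n. p i * g (e i)) - (\<Sum>i<n. q i * g (f i))"
    unfolding functional_diff[OF g L] using symplecticD(1,2)[OF assms]
      functional_lincomb[OF g, of "{..<n}" e p] functional_lincomb[OF g, of "{..<n}" f q]
    by simp
qed

lemma symplectic_proj_basis:
  assumes "symplectic \<omega> n e f" "j < n"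
  shows "symplectic_proj \<omega> n e f (e j) = e j" "symplectic_proj \<omega> n e f (f j) = f j"
proof -
  have "(\<Sum>i<n. \<omega> (e j) (f i) *s e i) = (\<Sum>i<n. if i = j then e j else 0)"
    using assms(2) by (intro sum.cong) (auto simp: symplecticD[OF assms(1)])
  moreover have "(\<Sum>i<n. \<omega> (e j) (e i) *s f i) = 0"
    using assms(2) by (intro sum.neutral) (auto simp: symplecticD[OF assms(1)])
  ultimately show "symplectic_proj \<omega> n e f (e j) = e j"
    unfolding symplectic_proj_def using assms(2) by simp
  have "(\<Sum>i<n. \<omega> (f j) (e i) *s f i) = (\<Sum>i<n. if i = j then - f j else 0)"
    using assms(2) by (intro sum.cong) (auto simp: symplecticD[OF assms(1)])
  moreover have "(\<Sum>i<n. \<omega> (f j) (f i) *s e i) = 0"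
    using assms(2) by (intro sum.neutral) (auto simp: symplecticD[OF assms(1)])
  ultimately show "symplectic_proj \<omega> n e f (f j) = f j"
    unfolding symplectic_proj_def using assms(2) by simp
qed

text \<open>A longest symplectic system exhausts the form: the residues that the projection leaves
  lie in the radical of \<open>\<omega>\<close> on \<open>H\<close>. It is applied to the kernel of
  a contact form and to the whole of \<open>L\<close>.\<close>

lemma exists_symplectic:
  assumes \<omega>: "\<And>y. y \<in> L \<Longrightarrow> functional (\<lambda>x. \<omega> x y)" "\<And>x. x \<in> L \<Longrightarrow> functional (\<omega> x)"
    and alt: "\<And>x. x \<in> L \<Longrightarrow> \<omega> x x = 0" and H: "subspace H" "H \<subseteq> L"
  obtains n e f where "symplectic \<omega> n e f" "\<And>i. i < n \<Longrightarrow> e i \<in> H \<and> f i \<in> H"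
    "\<And>x y. x \<in> H \<Longrightarrow> y \<in> H \<Longrightarrow> \<omega> (x - symplectic_proj \<omega> n e f x) y = 0"
proof -
  have skew: "\<omega> y x = - \<omega> x y" if "x \<in> L" "y \<in> L" for x y
  proof -
    have "\<omega> (x + y) (x + y) = \<omega> x x + \<omega> y x + (\<omega> x y + \<omega> y y)"
      using that by (simp add: functional_add[OF \<omega>(1)] functional_add[OF \<omega>(2)])
    then have "\<omega> y x + \<omega> x y = 0" using that alt by simp
    then show ?thesis by (simp add: eq_neg_iff_add_eq_0)
  qed
  define P where "P m \<longleftrightarrow> (\<exists>e f. symplectic \<omega> m e f \<and> (\<forall>i<m. e i \<in> H \<and> f i \<in> H))" for m
  obtain N :: nat where N: "\<And>m (b :: nat \<Rightarrow> 'v).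
      (\<And>i. i < m \<Longrightarrow> b i \<in> L \<and> b i \<notin> span (b ` {..<i})) \<Longrightarrow> m \<le> N"
    using independent_sequence_bound by blast
  have "m \<le> N" if "P m" for m
  proof -
    from that obtain e f where s: "symplectic \<omega> m e f" unfolding P_def by blast
    have "e i \<notin> span (e ` {..<i})" if i: "i < m" for i
    proof
      assume ei: "e i \<in> span (e ` {..<i})"
      have "e ` {..<i} \<subseteq> {x \<in> L. \<omega> x (f i) = 0}"
        using symplecticD[OF s] i by auto
      from span_minimal[OF this subspace_kernel[OF \<omega>(1)]] have "\<omega> (e i) (f i) = 0"
        using ei symplecticD(2)[OF s i] by blast
      then show False using symplecticD(3)[OF s i i] by simp
    qed
    then show ?thesis using N[of m e] symplecticD(1)[OF s] by blast
  qed
  moreover have "P 0" unfolding P_def symplectic_def by simp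
  ultimately obtain n where n: "P n" "\<And>m. P m \<Longrightarrow> m \<le> n"
    using Greatest_le_nat[of P _ N] GreatestI_nat[of P _ N] by blast
  then obtain e f where s: "symplectic \<omega> n e f" and ef: "\<And>i. i < n \<Longrightarrow> e i \<in> H \<and> f i \<in> H"
    unfolding P_def by blast
  let ?r = "\<lambda>x. x - symplectic_proj \<omega> n e f x"
  have rH: "?r x \<in> H" if "x \<in> H" for x
    unfolding symplectic_proj_def using that ef
    by (intro subspace_diff[OF H(1)] subspace_sum[OF H(1)] subspace_scale[OF H(1)]) auto
  have re: "\<omega> (?r x) (e j) = 0" "\<omega> (?r x) (f j) = 0" if x: "x \<in> L" and j: "j < n" for x j
  proof -
    note eL = symplecticD(1)[OF s j] and fL = symplecticD(2)[OF s j]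
    have pL: "symplectic_proj \<omega> n e f x \<in> L"
      unfolding symplectic_proj_def by (rule symplectic_combination(1)[OF s])
    have "\<omega> (symplectic_proj \<omega> n e f x) (e j) = (\<Sum>i<n. if i = j then \<omega> x (e j) else 0)"
      unfolding symplectic_proj_def
      unfolding symplectic_combination(2)[OF s \<omega>(1)[OF eL]]
      unfolding sum_subtractf[symmetric]
      using j by (intro sum.cong) (auto simp: symplecticD[OF s])
    then show "\<omega> (?r x) (e j) = 0"
      using j by (simp add: functional_diff[OF \<omega>(1)[OF eL] x pL])
    have "\<omega> (symplectic_proj \<omega> n e f x) (f j) = (\<Sum>i<n. if i = j then \<omega> x (f j) else 0)"
      unfolding symplectic_proj_def
      unfolding symplectic_combination(2)[OF s \<omega>(1)[OF fL]]
      unfolding sum_subtractf[symmetric]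
      using j by (intro sum.cong) (auto simp: symplecticD[OF s])
    then show "\<omega> (?r x) (f j) = 0"
      using j by (simp add: functional_diff[OF \<omega>(1)[OF fL] x pL])
  qed
  have "\<omega> (?r x) y = 0" if x: "x \<in> H" and y: "y \<in> H" for x y
  proof (rule ccontr)
    assume "\<omega> (?r x) y \<noteq> 0"
    \<comment> \<open>Replacing both vectors by their residues makes them orthogonal to the old
      system without changing the value of the form, so they can be adjoined after scaling
      \<open>w\<close>.\<close>
    define z w where "z = ?r x" and "w = ?r y"
    have zw: "z \<in> H" "w \<in> H" "z \<in> L" "w \<in> L" "x \<in> L" "y \<in> L"
      unfolding z_def w_def using x y rH H(2) by blast+
    have z0: "\<omega> z (e j) = 0" "\<omega> z (f j) = 0" "\<omega> w (e j) = 0" "\<omega> w (f j) = 0" if "j < n" for j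
      unfolding z_def w_def using re zw that by simp_all
    have z1: "\<omega> (e j) z = 0" "\<omega> (f j) z = 0" "\<omega> (e j) w = 0" "\<omega> (f j) w = 0" if "j < n" for j
      using z0[OF that] skew[OF _ symplecticD(1)[OF s that]] skew[OF _ symplecticD(2)[OF s that]] zw
      by simp_all
    have "\<omega> z (symplectic_proj \<omega> n e f y) = 0"
      unfolding symplectic_proj_def symplectic_combination(2)[OF s \<omega>(2)[OF zw(3)]]
      by (simp add: z0)
    moreover have "symplectic_proj \<omega> n e f y \<in> L"
      unfolding symplectic_proj_def by (rule symplectic_combination(1)[OF s])
    ultimately have "\<omega> z w = \<omega> z y"
      unfolding w_def using functional_diff[OF \<omega>(2)[OF zw(3)] zw(6)] by simp
    then have ne: "\<omega> z w \<noteq> 0" using \<open>\<omega> (?r x) y \<noteq> 0\<close> unfolding z_def by simp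
    define e' f' where "e' = e(n := z)" and "f' = f(n := (1 / \<omega> z w) *s w)"
    have scale: "\<omega> a (t *s w) = t * \<omega> a w" "\<omega> (t *s w) a = t * \<omega> w a" if "a \<in> L" for a t
      using functional_scale[OF \<omega>(2)[OF that] zw(4)] functional_scale[OF \<omega>(1)[OF that] zw(4)] by auto
    have ww: "\<omega> w w = 0" using alt zw by simp
    have "symplectic \<omega> (Suc n) e' f'"
      unfolding symplectic_def
    proof (intro conjI allI impI)
      fix i assume i: "i < Suc n"
      show "e' i \<in> L" "f' i \<in> L"
        using i zw symplecticD(1,2)[OF s] by (auto simp: e'_def f'_def less_Suc_eq)
      fix j assume j: "j < Suc n"
      show "\<omega> (e' i) (f' j) = (if i = j then 1 else 0)"
        using i j ne zw symplecticD[OF s] by (auto simp: e'_def f'_def less_Suc_eq z0 z1 scale)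
      show "\<omega> (f' j) (e' i) = (if i = j then -1 else 0)"
        using i j ne zw symplecticD[OF s] skew[OF zw(3,4)]
        by (auto simp: e'_def f'_def less_Suc_eq z0 z1 scale)
      show "\<omega> (e' i) (e' j) = 0"
        using i j zw symplecticD[OF s] alt by (auto simp: e'_def less_Suc_eq z0 z1)
      show "\<omega> (f' i) (f' j) = 0"
        using i j zw symplecticD[OF s] ww by (auto simp: f'_def less_Suc_eq z0 z1 scale)
    qed
    moreover have "e' i \<in> H \<and> f' i \<in> H" if "i < Suc n" for i
      using that ef zw subspace_scale[OF H(1)] by (auto simp: e'_def f'_def less_Suc_eq)
    ultimately have "P (Suc n)" unfolding P_def by blast
    then show False using n(2) by fastforce
  qed
  with s ef show thesis by (rule that)
qed

text \<open>The order e0, f0, e1, f1, ..., r is the one expected by \<open>hyperbolic\<close>. It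
  serves both for \<open>r\<close> with \<open>\<gamma> r = 1\<close>, to evaluate the top form, and
  for \<open>r\<close> a generator of the stabilizer, to compute a trace.\<close>

lemma symplectic_frame:
  assumes \<omega>: "\<And>y. y \<in> L \<Longrightarrow> functional (\<lambda>x. \<omega> x y)"
    and s: "symplectic \<omega> n e f" and r: "r \<in> L" and \<rho>: "functional \<rho>" "\<rho> r = 1"
    and \<rho>0: "\<And>i. i < n \<Longrightarrow> \<rho> (e i) = 0 \<and> \<rho> (f i) = 0"
    and expand: "\<And>x. x \<in> L \<Longrightarrow>
      x = symplectic_proj \<omega> n e f (x - \<rho> x *s r) + \<rho> x *s r"
  shows "frame (2 * n + 1)
    (\<lambda>a. if a = 2 * n then r else if even a then e (a div 2) else f (a div 2))
    (\<lambda>a x. if a = 2 * n then \<rho> x else if even a then \<omega> (x - \<rho> x *s r) (f (a div 2))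
      else - \<omega> (x - \<rho> x *s r) (e (a div 2)))" (is "frame _ ?b ?c")
  unfolding frame_def
proof (intro conjI allI impI ballI)
  have h: "endo (\<lambda>x. x - \<rho> x *s r)"
    using r unfolding endo_def
    by (simp add: functional_add[OF \<rho>(1)] functional_scale[OF \<rho>(1)] scale_left_distrib
        scale_right_diff_distrib)
  have half: "a div 2 < n" if "a < 2 * n + 1" "a \<noteq> 2 * n" for a
    using that by linarith
  show "?b a \<in> L" if "a < 2 * n + 1" for a
    using r symplecticD(1,2)[OF s] half[OF that] by auto
  show "functional (?c a)" if a: "a < 2 * n + 1" for a
  proof -
    have 1: "functional (\<lambda>x. \<omega> (x - \<rho> x *s r) y)" if "y \<in> L" for y
      by (rule functional_endo[OF \<omega>[OF that] h])
    then have "functional (\<lambda>x. - \<omega> (x - \<rho> x *s r) y)" if "y \<in> L" for y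
      using that unfolding functional_def by simp
    with 1 have "functional (\<lambda>x. \<omega> (x - \<rho> x *s r) (f (a div 2)))"
      "functional (\<lambda>x. - \<omega> (x - \<rho> x *s r) (e (a div 2)))" if "a \<noteq> 2 * n"
      using symplecticD(1,2)[OF s half[OF a that]] by blast+
    then show ?thesis using \<rho>(1) by (cases "a = 2 * n"; cases "even a"; simp)
  qed
  show "?c a (?b a') = (if a = a' then 1 else 0)" if a: "a < 2 * n + 1" "a' < 2 * n + 1" for a a'
  proof (cases "a' = 2 * n")
    case True
    have "\<omega> (r - \<rho> r *s r) y = 0" if "y \<in> L" for y
      using functional_0[OF \<omega>[OF that]] \<rho>(2) by simp
    then show ?thesis using True a \<rho>(2) half[OF a(1)] symplecticD(1,2)[OF s] by auto
  next
    case False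
    have "a = a' \<longleftrightarrow> a div 2 = a' div 2 \<and> (even a \<longleftrightarrow> even a')"
      by (metis dvd_mult_div_cancel odd_two_times_div_two_succ)
    then show ?thesis
      using False a half[OF a(1)] half[OF a(2) False] \<rho>0 symplecticD[OF s] by auto
  qed
  fix x assume x: "x \<in> L"
  let ?h = "x - \<rho> x *s r"
  have "(\<Sum>a<2 * n. ?c a x *s ?b a) = (\<Sum>i<n. \<omega> ?h (f i) *s e i + (- \<omega> ?h (e i)) *s f i)"
    unfolding sum_lessThan_double by (intro sum.cong) auto
  also have "\<dots> = symplectic_proj \<omega> n e f ?h"
    unfolding symplectic_proj_def sum_subtractf[symmetric] by simp
  finally show "x = (\<Sum>a<2 * n + 1. ?c a x *s ?b a)"
    using expand[OF x] by simp
qed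

end

section \<open>Contact forms\<close>

context fin_dim_lie_algebra begin

lemma functional_form:
  assumes "functional \<gamma>"
  shows "y \<in> L \<Longrightarrow> functional (\<lambda>x. \<gamma> (br x y))" "x \<in> L \<Longrightarrow> functional (\<lambda>y. \<gamma> (br x y))"
  by (rule functional_endo[OF assms endo_br_left] functional_endo[OF assms endo_br]; assumption)+

lemma form_skew: "functional \<gamma> \<Longrightarrow> x \<in> L \<Longrightarrow> y \<in> L \<Longrightarrow> \<gamma> (br y x) = - \<gamma> (br x y)"
  using functional_scale[of \<gamma> "br x y" "-1"] br_anticommute[of x y] br_closed by simp

text \<open>
  The alternating form \<open>((w, a), (y, b)) \<mapsto> \<gamma> [w, y] - a * \<gamma> y + b * \<gamma> w\<close> on \<open>L \<times> K\<close> is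
  nondegenerate.
\<close>

definition contact_form :: "('v \<Rightarrow> 'k) \<Rightarrow> bool" where
  "contact_form \<gamma> \<longleftrightarrow> functional \<gamma> \<and>
     (\<forall>w\<in>L. \<forall>a. \<gamma> w = 0 \<and> (\<forall>y\<in>L. \<gamma> (br w y) = a * \<gamma> y) \<longrightarrow> w = 0 \<and> a = 0)"

text \<open>Nondegeneracy makes \<open>\<omega>\<close> symplectic on the kernel of
  \<open>\<gamma>\<close>. A symplectic basis of this kernel and a vector with
  \<open>\<gamma> r = 1\<close> form a basis of odd length on which the top form can be
  evaluated.\<close>

lemma contact_form_imp_contact:
  assumes "contact_form \<gamma>" shows contact
proof -
  have \<gamma>: "functional \<gamma>" and nd: "\<And>w a. w \<in> L \<Longrightarrow> \<gamma> w = 0 \<Longrightarrow>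
      (\<And>y. y \<in> L \<Longrightarrow> \<gamma> (br w y) = a * \<gamma> y) \<Longrightarrow> w = 0 \<and> a = 0"
    using assms unfolding contact_form_def by blast+
  define H where "H = {x \<in> L. \<gamma> x = 0}"
  have H: "subspace H" "H \<subseteq> L"
    unfolding H_def using subspace_kernel[OF \<gamma>] by auto
  have "\<exists>x\<in>L. \<gamma> x \<noteq> 0"
  proof (rule ccontr)
    assume "\<not> ?thesis"
    \<comment> \<open>If \<open>\<gamma>\<close> vanished on \<open>L\<close>, the pair (0, 1) would
      be a kernel vector; this covers \<open>L = {0}\<close> as well.\<close>
    then show False
      using nd[of 0 1] functional_0[OF \<gamma>] by (simp add: br_0_left)
  qed
  then obtain x where x: "x \<in> L" "\<gamma> x \<noteq> 0" by blast
  define r where "r = (1 / \<gamma> x) *s x"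
  have r: "r \<in> L" "\<gamma> r = 1"
    unfolding r_def using x by (simp_all add: functional_scale[OF \<gamma>])
  define \<omega> where "\<omega> x y = - \<gamma> (br x y)" for x y
  have \<omega>: "functional (\<lambda>x. \<omega> x y)" "functional (\<omega> y)" if "y \<in> L" for y
    using functional_form[OF \<gamma>] that unfolding functional_def \<omega>_def by simp_all
  have alt: "\<omega> x x = 0" if "x \<in> L" for x
    unfolding \<omega>_def using that by (simp add: br_self functional_0[OF \<gamma>])
  obtain n e f where s: "symplectic \<omega> n e f" and ef: "\<And>i. i < n \<Longrightarrow> e i \<in> H \<and> f i \<in> H"
    and rad: "\<And>x y. x \<in> H \<Longrightarrow> y \<in> H \<Longrightarrow> \<omega> (x - symplectic_proj \<omega> n e f x) y = 0"
    using exists_symplectic[OF \<omega> alt H] by blast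
  have proj: "symplectic_proj \<omega> n e f x = x" if x: "x \<in> H" for x
  proof -
    define h where "h = x - symplectic_proj \<omega> n e f x"
    have h: "h \<in> H" "h \<in> L"
      unfolding h_def symplectic_proj_def using that ef H
      by (auto intro!: subspace_diff[OF H(1)] subspace_sum[OF H(1)] subspace_scale[OF H(1)])
    \<comment> \<open>A vector \<open>h\<close> orthogonal to the kernel of \<open>\<gamma>\<close>
      makes \<open>y \<mapsto> \<gamma> [h, y]\<close> a multiple of \<open>\<gamma>\<close>;
      evaluation at \<open>r\<close> gives the factor, which serves as the scalar \<open>a\<close>
      of a kernel vector.\<close>
    have "\<gamma> (br h y) = \<gamma> (br h r) * \<gamma> y" if y: "y \<in> L" for y
    proof -
      have "y - \<gamma> y *s r \<in> H"
        unfolding H_def using r y by (simp add: functional_diff[OF \<gamma>] functional_scale[OF \<gamma>])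
      then have "\<omega> h (y - \<gamma> y *s r) = 0"
        unfolding h_def using rad[OF x] by blast
      then have "\<omega> h y = \<gamma> y * \<omega> h r"
        using r y by (simp add: functional_diff[OF \<omega>(2)[OF h(2)]] functional_scale[OF \<omega>(2)[OF h(2)]])
      then show ?thesis unfolding \<omega>_def by simp
    qed
    then have "h = 0"
      using nd[OF h(2)] h(1) unfolding H_def by blast
    then show ?thesis unfolding h_def by simp
  qed
  define b where "b a = (if a = 2 * n then r else if even a then e (a div 2) else f (a div 2))" for a
  have "\<exists>c. frame (2 * n + 1) b c"
    unfolding b_def
  proof (rule exI, rule symplectic_frame[OF \<omega>(1) s r(1) \<gamma> r(2)])
    show "\<gamma> (e i) = 0 \<and> \<gamma> (f i) = 0" if "i < n" for i
      using ef[OF that] unfolding H_def by blast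
    show "x = symplectic_proj \<omega> n e f (x - \<gamma> x *s r) + \<gamma> x *s r" if "x \<in> L" for x
    proof -
      have "x - \<gamma> x *s r \<in> H"
        unfolding H_def using r that by (simp add: functional_diff[OF \<gamma>] functional_scale[OF \<gamma>])
      then show ?thesis by (simp add: proj)
    qed
  qed
  then obtain c where fr: "frame (2 * n + 1) b c" by blast
  have "wedge (2 * n) 1 (wedge_power 2 (\<lambda>v. \<omega> (v 0) (v 1)) n) (\<lambda>u. \<gamma> (u 0)) b \<noteq> 0"
  proof (rule wedge_power_hyperbolic_ne_0)
    show "\<omega> (b a) (b a') = of_int (hyperbolic a a')" if "a < 2 * n" "a' < 2 * n" for a a'
    proof -
      have "a div 2 < n" "a' div 2 < n" using that by linarith+
      then show ?thesis
        using that symplecticD(3-6)[OF s]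
        by (cases "even a"; cases "even a'")
            (auto simp: b_def hyperbolic_def even_iff_mod_2_eq_zero odd_iff_mod_2_eq_one)
    qed
    show "\<gamma> (b a) = 0" if "a < 2 * n" for a
    proof -
      have "a div 2 < n" using that by linarith
      then show ?thesis using that ef unfolding b_def H_def by auto
    qed
    show "\<gamma> (b (2 * n)) \<noteq> 0" using r by (simp add: b_def)
  qed
  then show contact
    unfolding contact_def differential_def linear_form_eq_functional
    using \<gamma> frame_dim[OF fr] frame_mem[OF fr] unfolding \<omega>_def by blast
qed

end

section \<open>Stabilizers and index 1\<close>

context fin_dim_lie_algebra begin

lemma subspace_stabilizer:
  assumes "functional \<gamma>" shows "subspace (stabilizer \<gamma>)"
proof (rule subspaceI)
  show "0 \<in> stabilizer \<gamma>"
    unfolding stabilizer_def by (simp add: br_0_left functional_0[OF assms])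
  show "x + y \<in> stabilizer \<gamma>" if "x \<in> stabilizer \<gamma>" "y \<in> stabilizer \<gamma>" for x y
    using that unfolding stabilizer_def by (simp add: br_add_left br_closed functional_add[OF assms])
  show "a *s x \<in> stabilizer \<gamma>" if "x \<in> stabilizer \<gamma>" for a x
    using that unfolding stabilizer_def by (simp add: br_scale_left br_closed functional_scale[OF assms])
qed

lemma index_1_stabilizer:
  assumes "index = 1"
  obtains \<gamma> v where "functional \<gamma>" "v \<noteq> 0" "stabilizer \<gamma> = range (\<lambda>a. a *s v)"
proof -
  have "linear_form (\<lambda>x. 0)" unfolding linear_form_def by simp
  then have "{dim (stabilizer \<gamma>) | \<gamma>. linear_form \<gamma>} \<noteq> {}" by blast
  from Inf_nat_def1[OF this] have "index \<in> {dim (stabilizer \<gamma>) | \<gamma>. linear_form \<gamma>}"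
    unfolding index_def .
  then obtain \<gamma> where \<gamma>: "functional \<gamma>" "dim (stabilizer \<gamma>) = 1"
    using assms unfolding linear_form_eq_functional by auto
  obtain B where B: "B \<subseteq> stabilizer \<gamma>" "independent B" "stabilizer \<gamma> \<subseteq> span B"
    "card B = dim (stabilizer \<gamma>)"
    using basis_exists[of "stabilizer \<gamma>"] by blast
  then obtain v where v: "B = {v}" using \<gamma>(2) card_1_singletonE by metis
  have "span B = stabilizer \<gamma>"
    using span_minimal[OF B(1) subspace_stabilizer[OF \<gamma>(1)]] B(3) by blast
  then have "stabilizer \<gamma> = range (\<lambda>a. a *s v)"
    unfolding v span_singleton by simp
  moreover have "v \<noteq> 0" using B(2) v dependent_zero by blast
  ultimately show thesis using that \<gamma>(1) by blast
qed

end

context split_lie_algebra begin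

text \<open>
  If the generator \<open>v\<close> of the stabilizer of \<open>\<gamma>\<close> satisfies \<open>\<gamma> v = 0\<close>, then \<open>\<gamma> y = \<gamma> [u, y]\<close> for
  some \<open>u\<close>, so the symplectic form \<open>\<omega> x y = \<gamma> [x, y]\<close> on \<open>L / K v\<close> satisfies
  \<open>\<omega> [u, x] y + \<omega> x [u, y] = \<omega> x y\<close>, and \<open>ad u\<close> has trace \<open>n\<close> there.  Hence unimodularity forces \<open>[u, v] = - n v\<close>.  A kernel vector
  \<open>(w, a)\<close> of the form of \<open>\<gamma> + t \<rho>\<close>, where \<open>\<rho> v = 1\<close>, then solves an eigenvalue equation for
  \<open>1 / t\<close>; the coefficient that must be inverted to derive it is \<open>n + 1\<close>.
\<close>

theorem exists_contact_form:
  assumes index: "index = 1" and unimodular: "\<And>x. x \<in> L \<Longrightarrow> trace (br x) = 0"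
  shows "\<exists>\<gamma>. contact_form \<gamma>"
proof -
  obtain \<gamma> v where \<gamma>: "functional \<gamma>" and v0: "v \<noteq> 0" and stab: "stabilizer \<gamma> = range (\<lambda>a. a *s v)"
    using index_1_stabilizer[OF index] by blast
  have "v \<in> stabilizer \<gamma>" using stab by (metis rangeI scale_one)
  then have v: "v \<in> L" "\<And>y. y \<in> L \<Longrightarrow> \<gamma> (br v y) = 0"
    unfolding stabilizer_def by auto
  show ?thesis
  proof (cases "\<gamma> v = 0")
    case False
    have "contact_form \<gamma>"
      unfolding contact_form_def
    proof (intro conjI \<gamma> ballI allI impI)
      fix w a assume w: "w \<in> L" and wa: "\<gamma> w = 0 \<and> (\<forall>y\<in>L. \<gamma> (br w y) = a * \<gamma> y)"
      have "\<gamma> (br w v) = 0"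
        using form_skew[OF \<gamma> v(1) w] v(2)[OF w] by simp
      then show "a = 0" using wa v(1) False by auto
      then have "w \<in> stabilizer \<gamma>" using w wa unfolding stabilizer_def by simp
      then obtain s where "w = s *s v" using stab by blast
      then show "w = 0" using wa False functional_scale[OF \<gamma> v(1)] by auto
    qed
    then show ?thesis by blast
  next
    case True
    define \<omega> where "\<omega> x y = \<gamma> (br x y)" for x y
    have \<omega>: "functional (\<lambda>x. \<omega> x y)" "functional (\<omega> y)" if "y \<in> L" for y
      using functional_form[OF \<gamma> that] unfolding \<omega>_def by simp_all
    have alt: "\<omega> x x = 0" if "x \<in> L" for x
      unfolding \<omega>_def using that by (simp add: br_self functional_0[OF \<gamma>])
    have skew: "\<omega> y x = - \<omega> x y" if "x \<in> L" "y \<in> L" for x y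
      unfolding \<omega>_def by (rule form_skew[OF \<gamma> that])
    have v\<omega>: "\<omega> v y = 0" "\<omega> y v = 0" if "y \<in> L" for y
      using v(2)[OF that] skew[OF v(1) that] unfolding \<omega>_def by simp_all
    obtain n e f where s: "symplectic \<omega> n e f"
      and rad: "\<And>x y. x \<in> L \<Longrightarrow> y \<in> L \<Longrightarrow> \<omega> (x - symplectic_proj \<omega> n e f x) y = 0"
      by (rule exists_symplectic[of \<omega> L])
        (assumption | rule \<omega> alt subspace_L subset_refl that)+
    note ef = symplecticD(1,2)[OF s]
    let ?p = "symplectic_proj \<omega> n e f"
    have pL: "?p x \<in> L" for x
      unfolding symplectic_proj_def by (rule symplectic_combination(1)[OF s])
    have "\<exists>a. x - ?p x = a *s v" if "x \<in> L" for x
    proof -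
      have "x - ?p x \<in> stabilizer \<gamma>"
        unfolding stabilizer_def using rad[OF that] that pL by (simp add: \<omega>_def)
      then show ?thesis using stab by blast
    qed
    \<comment> \<open>The coordinate along \<open>v\<close> relative to the complement spanned by
      the symplectic system: what the projection misses lies in the stabilizer.\<close>
    then obtain \<rho> where \<rho>p: "\<And>x. x \<in> L \<Longrightarrow> x - ?p x = \<rho> x *s v" by metis
    have \<rho>_unique: "\<rho> x = a" if "x \<in> L" "x - ?p x = a *s v" for x a
      using \<rho>p[OF that(1)] that(2) v0 by simp
    have padd: "?p (x + y) = ?p x + ?p y" if "x \<in> L" "y \<in> L" for x y
      unfolding symplectic_proj_def using that ef
      by (simp add: functional_add[OF \<omega>(1)] scale_left_distrib sum.distrib)
    have pscale: "?p (a *s x) = a *s ?p x" if "x \<in> L" for a x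
      unfolding symplectic_proj_def using that ef
      by (simp add: functional_scale[OF \<omega>(1)] scale_right_diff_distrib scale_sum_right)
    have \<rho>: "functional \<rho>"
      unfolding functional_def
    proof (intro conjI ballI allI)
      fix x y assume xy: "x \<in> L" "y \<in> L"
      have "x + y - ?p (x + y) = (x - ?p x) + (y - ?p y)"
        unfolding padd[OF xy] by simp
      also have "\<dots> = (\<rho> x + \<rho> y) *s v"
        using \<rho>p xy by (simp add: scale_left_distrib)
      finally show "\<rho> (x + y) = \<rho> x + \<rho> y" using xy by (intro \<rho>_unique) auto
    next
      fix a x assume x: "x \<in> L"
      have "a *s x - ?p (a *s x) = a *s (x - ?p x)"
        unfolding pscale[OF x] by (simp add: scale_right_diff_distrib)
      also have "\<dots> = (a * \<rho> x) *s v"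
        using \<rho>p x by simp
      finally show "\<rho> (a *s x) = a * \<rho> x" using x by (intro \<rho>_unique) auto
    qed
    have p0: "?p x = 0" if "x \<in> L" "\<And>y. y \<in> L \<Longrightarrow> \<omega> x y = 0" for x
      unfolding symplectic_proj_def using that ef by simp
    have \<rho>v: "\<rho> v = 1"
      using v p0[OF v(1)] v\<omega> by (intro \<rho>_unique) auto
    have \<rho>ef: "\<rho> (e i) = 0" "\<rho> (f i) = 0" if "i < n" for i
      using ef[OF that] symplectic_proj_basis[OF s that] by (auto intro: \<rho>_unique)
    have expand: "x = ?p x + \<rho> x *s v" if "x \<in> L" for x
      using \<rho>p[OF that] by (simp add: algebra_simps)

    \<comment> \<open>The vector representing \<open>\<gamma>\<close> through
      \<open>\<omega>\<close>, with coefficients read off from the symplectic basis; it works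
      because \<open>\<gamma> v = 0\<close>.\<close>
    define u where "u = (\<Sum>i<n. \<gamma> (f i) *s e i) - (\<Sum>i<n. \<gamma> (e i) *s f i)"
    have u: "u \<in> L" unfolding u_def by (rule symplectic_combination(1)[OF s])
    have \<rho>u: "\<rho> u = 0"
      unfolding u_def symplectic_combination(2)[OF s \<rho>] by (simp add: \<rho>ef)
    have u\<gamma>: "\<gamma> (br u y) = \<gamma> y" if y: "y \<in> L" for y
    proof -
      have "\<gamma> y = \<gamma> (?p y + \<rho> y *s v)" by (rule arg_cong[OF expand[OF y]])
      also have "\<dots> = \<gamma> (?p y)"
        using functional_add[OF \<gamma> pL] v(1) functional_scale[OF \<gamma> v(1)] True by simp
      also have "\<dots> = (\<Sum>i<n. \<omega> y (f i) * \<gamma> (e i)) - (\<Sum>i<n. \<omega> y (e i) * \<gamma> (f i))"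
        unfolding symplectic_proj_def symplectic_combination(2)[OF s \<gamma>] ..
      also have "\<dots> = (\<Sum>i<n. \<gamma> (f i) * \<omega> (e i) y) - (\<Sum>i<n. \<gamma> (e i) * \<omega> (f i) y)"
        using skew[OF y] ef by (simp add: sum_negf mult.commute)
      also have "\<dots> = \<omega> u y"
        unfolding u_def symplectic_combination(2)[OF s \<omega>(1)[OF y]] ..
      finally show ?thesis unfolding \<omega>_def by simp
    qed
    have \<gamma>u: "\<gamma> u = 0"
      using u\<gamma>[OF u] u by (simp add: br_self functional_0[OF \<gamma>])

    \<comment> \<open>Composition with \<open>ad u\<close> fixes \<open>\<gamma>\<close>, so
      \<open>ad u\<close> maps the stabilizer of \<open>\<gamma>\<close> into itself.\<close>
    have "br u v \<in> stabilizer \<gamma>"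
    proof -
      have "\<gamma> (br (br u v) y) = 0" if y: "y \<in> L" for y
      proof -
        have "\<gamma> (br u (br v y)) = \<gamma> (br (br u v) y) + \<gamma> (br v (br u y))"
          unfolding br_derivation[OF u v(1) y]
          using u v(1) y by (intro functional_add[OF \<gamma>] br_closed)
        then show ?thesis
          using u\<gamma>[OF br_closed[OF v(1) y]] v(2)[OF y] v(2)[OF br_closed[OF u y]] by simp
      qed
      then show ?thesis unfolding stabilizer_def using u v(1) br_closed by simp
    qed
    then have uv: "br u v = \<rho> (br u v) *s v"
      using stab functional_scale[OF \<rho> v(1)] \<rho>v by force
    have hp: "?p (x - \<rho> x *s v) = ?p x" if "x \<in> L" for x
    proof -
      have "?p (x - \<rho> x *s v + \<rho> x *s v) = ?p (x - \<rho> x *s v) + ?p (\<rho> x *s v)"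
        using that v(1) by (intro padd) auto
      then show ?thesis using pscale[OF v(1)] p0[OF v(1) v\<omega>(1)] by simp
    qed
    have fr: "frame (2 * n + 1)
      (\<lambda>a. if a = 2 * n then v else if even a then e (a div 2) else f (a div 2))
      (\<lambda>a x. if a = 2 * n then \<rho> x else if even a then \<omega> (x - \<rho> x *s v) (f (a div 2))
        else - \<omega> (x - \<rho> x *s v) (e (a div 2)))"
    proof (rule symplectic_frame[OF \<omega>(1) s v(1) \<rho> \<rho>v])
      show "\<rho> (e i) = 0 \<and> \<rho> (f i) = 0" if "i < n" for i using \<rho>ef[OF that] by simp
      show "x = ?p (x - \<rho> x *s v) + \<rho> x *s v" if "x \<in> L" for x
        unfolding hp[OF that] by (rule expand[OF that])
    qed
    have \<omega>h: "\<omega> (x - \<rho> x *s v) y = \<omega> x y" if "x \<in> L" "y \<in> L" for x y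
      using that v(1) v\<omega>(1)[OF that(2)]
      by (simp add: functional_diff[OF \<omega>(1)] functional_scale[OF \<omega>(1)])
    have "trace (br u) = of_nat n + \<rho> (br u v)"
    proof -
      \<comment> \<open>The two diagonal entries of \<open>ad u\<close> at \<open>e i\<close> and
        \<open>f i\<close> add up to 1, since
        \<open>\<gamma> [u, [e i, f i]] = \<gamma> [e i, f i] = 1\<close>.\<close>
      have pair: "\<omega> (br u (e i)) (f i) - \<omega> (br u (f i)) (e i) = 1" if i: "i < n" for i
      proof -
        note L = ef[OF i]
        have "\<gamma> (br u (br (e i) (f i))) = \<omega> (br u (e i)) (f i) + \<omega> (e i) (br u (f i))"
          unfolding br_derivation[OF u L] \<omega>_def
          using u L by (intro functional_add[OF \<gamma>] br_closed)
        moreover have "\<omega> (e i) (br u (f i)) = - \<omega> (br u (f i)) (e i)"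
          using u L br_closed by (intro skew) auto
        moreover have "\<gamma> (br u (br (e i) (f i))) = 1"
          using u\<gamma>[OF br_closed[OF L]] symplecticD(3)[OF s i i] unfolding \<omega>_def by simp
        ultimately show ?thesis by simp
      qed
      show ?thesis
        unfolding trace_eq[OF fr endo_br[OF u]]
        using pair by (simp add: sum_lessThan_double \<omega>h ef u br_closed)
    qed
    then have \<epsilon>: "\<rho> (br u v) = - of_nat n"
      using unimodular[OF u] by (simp add: eq_neg_iff_add_eq_0 add.commute)

    define m where "m = 1 + (of_nat n :: 'k)"
    have m: "m \<noteq> 0" unfolding m_def by (metis of_nat_Suc of_nat_neq_0)
    \<comment> \<open>A kernel vector \<open>(w, a)\<close> will be written as
      \<open>w = x + a *s u + \<rho> w *s v\<close>. Its equation at \<open>v\<close> determines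
      \<open>a\<close> as \<open>ca x\<close>; its equation at \<open>u\<close>, combined with the
      condition that the perturbed form vanishes at \<open>w\<close>, determines
      \<open>\<rho> w\<close> as \<open>cb x\<close>. Both require division by \<open>m\<close>, and
      \<open>w\<close> becomes \<open>G x\<close>.\<close>
    define ca cb where "ca x = \<rho> (br x v) / m" and "cb x = - \<rho> (br x u) / m" for x
    define G where "G x = x + ca x *s u + cb x *s v" for x
    \<comment> \<open>The kernel equation takes the form
      \<open>\<omega> x y = t * \<beta> x y\<close>. Inserting it into the symplectic expansion of
      \<open>x\<close> gives \<open>x = t *s S x\<close>.\<close>
    define \<beta> where "\<beta> x y = ca x * \<rho> y - \<rho> (br (G x) y)" for x y
    define S where "S x = (\<Sum>i<n. \<beta> x (f i) *s e i) - (\<Sum>i<n. \<beta> x (e i) *s f i)" for x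
    have ca: "functional ca" and cb: "functional cb"
      unfolding functional_def ca_def cb_def
      by (auto simp: functional_add[OF functional_form(1)[OF \<rho> u]]
          functional_scale[OF functional_form(1)[OF \<rho> u]]
          functional_add[OF functional_form(1)[OF \<rho> v(1)]]
          functional_scale[OF functional_form(1)[OF \<rho> v(1)]] add_divide_distrib diff_divide_distrib)
    have G: "endo G"
      unfolding endo_def G_def using u v(1)
      by (simp add: functional_add[OF ca] functional_add[OF cb] functional_scale[OF ca]
          functional_scale[OF cb] scale_left_distrib scale_right_distrib)
    have \<beta>: "functional (\<lambda>x. \<beta> x y)" if y: "y \<in> L" for y
    proof -
      have "functional (\<lambda>x. \<rho> (br (G x) y))"
        by (rule functional_endo[OF functional_form(1)[OF \<rho> y] G])
      then show ?thesis
        unfolding functional_def \<beta>_def using functional_add[OF ca] functional_scale[OF ca]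
        by (simp add: algebra_simps)
    qed
    have S: "endo S"
      unfolding endo_def
    proof (intro conjI ballI allI)
      show "S x \<in> L" for x
        unfolding S_def by (rule symplectic_combination(1)[OF s])
      show "S (x + y) = S x + S y" if "x \<in> L" "y \<in> L" for x y
        unfolding S_def using that ef
        by (simp add: functional_add[OF \<beta>] scale_left_distrib sum.distrib)
      show "S (a *s x) = a *s S x" if "x \<in> L" for a x
        unfolding S_def using that ef
        by (simp add: functional_scale[OF \<beta>] scale_right_diff_distrib scale_sum_right)
    qed
    obtain d b c \<theta> where tri: "frame d b c" "triangular S d b \<theta>"
      using exists_triangular_frame[OF S] by blast
    have "finite (insert 0 (\<theta> ` {..<d}))" by simp
    \<comment> \<open>\<open>S\<close> does not depend on \<open>t\<close>, so it suffices to avoid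
      0 and the finitely many eigenvalues of \<open>S\<close>.\<close>
    then obtain \<mu> where \<mu>: "\<mu> \<noteq> 0" "\<mu> \<notin> \<theta> ` {..<d}"
      using ex_new_if_finite[OF infinite_UNIV_char_0] by (metis insert_iff)
    define t where "t = 1 / \<mu>"
    have t: "t \<noteq> 0" unfolding t_def using \<mu>(1) by simp
    have "contact_form (\<lambda>x. \<gamma> x + t * \<rho> x)"
      unfolding contact_form_def
    proof (intro conjI ballI allI impI)
      show "functional (\<lambda>x. \<gamma> x + t * \<rho> x)"
        using \<gamma> \<rho> unfolding functional_def by (simp add: algebra_simps)
      fix w a
      assume w: "w \<in> L" and wa: "\<gamma> w + t * \<rho> w = 0 \<and>
        (\<forall>y\<in>L. \<gamma> (br w y) + t * \<rho> (br w y) = a * (\<gamma> y + t * \<rho> y))"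
      \<comment> \<open>Subtracting \<open>a *s u\<close> cancels the term
        \<open>a * \<gamma> y\<close>, and subtracting the multiple of \<open>v\<close> leaves
        \<open>\<omega>\<close> unchanged while making \<open>\<rho> x = 0\<close>; every remaining
        term carries the factor \<open>t\<close>.\<close>
      define x where "x = w - a *s u - \<rho> w *s v"
      have x: "x \<in> L" unfolding x_def using w u v(1) by simp
      have wx: "w = x + a *s u + \<rho> w *s v" unfolding x_def by simp
      have au: "a *s u \<in> L" and \<rho>wv: "\<rho> w *s v \<in> L" using u v(1) by auto
      have \<rho>x: "\<rho> x = 0"
        unfolding x_def using w u v(1)
        by (simp add: functional_diff[OF \<rho>] functional_scale[OF \<rho>] \<rho>u \<rho>v)
      have \<omega>x: "\<omega> x y = t * (a * \<rho> y - \<rho> (br w y))" if y: "y \<in> L" for y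
      proof -
        have "\<omega> x y = \<omega> w y - a * \<omega> u y - \<rho> w * \<omega> v y"
          unfolding x_def using w u v(1) y
          by (simp add: functional_diff[OF \<omega>(1)] functional_scale[OF \<omega>(1)])
        also have "\<dots> = \<gamma> (br w y) - a * \<gamma> y"
          using u\<gamma>[OF y] v\<omega>(1)[OF y] unfolding \<omega>_def by simp
        also have "\<dots> = t * (a * \<rho> y - \<rho> (br w y))"
          using wa y by (simp add: algebra_simps)
        finally show ?thesis .
      qed
      have \<rho>w: "\<rho> (br w y) = \<rho> (br x y) + a * \<rho> (br u y) + \<rho> w * \<rho> (br v y)" if y: "y \<in> L" for y
      proof -
        note g = functional_form(1)[OF \<rho> y]
        have "\<rho> (br w y) = \<rho> (br (x + a *s u + \<rho> w *s v) y)"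
          by (rule arg_cong[where f = "\<lambda>w. \<rho> (br w y)", OF wx])
        also have "\<dots> = \<rho> (br x y) + a * \<rho> (br u y) + \<rho> w * \<rho> (br v y)"
          using functional_add[OF g, of "x + a *s u" "\<rho> w *s v"] functional_add[OF g x au]
            functional_scale[OF g u] functional_scale[OF g v(1)] x au \<rho>wv by simp
        finally show ?thesis .
      qed
      have "a = \<rho> (br w v)"
        using \<omega>x[OF v(1)] v\<omega>(2)[OF x] t \<rho>v by simp
      also have "\<dots> = \<rho> (br x v) - a * of_nat n"
        using \<rho>w[OF v(1)] \<epsilon> v(1) by (simp add: br_self functional_0[OF \<rho>])
      finally have "a * m = \<rho> (br x v)"
        unfolding m_def by (simp add: algebra_simps)
      then have a: "a = ca x" unfolding ca_def using m by (simp add: field_simps)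
      have "\<rho> (br v u) = of_nat n"
        using form_skew[OF \<rho> u v(1)] \<epsilon> by simp
      then have "\<rho> (br w u) = \<rho> (br x u) + \<rho> w * of_nat n"
        using \<rho>w[OF u] u by (simp add: br_self functional_0[OF \<rho>])
      then have "\<omega> x u = - t * (\<rho> (br x u) + \<rho> w * of_nat n)"
        using \<omega>x[OF u] \<rho>u by (simp add: algebra_simps)
      moreover have "\<omega> x u = - \<gamma> x"
        using skew[OF u x] u\<gamma>[OF x] unfolding \<omega>_def by simp
      moreover have "\<gamma> w = \<gamma> x"
        unfolding x_def using w u v(1) True
        by (simp add: functional_diff[OF \<gamma>] functional_scale[OF \<gamma>] \<gamma>u)
      moreover have "\<gamma> w = - t * \<rho> w"
        using wa by (simp add: eq_neg_iff_add_eq_0)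
      \<comment> \<open>Two expressions for \<open>\<gamma> w\<close>: one from the condition on
        \<open>w\<close>, the other from the equation at \<open>u\<close>. Cancelling
        \<open>t\<close> leaves a linear equation for \<open>\<rho> w\<close> with coefficient
        \<open>m\<close>.\<close>
      ultimately have "- (t * \<rho> w) = t * (\<rho> (br x u) + \<rho> w * of_nat n)" by simp
      then have "t * (- \<rho> w) = t * (\<rho> (br x u) + \<rho> w * of_nat n)"
        by (simp only: mult_minus_right)
      then have "- \<rho> w = \<rho> (br x u) + \<rho> w * of_nat n"
        by (rule mult_left_cancel[OF t, THEN iffD1])
      then have "- \<rho> (br x u) = \<rho> w + \<rho> w * of_nat n"
        by (metis add.commute add_uminus_conv_diff diff_eq_eq minus_add_cancel minus_equation_iff)
      then have "\<rho> w * m = - \<rho> (br x u)"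
        unfolding m_def by (simp add: distrib_left)
      then have \<rho>wx: "\<rho> w = cb x" unfolding cb_def using m by (simp add: field_simps)
      have wG: "w = G x" unfolding G_def using wx a \<rho>wx by simp
      have "x = ?p x" using expand[OF x] \<rho>x by simp
      also have "\<dots> = t *s S x"
        unfolding symplectic_proj_def S_def
        using \<omega>x ef wG a by (simp add: \<beta>_def scale_right_diff_distrib scale_sum_right)
      finally have xS: "x = t *s S x" .
      then have "\<mu> *s x = \<mu> *s (t *s S x)" by (rule arg_cong)
      then have "S x = \<mu> *s x" unfolding t_def using \<mu>(1) by simp
      then have "x = 0"
        using eigenvalue_in_triangular[OF tri S x] \<mu>(2) by blast
      then show "w = 0" "a = 0"
        using wG a functional_0[OF ca] functional_0[OF cb] by (simp_all add: G_def)
    qed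
    then show ?thesis by blast
  qed
qed

end

theorem corollary3p4:
  fixes Q :: "('g, 'm) monoid_scheme"
    and A :: "('g \<Rightarrow> 'k::{alg_closed_field, field_char_0}) set"
  defines "\<qq> \<equiv> affine_algebraic_group.Lie Q A"
  assumes "affine_algebraic_group Q A"
    and "connected_space (affine_variety.zariski (carrier Q) A)"
    and "fin_dim_lie_algebra.index op_scale \<qq> commutator = 1"
    and "\<forall>x \<in> fin_dim_lie_algebra.radical op_scale \<qq> commutator.
           fin_dim_lie_algebra.ad_nilpotent \<qq> commutator x"
  shows "fin_dim_lie_algebra.contact op_scale \<qq> commutator"
proof -
  interpret affine_algebraic_group Q A by fact
  interpret \<qq>: split_lie_algebra op_scale \<qq> commutator
    unfolding \<qq>_def
    by unfold_locales (rule alg_closed_imp_poly_has_root)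
  have "\<exists>\<gamma>. \<qq>.contact_form \<gamma>"
    using assms(4,5) by (intro \<qq>.exists_contact_form \<qq>.unimodular) auto
  then show ?thesis
    using \<qq>.contact_form_imp_contact by blast
qed

end
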